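(* For every $u\in L^2(S)$ we have $$\lim_{n\to+\infty}e^{tA_n^*}u=e^{tQ}Pu,\qquad t>0,$$ in $L^2(S)$. The convergence is uniform (in $t$) on compact subsets of $(0,+\infty)$. If $u\in L^2_0(S)$, then the formula holds also for $t=0$, and the convergence is uniform on compact subsets of $[0,+\infty)$.
   Context: Graph. Let $\mathcal G=(\mathcal V,\mathcal E)$ be a finite directed geometric graph in $\mathbb R^3$ without loops: $\mathcal V$ is the finite set of vertices and the edges $E_1,\dots,E_N$ are $C^1$ curves of finite lengths $d_i>0$ connecting vertices; put $\mathcal N=\{1,\dots,N\}$, $\mathbb N=\{1,2,\dots\}$. The initial and terminal vertices of $E_i$ are denoted $L_i$ (left endpoint) and $R_i$ (right endpoint); $L_i\ne R_i$ as vertices. $S$ is the disjoint union of the edges. Each $E_i$ is identified with $[0,d_i]$ by arc length, $L_i$ corresponding to $0$ and $R_i$ to $d_i$. A function $u$ on $S$ is identified with $(u_i)_{i\in\mathcal N}$, $u_i$ a function on $[0,d_i]$; $u(L_i)=u_i(0)$, $u(R_i)=u_i(d_i)$, $u'(L_i)=u_i'(0)$, $u'(R_i)=u_i'(d_i)$. Coefficients. $\sigma_i>0$ ($i\in\mathcal N$) are given and $\sigma$ is the function on $S$ equal to $\sigma_i$ on $E_i$. $l_i,r_i\ge 0$ and, for $i\neq j$, $l_{ij},r_{ij}\ge 0$ are real numbers with $\sum_{j\ne i}l_{ij}\le l_i$, $\sum_{j\neq i}r_{ij}\le r_i$; $l_{ij}=0$ if $E_j$ is not incident with the vertex $L_i$,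 and $r_{ij}=0$ if $E_j$ is not incident with the vertex $R_i$. $(\kappa_n)_{n\in\mathbb N}$ is a nondecreasing sequence of positive numbers converging to $+\infty$. Spaces and operators. $L^2(S)=\{u=(u_i)_{i\in\mathcal N}:u_i\in L^2(0,d_i)\}$ is the complex Hilbert space with $\langle u,v\rangle_{L^2(S)}=\sum_i\int_0^{d_i}u_i\overline{v_i}$. $H^2(S)$ is the set of $u\in L^2(S)$ with $u,u'$ weakly differentiable (on each edge) and $u',u''\in L^2(S)$. Functionals $F_{L,i},F_{R,i}$ on $H^2(S)$ are defined by $$\sigma_iF_{L,i}u=\sigma_il_iu(L_i)-\sum_{j\neq i:\,L_j=L_i}\sigma_jl_{ji}u(L_j)-\sum_{j\ne i:\,R_j=L_i}\sigma_jr_{ji}u(R_j),$$ $$\sigma_iF_{R,i}u=\sum_{j\neq i:\,L_j=R_i}\sigma_jl_{ji}u(L_j)+\sum_{j\ne i:\,R_j=R_i}\sigma_jr_{ji}u(R_j)-\sigma_ir_iu(R_i),$$ where equalities under the sums are equalities of vertices in $\mathcal V$. Then $A_n^*u=\kappa_n\sigma u''$ with $D(A_n^* )=\{u\in H^2(S):\ \kappa_nu'(L_i)=F_{L,i}u,\ \kappa_nu'(R_i)=F_{R,i}u,\ i\in\mathcal N\}$. Each $A_n^*$ generates a holomorphic semigroup $\{e^{tA_n^*}\}_{t\ge0}$ in $L^2(S)$. Limit objects. $L^2_0(S)\subset L^2(S)$ is the closed subspace of complex functions constant on each edge. $P$ is the projection of $L^2(S)$ onto $L^2_0(S)$ given by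 $Pu=\bigl(d_i^{-1}\int_{E_i}u_i\bigr)_{i\in\mathcal N}$. $Q$ is the operator in $L^2_0(S)$ given, for $u=(u_i)_{i\in\mathcal N}$ with $u_i$ the constant value on $E_i$, by $Qu=\bigl(\sum_{j\ne i}q_{ij}u_j+q_{ii}u_i\bigr)_{i\in\mathcal N}$, where $q_{ij}=\sigma_jd_i^{-1}(l_{ji}+r_{ji})$ for $i\neq j$ and $q_{ii}=-\sigma_id_i^{-1}(l_i+r_i)$. *)

theory Defs
  imports "HOL-Analysis.Analysis"
begin

text \<open>
  The index type \<open>'e\<close> of edges is finite.  Each edge is a curve on \<open>{0..1}\<close>, so that its orientation
  determines the left endpoint \<open>pathstart\<close> and the right endpoint \<open>pathfinish\<close>.
  The diagonal values of \<open>lout\<close> and \<open>rout\<close> carry no meaning and are never used.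
\<close>

record 'e network =
  verts :: "(real^3) set"
  curve :: "'e \<Rightarrow> real \<Rightarrow> real^3"
  sig   :: "'e \<Rightarrow> real"           \<comment> \<open>\<open>\<sigma>\<^sub>i\<close>\<close>
  lperm :: "'e \<Rightarrow> real"           \<comment> \<open>\<open>l\<^sub>i\<close>\<close>
  rperm :: "'e \<Rightarrow> real"           \<comment> \<open>\<open>r\<^sub>i\<close>\<close>
  lout  :: "'e \<Rightarrow> 'e \<Rightarrow> real"     \<comment> \<open>\<open>lout G i j\<close> is \<open>l\<^sub>i\<^sub>j\<close>\<close>
  rout  :: "'e \<Rightarrow> 'e \<Rightarrow> real"     \<comment> \<open>\<open>rout G i j\<close> is \<open>r\<^sub>i\<^sub>j\<close>\<close>

definition L_end :: "'e network \<Rightarrow> 'e \<Rightarrow> real^3" where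
  "L_end G i = pathstart (curve G i)"

definition R_end :: "'e network \<Rightarrow> 'e \<Rightarrow> real^3" where
  "R_end G i = pathfinish (curve G i)"

definition len :: "'e network \<Rightarrow> 'e \<Rightarrow> real" where
  "len G i = integral {0..1} (\<lambda>t. norm (vector_derivative (curve G i) (at t within {0..1})))"

text \<open>One-sided derivatives at the endpoints, unlike the library's \<open>C1_differentiable_on\<close>.\<close>

definition C1_curve :: "(real \<Rightarrow> real^3) \<Rightarrow> bool" where
  "C1_curve g \<longleftrightarrow> (\<exists>D. continuous_on {0..1} D \<and>
     (\<forall>t\<in>{0..1}. (g has_vector_derivative D t) (at t within {0..1})))"

definition incident :: "'e network \<Rightarrow> 'e \<Rightarrow> real^3 \<Rightarrow> bool" where
  "incident G j v \<longleftrightarrow> v = L_end G j \<or> v = R_end G j"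

definition is_network :: "('e::finite) network \<Rightarrow> bool" where
  "is_network G \<longleftrightarrow>
     finite (verts G) \<and>
     (\<forall>i. C1_curve (curve G i) \<and> L_end G i \<in> verts G \<and> R_end G i \<in> verts G \<and>
          L_end G i \<noteq> R_end G i \<and> len G i > 0) \<and>
     (\<forall>i. sig G i > 0 \<and> lperm G i \<ge> 0 \<and> rperm G i \<ge> 0) \<and>
     (\<forall>i j. i \<noteq> j \<longrightarrow> lout G i j \<ge> 0 \<and> rout G i j \<ge> 0) \<and>
     (\<forall>i. (\<Sum>j\<in>UNIV - {i}. lout G i j) \<le> lperm G i \<and>
          (\<Sum>j\<in>UNIV - {i}. rout G i j) \<le> rperm G i) \<and>
     (\<forall>i j. i \<noteq> j \<and> \<not> incident G j (L_end G i) \<longrightarrow> lout G i j = 0) \<and>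
     (\<forall>i j. i \<noteq> j \<and> \<not> incident G j (R_end G i) \<longrightarrow> rout G i j = 0)"

text \<open>
  Elements of \<open>L\<^sup>2(S)\<close> are represented by families of functions \<open>u i\<close>, of which only the
  restriction to \<open>[0, d i]\<close> matters, and only up to equality almost everywhere (\<open>L2_eq\<close>);
  here \<open>d\<close> is the family of edge lengths.
\<close>

type_synonym 'e edgefun = "'e \<Rightarrow> real \<Rightarrow> complex"

definition L2I :: "real \<Rightarrow> (real \<Rightarrow> complex) set" where
  "L2I D = {f \<in> borel_measurable (lebesgue_on {0..D}).
              integrable (lebesgue_on {0..D}) (\<lambda>x. (cmod (f x))\<^sup>2)}"

definition L2S :: "('e \<Rightarrow> real) \<Rightarrow> 'e edgefun set" where
  "L2S d = {u. \<forall>i. u i \<in> L2I (d i)}"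

definition L2_eq :: "('e \<Rightarrow> real) \<Rightarrow> 'e edgefun \<Rightarrow> 'e edgefun \<Rightarrow> bool" where
  "L2_eq d u v \<longleftrightarrow> (\<forall>i. AE x in lebesgue_on {0..d i}. u i x = v i x)"

definition L2_inner :: "('e::finite \<Rightarrow> real) \<Rightarrow> 'e edgefun \<Rightarrow> 'e edgefun \<Rightarrow> complex" where
  "L2_inner d u v = (\<Sum>i\<in>UNIV. integral\<^sup>L (lebesgue_on {0..d i}) (\<lambda>x. u i x * cnj (v i x)))"

definition L2_norm :: "('e::finite \<Rightarrow> real) \<Rightarrow> 'e edgefun \<Rightarrow> real" where
  "L2_norm d u = sqrt (Re (L2_inner d u u))"

definition L2_dist :: "('e::finite \<Rightarrow> real) \<Rightarrow> 'e edgefun \<Rightarrow> 'e edgefun \<Rightarrow> real" where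
  "L2_dist d u v = L2_norm d (\<lambda>i x. u i x - v i x)"

definition test_fun :: "real \<Rightarrow> (real \<Rightarrow> real) \<Rightarrow> bool" where
  "test_fun D \<phi> \<longleftrightarrow> (\<forall>k x. (deriv ^^ k) \<phi> differentiable (at x)) \<and>
     (\<exists>a b. 0 < a \<and> b < D \<and> (\<forall>x. x \<notin> {a..b} \<longrightarrow> \<phi> x = 0))"

definition has_weak_deriv :: "real \<Rightarrow> (real \<Rightarrow> complex) \<Rightarrow> (real \<Rightarrow> complex) \<Rightarrow> bool" where
  "has_weak_deriv D f g \<longleftrightarrow> (\<forall>\<phi>. test_fun D \<phi> \<longrightarrow>
     integral\<^sup>L (lebesgue_on {0..D}) (\<lambda>x. f x * complex_of_real (deriv \<phi> x)) =
     - integral\<^sup>L (lebesgue_on {0..D}) (\<lambda>x. g x * complex_of_real (\<phi> x)))"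

text \<open>A representative of the weak derivative; it is determined almost everywhere on \<open>[0, D]\<close>.\<close>

definition wderiv :: "real \<Rightarrow> (real \<Rightarrow> complex) \<Rightarrow> real \<Rightarrow> complex" where
  "wderiv D f = (SOME g. g \<in> L2I D \<and> has_weak_deriv D f g)"

definition H2S :: "('e \<Rightarrow> real) \<Rightarrow> 'e edgefun set" where
  "H2S d = {u \<in> L2S d. \<exists>v\<in>L2S d. \<exists>w\<in>L2S d.
     \<forall>i. has_weak_deriv (d i) (u i) (v i) \<and> has_weak_deriv (d i) (v i) (w i)}"

text \<open>
  Value at a point of the continuous representative on \<open>[0, D]\<close>.  For \<open>D > 0\<close> such a representative
  is unique, and it exists whenever \<open>f\<close> has a weak derivative in \<open>L2I D\<close>.
\<close>

definition cval :: "real \<Rightarrow> (real \<Rightarrow> complex) \<Rightarrow> real \<Rightarrow> complex" where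
  "cval D f x = (THE c. \<exists>h. continuous_on {0..D} h \<and>
     (AE y in lebesgue_on {0..D}. h y = f y) \<and> h x = c)"

definition at_L :: "'e network \<Rightarrow> 'e edgefun \<Rightarrow> 'e \<Rightarrow> complex" where
  "at_L G u i = cval (len G i) (u i) 0"

definition at_R :: "'e network \<Rightarrow> 'e edgefun \<Rightarrow> 'e \<Rightarrow> complex" where
  "at_R G u i = cval (len G i) (u i) (len G i)"

definition Diff :: "'e network \<Rightarrow> 'e edgefun \<Rightarrow> 'e edgefun" where
  "Diff G u = (\<lambda>i. wderiv (len G i) (u i))"

definition F_L :: "('e::finite) network \<Rightarrow> 'e \<Rightarrow> 'e edgefun \<Rightarrow> complex" where
  "F_L G i u =
     (of_real (sig G i * lperm G i) * at_L G u i
      - (\<Sum>j | j \<noteq> i \<and> L_end G j = L_end G i. of_real (sig G j * lout G j i) * at_L G u j)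
      - (\<Sum>j | j \<noteq> i \<and> R_end G j = L_end G i. of_real (sig G j * rout G j i) * at_R G u j))
     / of_real (sig G i)"

definition F_R :: "('e::finite) network \<Rightarrow> 'e \<Rightarrow> 'e edgefun \<Rightarrow> complex" where
  "F_R G i u =
     ((\<Sum>j | j \<noteq> i \<and> L_end G j = R_end G i. of_real (sig G j * lout G j i) * at_L G u j)
      + (\<Sum>j | j \<noteq> i \<and> R_end G j = R_end G i. of_real (sig G j * rout G j i) * at_R G u j)
      - of_real (sig G i * rperm G i) * at_R G u i)
     / of_real (sig G i)"

definition dom_Astar :: "('e::finite) network \<Rightarrow> real \<Rightarrow> 'e edgefun set" where
  "dom_Astar G k = {u \<in> H2S (len G). \<forall>i.
     of_real k * at_L G (Diff G u) i = F_L G i u \<and>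
     of_real k * at_R G (Diff G u) i = F_R G i u}"

definition Astar :: "'e network \<Rightarrow> real \<Rightarrow> 'e edgefun \<Rightarrow> 'e edgefun" where
  "Astar G k u = (\<lambda>i x. of_real (k * sig G i) * Diff G (Diff G u) i x)"

definition C0_semigroup ::
  "('e::finite \<Rightarrow> real) \<Rightarrow> (real \<Rightarrow> 'e edgefun \<Rightarrow> 'e edgefun) \<Rightarrow> bool" where
  "C0_semigroup d T \<longleftrightarrow>
     (\<forall>t\<ge>0. \<forall>u\<in>L2S d. T t u \<in> L2S d) \<and>
     (\<forall>t\<ge>0. \<forall>u\<in>L2S d. \<forall>v\<in>L2S d. \<forall>a b.
        L2_eq d (T t (\<lambda>i x. a * u i x + b * v i x)) (\<lambda>i x. a * T t u i x + b * T t v i x)) \<and>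
     (\<forall>t\<ge>0. \<exists>C. \<forall>u\<in>L2S d. L2_norm d (T t u) \<le> C * L2_norm d u) \<and>
     (\<forall>u\<in>L2S d. L2_eq d (T 0 u) u) \<and>
     (\<forall>s\<ge>0. \<forall>t\<ge>0. \<forall>u\<in>L2S d. L2_eq d (T (s + t) u) (T s (T t u))) \<and>
     (\<forall>u\<in>L2S d. ((\<lambda>t. L2_dist d (T t u) u) \<longlongrightarrow> 0) (at_right 0))"

definition in_generator ::
  "('e::finite \<Rightarrow> real) \<Rightarrow> (real \<Rightarrow> 'e edgefun \<Rightarrow> 'e edgefun) \<Rightarrow> 'e edgefun \<Rightarrow> 'e edgefun \<Rightarrow> bool" where
  "in_generator d T u w \<longleftrightarrow> u \<in> L2S d \<and> w \<in> L2S d \<and>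
     ((\<lambda>h. L2_dist d (\<lambda>i x. (T h u i x - u i x) / of_real h) w) \<longlongrightarrow> 0) (at_right 0)"

definition generates ::
  "('e::finite \<Rightarrow> real) \<Rightarrow> 'e edgefun set \<Rightarrow> ('e edgefun \<Rightarrow> 'e edgefun)
    \<Rightarrow> (real \<Rightarrow> 'e edgefun \<Rightarrow> 'e edgefun) \<Rightarrow> bool" where
  "generates d D A T \<longleftrightarrow> C0_semigroup d T \<and>
     (\<forall>u\<in>L2S d. \<forall>w\<in>L2S d. in_generator d T u w \<longleftrightarrow> u \<in> D \<and> L2_eq d (A u) w)"

text \<open>
  An edgewise constant function is identified with the vector of its values; \<open>edge_const\<close> turns
  the vector back into a function on \<open>S\<close>.
\<close>

definition edge_const :: "complex^'e \<Rightarrow> 'e edgefun" where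
  "edge_const c = (\<lambda>i x. c $ i)"

definition L20S :: "('e::finite \<Rightarrow> real) \<Rightarrow> 'e edgefun set" where
  "L20S d = {u \<in> L2S d. \<exists>c. L2_eq d u (edge_const c)}"

definition Pavg :: "('e::finite) network \<Rightarrow> 'e edgefun \<Rightarrow> complex^'e" where
  "Pavg G u = (\<chi> i. integral\<^sup>L (lebesgue_on {0..len G i}) (u i) / of_real (len G i))"

definition q :: "'e network \<Rightarrow> 'e \<Rightarrow> 'e \<Rightarrow> real" where
  "q G i j = (if i = j then - (sig G i * (lperm G i + rperm G i) / len G i)
              else sig G j * (lout G j i + rout G j i) / len G i)"

definition Qop :: "('e::finite) network \<Rightarrow> complex^'e \<Rightarrow> complex^'e" where
  "Qop G c = (\<chi> i. (\<Sum>j\<in>UNIV - {i}. of_real (q G i j) * c $ j) + of_real (q G i i) * c $ i)"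

definition exp_tQ :: "('e::finite) network \<Rightarrow> real \<Rightarrow> complex^'e \<Rightarrow> complex^'e" where
  "exp_tQ G t c = (\<Sum>k. (t ^ k / fact k) *\<^sub>R (Qop G ^^ k) c)"

end

theory Submission
  imports Defs
begin

text \<open>
  The proof is an energy method and never constructs the semigroups.  For \<open>u\<close> in the domain of the
  generator let \<open>v(t) = T(t) u\<close>, let \<open>N\<close> be the sum of the squared \<open>L\<^sup>2\<close> norms of the first
  derivatives of \<open>v\<close>, \<open>E\<close> the squared norm of \<open>v\<close> weighted by \<open>1/\<sigma>\<^sub>i\<close>, \<open>W\<close> the weighted squared norm of
  \<open>v - P v\<close>, and \<open>Z = |P v - e\<^bsup>tQ\<^esup> P u|\<^sup>2\<close>.  Integrating by parts and bounding boundary values by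
  \<open>E\<close> and \<open>N\<close> gives, with a constant \<open>C\<close> that depends on the network only,
  \<open>E' \<le> -2\<kappa>N + C(E + N)\<close>, \<open>W' \<le> -2\<kappa>N + 2C(E + N)\<close>, \<open>W \<le> C N\<close> and \<open>Z' \<le> C(Z + N)\<close>, the last
  one because \<open>P A v - Q P v\<close> involves only differences between boundary values and edge means.
  For large \<open>\<kappa>\<close>, Gronwall's inequality for \<open>Z + (2C/\<kappa>) E\<close> bounds \<open>Z\<close> by a multiple of \<open>1/\<kappa>\<close>, and
  Gronwall's inequality for \<open>W\<close>, where \<open>-\<kappa>N \<le> -(\<kappa>/C) W\<close>, gives \<open>W(t) \<le> e\<^bsup>-\<kappa>t/C\<^esup> W(0) + O(1/\<kappa>)\<close>.
  The estimate extends from the dense domain to all initial values, and \<open>W(0) = 0\<close> when \<open>u\<close> is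
  constant on the edges.
\<close>

section \<open>Square-integrable functions on an interval\<close>

text \<open>The constant C must not depend on \<kappa>, although the generator does. After
  integration by parts \<kappa> multiplies only N and the endpoint derivatives, and on the domain
  \<kappa> times an endpoint derivative is \<open>F_L\<close> or \<open>F_R\<close>, free of
  \<kappa>. So \<kappa> survives only in front of N, where its sign helps. No bound on N by the
  initial value is available, so N is never followed in time: at each instant it is some nonnegative
  number that the dissipation absorbs. This dictates the factor 2C/\<kappa> of E, whose dissipation
  cancels the source 2CN of Z. Means and fluctuations are separated because they differ at small
  times: the means start at the right value, while the initial fluctuation is independent of
  \<kappa> and dies out in a layer of width of order 1/\<kappa>. Hence the compact sets away from 0.
  The semigroups are known only through the C0-laws, up to null sets, so two-sided differentiability
  of trajectories must be derived; from the left this takes bounds on T that are locally uniform in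
  time.\<close>

abbreviation lebI :: "real \<Rightarrow> real measure" where
  "lebI D \<equiv> lebesgue_on {0..D}"

abbreviation lint :: "real \<Rightarrow> (real \<Rightarrow> 'a::{banach, second_countable_topology}) \<Rightarrow> 'a" where
  "lint D f \<equiv> integral\<^sup>L (lebI D) f"

abbreviation ip :: "real \<Rightarrow> (real \<Rightarrow> complex) \<Rightarrow> (real \<Rightarrow> complex) \<Rightarrow> complex" where
  "ip D f g \<equiv> lint D (\<lambda>x. f x * cnj (g x))"

text \<open>A seminorm on functions rather than a norm on classes, since \<open>L2S\<close> consists
  of representatives; \<open>nrm_cong_AE\<close> passes between representatives and
  \<open>nrm_zero_imp_AE\<close> identifies its kernel.\<close>

definition nrm :: "real \<Rightarrow> (real \<Rightarrow> complex) \<Rightarrow> real" where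
  "nrm D f = sqrt (lint D (\<lambda>x. (cmod (f x))\<^sup>2))"

lemma nrm_nonneg [simp]: "nrm D f \<ge> 0"
  by (simp add: nrm_def)

lemma nrm_sq: "(nrm D f)\<^sup>2 = lint D (\<lambda>x. (cmod (f x))\<^sup>2)"
  by (simp add: nrm_def)

lemma measure_lebI: "D \<ge> 0 \<Longrightarrow> measure (lebI D) {0..D} = D"
  by (simp add: measure_restrict_space)

lemma finite_measure_lebI [simp]: "finite_measure (lebI D)"
  by (rule finite_measureI) (simp add: emeasure_restrict_space emeasure_lborel_Icc_eq)

lemma L2I_meas: "f \<in> L2I D \<Longrightarrow> f \<in> borel_measurable (lebI D)"
  by (simp add: L2I_def)

lemma L2I_sq_integrable:
  "f \<in> L2I D \<Longrightarrow> integrable (lebI D) (\<lambda>x. (cmod (f x))\<^sup>2)"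
  by (simp add: L2I_def)

lemma L2I_dominated:
  assumes "f \<in> borel_measurable (lebI D)" "integrable (lebI D) g"
    and "\<And>x. x \<in> {0..D} \<Longrightarrow> (cmod (f x))\<^sup>2 \<le> g x"
  shows "f \<in> L2I D"
proof -
  have "integrable (lebI D) (\<lambda>x. (cmod (f x))\<^sup>2)"
  proof (rule Bochner_Integration.integrable_bound[OF assms(2)])
    show "AE x in lebI D. norm ((cmod (f x))\<^sup>2) \<le> norm (g x)"
      using assms(3) by (intro AE_I2) (fastforce intro: order_trans[OF _ abs_ge_self])
  qed (use assms(1) in measurable)
  then show ?thesis using assms by (simp add: L2I_def)
qed

lemma L2I_add:
  assumes "f \<in> L2I D" "g \<in> L2I D" shows "(\<lambda>x. f x + g x) \<in> L2I D"
proof (rule L2I_dominated)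
  show "integrable (lebI D) (\<lambda>x. 2 * (cmod (f x))\<^sup>2 + 2 * (cmod (g x))\<^sup>2)"
    using assms by (intro Bochner_Integration.integrable_add integrable_mult_right L2I_sq_integrable)
  fix x
  have "(cmod (f x + g x))\<^sup>2 \<le> (cmod (f x) + cmod (g x))\<^sup>2"
    by (intro power_mono norm_triangle_ineq) auto
  also have "\<dots> \<le> 2 * (cmod (f x))\<^sup>2 + 2 * (cmod (g x))\<^sup>2"
    using sum_squares_bound[of "cmod (f x)" "cmod (g x)"] by (simp add: power2_sum)
  finally show "(cmod (f x + g x))\<^sup>2 \<le> 2 * (cmod (f x))\<^sup>2 + 2 * (cmod (g x))\<^sup>2" .
qed (use assms in \<open>auto intro: borel_measurable_add L2I_meas\<close>)

lemma L2I_cmult: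
  assumes "f \<in> L2I D" shows "(\<lambda>x. c * f x) \<in> L2I D"
  using assms by (auto simp: L2I_def norm_mult power_mult_distrib)

lemma L2I_cnj: "f \<in> L2I D \<Longrightarrow> (\<lambda>x. cnj (f x)) \<in> L2I D"
  by (auto simp: L2I_def intro: borel_measurable_continuous_on[where f=cnj] continuous_intros)

lemma L2I_uminus: "f \<in> L2I D \<Longrightarrow> (\<lambda>x. - f x) \<in> L2I D"
  by (auto simp: L2I_def)

lemma L2I_diff: "f \<in> L2I D \<Longrightarrow> g \<in> L2I D \<Longrightarrow> (\<lambda>x. f x - g x) \<in> L2I D"
  using L2I_add[of f D "\<lambda>x. - g x"] L2I_uminus by fastforce

lemma L2I_bounded:
  assumes "f \<in> borel_measurable (lebI D)" and "\<And>x. x \<in> {0..D} \<Longrightarrow> cmod (f x) \<le> B"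
  shows "f \<in> L2I D"
proof (rule L2I_dominated)
  show "integrable (lebI D) (\<lambda>x. B\<^sup>2)"
    by (rule finite_measure.integrable_const) simp
qed (use assms in \<open>auto intro: power_mono\<close>)

lemma continuous_imp_measurable_lebI:
  "continuous_on {0..D} f \<Longrightarrow> f \<in> borel_measurable (lebI D)"
  by (rule continuous_imp_measurable_on_sets_lebesgue) auto

lemma L2I_continuous:
  assumes "continuous_on {0..D} f" shows "f \<in> L2I D"
proof -
  have "compact (f ` {0..D})" by (intro compact_continuous_image assms compact_Icc)
  then obtain B where "\<And>x. x \<in> {0..D} \<Longrightarrow> cmod (f x) \<le> B"
    by (meson bounded_iff compact_imp_bounded image_eqI)
  then show ?thesis by (intro L2I_bounded[of f D B] continuous_imp_measurable_lebI assms) auto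
qed

lemma L2I_const: "(\<lambda>x. c) \<in> L2I D"
  by (rule L2I_continuous) auto

lemma L2I_mult_integrable:
  assumes "f \<in> L2I D" "g \<in> L2I D"
  shows "integrable (lebI D) (\<lambda>x. f x * g x)"
proof (rule Bochner_Integration.integrable_bound)
  show "integrable (lebI D) (\<lambda>x. (cmod (f x))\<^sup>2 + (cmod (g x))\<^sup>2)"
    using assms by (auto dest: L2I_sq_integrable)
  show "AE x in lebI D. norm (f x * g x) \<le> norm ((cmod (f x))\<^sup>2 + (cmod (g x))\<^sup>2)"
  proof (rule AE_I2)
    fix x
    have "cmod (f x) * cmod (g x) \<le> (cmod (f x))\<^sup>2 + (cmod (g x))\<^sup>2"
      using sum_squares_bound[of "cmod (f x)" "cmod (g x)"]
        mult_nonneg_nonneg[OF norm_ge_zero[of "f x"] norm_ge_zero[of "g x"]] by linarith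
    then show "norm (f x * g x) \<le> norm ((cmod (f x))\<^sup>2 + (cmod (g x))\<^sup>2)"
      by (simp add: norm_mult)
  qed
qed (use assms in \<open>auto intro: borel_measurable_times L2I_meas\<close>)

lemma L2I_integrable: "f \<in> L2I D \<Longrightarrow> integrable (lebI D) f"
  using L2I_mult_integrable[OF _ L2I_const[of 1]] by simp

lemma L2I_mult_cmod_integrable:
  assumes "f \<in> L2I D" "g \<in> L2I D"
  shows "integrable (lebI D) (\<lambda>x. cmod (f x) * cmod (g x))"
  using integrable_norm[OF L2I_mult_integrable[OF assms]] by (simp add: norm_mult)

text \<open>The quadratic polynomial \<open>s\<^sup>2 * A - 2 * s * I + B\<close> is the integral of
  a square, hence nonnegative for every real s. The best choice \<open>s = I / A\<close> gives the
  claim; for \<open>A = 0\<close> the polynomial is affine, which forces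
  \<open>I = 0\<close>.\<close>

lemma Cauchy_Schwarz_cmod:
  assumes "f \<in> L2I D" "g \<in> L2I D"
  shows "lint D (\<lambda>x. cmod (f x) * cmod (g x)) \<le> nrm D f * nrm D g"
proof -
  let ?M = "lebI D"
  define I where "I = integral\<^sup>L ?M (\<lambda>x. cmod (f x) * cmod (g x))"
  define A where "A = (nrm D f)\<^sup>2"
  define B where "B = (nrm D g)\<^sup>2"
  note int = L2I_sq_integrable[OF assms(1)] L2I_sq_integrable[OF assms(2)]
    L2I_mult_cmod_integrable[OF assms]
  have q: "2 * s * I \<le> s\<^sup>2 * A + B" for s
  proof -
    have "2 * s * I = integral\<^sup>L ?M (\<lambda>x. 2 * s * (cmod (f x) * cmod (g x)))"
      by (simp add: I_def)
    also have "\<dots> \<le> integral\<^sup>L ?M (\<lambda>x. s\<^sup>2 * (cmod (f x))\<^sup>2 + (cmod (g x))\<^sup>2)"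
    proof (rule integral_mono)
      fix x show "2 * s * (cmod (f x) * cmod (g x)) \<le> s\<^sup>2 * (cmod (f x))\<^sup>2 + (cmod (g x))\<^sup>2"
        using sum_squares_bound[of "s * cmod (f x)" "cmod (g x)"]
        by (simp add: power_mult_distrib mult.assoc)
    qed (use int in auto)
    also have "\<dots> = s\<^sup>2 * A + B"
      using int by (simp add: A_def B_def nrm_sq)
    finally show ?thesis .
  qed
  have AB: "A \<ge> 0" "B \<ge> 0" by (auto simp: A_def B_def)
  have "I\<^sup>2 \<le> A * B"
  proof (cases "A = 0")
    case True
    have "I = 0"
    proof (rule ccontr)
      assume "I \<noteq> 0"
      \<comment> \<open>For this s the inequality \<open>q\<close> reads
        \<open>B + 1 \<le> B\<close>.\<close>
      then show False using q[of "(B + 1) / (2 * I)"] True AB by simp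
    qed
    then show ?thesis using True by simp
  next
    case False
    then have "A > 0" using AB by simp
    then show ?thesis using q[of "I / A"] by (simp add: field_simps power2_eq_square)
  qed
  also have "A * B = (nrm D f * nrm D g)\<^sup>2" by (simp add: A_def B_def power_mult_distrib)
  finally show ?thesis unfolding I_def by (rule power2_le_imp_le) simp
qed

lemma Cauchy_Schwarz_L2I:
  assumes "f \<in> L2I D" "g \<in> L2I D"
  shows "cmod (lint D (\<lambda>x. f x * g x)) \<le> nrm D f * nrm D g"
proof -
  have "cmod (lint D (\<lambda>x. f x * g x))
      \<le> lint D (\<lambda>x. cmod (f x * g x))"
    by (rule integral_norm_bound)
  then show ?thesis using Cauchy_Schwarz_cmod[OF assms] by (simp add: norm_mult)
qed

lemma nrm_const: "D \<ge> 0 \<Longrightarrow> nrm D (\<lambda>x. c) = sqrt D * cmod c"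
  using measure_lebI[of D] by (simp add: nrm_def real_sqrt_mult)

lemma integral_cmod_le_nrm:
  assumes "f \<in> L2I D" "D \<ge> 0"
  shows "lint D (\<lambda>x. cmod (f x)) \<le> sqrt D * nrm D f"
  using Cauchy_Schwarz_cmod[OF assms(1) L2I_const[of 1]] assms(2)
  by (simp add: nrm_const mult.commute)

lemma nrm_triangle:
  assumes "f \<in> L2I D" "g \<in> L2I D"
  shows "nrm D (\<lambda>x. f x + g x) \<le> nrm D f + nrm D g"
proof (rule power2_le_imp_le)
  let ?M = "lebI D"
  note int = L2I_sq_integrable[OF assms(1)] L2I_sq_integrable[OF assms(2)]
    L2I_mult_cmod_integrable[OF assms]
  have "(nrm D (\<lambda>x. f x + g x))\<^sup>2 \<le>
      integral\<^sup>L ?M (\<lambda>x. (cmod (f x))\<^sup>2 + (cmod (g x))\<^sup>2 + 2 * (cmod (f x) * cmod (g x)))"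
    unfolding nrm_sq
  proof (rule integral_mono)
    fix x
    have "(cmod (f x + g x))\<^sup>2 \<le> (cmod (f x) + cmod (g x))\<^sup>2"
      by (intro power_mono norm_triangle_ineq) auto
    then show "(cmod (f x + g x))\<^sup>2 \<le> (cmod (f x))\<^sup>2 + (cmod (g x))\<^sup>2 + 2 * (cmod (f x) * cmod (g x))"
      by (simp add: power2_sum mult.assoc)
  qed (use int L2I_sq_integrable[OF L2I_add[OF assms]] in auto)
  also have "\<dots> = (nrm D f)\<^sup>2 + (nrm D g)\<^sup>2
      + 2 * integral\<^sup>L ?M (\<lambda>x. cmod (f x) * cmod (g x))"
    using int by (simp add: nrm_sq)
  also have "\<dots> \<le> (nrm D f + nrm D g)\<^sup>2"
    using Cauchy_Schwarz_cmod[OF assms] by (simp add: power2_sum)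
  finally show "(nrm D (\<lambda>x. f x + g x))\<^sup>2 \<le> (nrm D f + nrm D g)\<^sup>2" .
qed simp

lemma nrm_cmult: "nrm D (\<lambda>x. c * f x) = cmod c * nrm D f"
  by (simp add: nrm_def norm_mult power_mult_distrib real_sqrt_mult)

lemma nrm_minus_commute: "nrm D (\<lambda>x. f x - g x) = nrm D (\<lambda>x. g x - f x)"
  by (simp add: nrm_def norm_minus_commute)

lemma nrm_triangle_sub:
  assumes "f \<in> L2I D" "g \<in> L2I D"
  shows "nrm D f \<le> nrm D g + nrm D (\<lambda>x. f x - g x)"
  using nrm_triangle[OF assms(2) L2I_diff[OF assms]] by simp

lemma nrm_diff_le:
  assumes "f \<in> L2I D" "g \<in> L2I D"
  shows "\<bar>nrm D f - nrm D g\<bar> \<le> nrm D (\<lambda>x. f x - g x)"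
  using nrm_triangle_sub[OF assms] nrm_triangle_sub[OF assms(2,1)] nrm_minus_commute[of D f g] by simp

lemma nrm_cong_AE:
  assumes "AE x in lebI D. f x = g x"
    and "f \<in> borel_measurable (lebI D)" "g \<in> borel_measurable (lebI D)"
  shows "nrm D f = nrm D g"
proof -
  have "lint D (\<lambda>x. (cmod (f x))\<^sup>2)
      = lint D (\<lambda>x. (cmod (g x))\<^sup>2)"
    using assms by (intro integral_cong_AE) auto
  then show ?thesis by (simp add: nrm_def)
qed

lemma nrm_zero_imp_AE:
  assumes "f \<in> L2I D" "nrm D f = 0"
  shows "AE x in lebI D. f x = 0"
proof -
  have "lint D (\<lambda>x. (cmod (f x))\<^sup>2) = 0"
    using assms(2) nrm_sq[of D f] by simp
  then have "AE x in lebI D. (cmod (f x))\<^sup>2 = 0"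
    using L2I_sq_integrable[OF assms(1)] by (subst (asm) integral_nonneg_eq_0_iff_AE) auto
  then show ?thesis by simp
qed

lemma nrm_bound:
  assumes "D \<ge> 0" "f \<in> borel_measurable (lebI D)"
    and "\<And>x. x \<in> {0..D} \<Longrightarrow> cmod (f x) \<le> B" "B \<ge> 0"
  shows "nrm D f \<le> sqrt D * B"
proof -
  have "(nrm D f)\<^sup>2 \<le> lint D (\<lambda>x. B\<^sup>2)"
    unfolding nrm_sq
    using L2I_sq_integrable[OF L2I_bounded[OF assms(2,3)]] assms(3)
    by (intro integral_mono finite_measure.integrable_const power_mono) auto
  also have "\<dots> = (sqrt D * B)\<^sup>2"
    using measure_lebI[OF assms(1)] assms(1) by (simp add: power_mult_distrib)
  finally show ?thesis by (rule power2_le_imp_le) (use assms in auto)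
qed

section \<open>Density of polynomials and integration by parts\<close>

lemma nrm_dominated_convergence:
  assumes "\<And>n. F n \<in> borel_measurable (lebI D)" "f \<in> L2I D"
    and "AE x in lebI D. (\<lambda>n. F n x) \<longlonglongrightarrow> f x"
    and "g \<in> L2I D" "\<And>n x. x \<in> {0..D} \<Longrightarrow> cmod (F n x - f x) \<le> cmod (g x)"
  shows "(\<lambda>n. nrm D (\<lambda>x. F n x - f x)) \<longlonglongrightarrow> 0"
proof -
  note [measurable] = assms(1) L2I_meas[OF assms(2)]
  have "(\<lambda>n. lint D (\<lambda>x. (cmod (F n x - f x))\<^sup>2))
      \<longlonglongrightarrow> lint D (\<lambda>x. 0)"
  proof (rule integral_dominated_convergence[where w="\<lambda>x. (cmod (g x))\<^sup>2"])
    show "AE x in lebI D. (\<lambda>n. (cmod (F n x - f x))\<^sup>2) \<longlonglongrightarrow> 0"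
      using assms(3)
    proof eventually_elim
      case (elim x)
      then have "(\<lambda>n. F n x - f x) \<longlonglongrightarrow> 0" by (simp add: LIM_zero)
      then have "(\<lambda>n. (cmod (F n x - f x))\<^sup>2) \<longlonglongrightarrow> (cmod 0)\<^sup>2" by (intro tendsto_intros)
      then show ?case by simp
    qed
    show "AE x in lebI D. norm ((cmod (F n x - f x))\<^sup>2) \<le> (cmod (g x))\<^sup>2" for n
      using assms(5) by (intro AE_I2) (auto intro!: power_mono)
  qed (use L2I_sq_integrable[OF assms(4)] in \<open>auto\<close>)
  then have "(\<lambda>n. (nrm D (\<lambda>x. F n x - f x))\<^sup>2) \<longlonglongrightarrow> 0" by (simp add: nrm_sq)
  then have "(\<lambda>n. sqrt ((nrm D (\<lambda>x. F n x - f x))\<^sup>2)) \<longlonglongrightarrow> sqrt 0" by (intro tendsto_real_sqrt)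
  then show ?thesis by simp
qed

text \<open>The radial retraction of the plane onto the closed disc of radius B. Its continuity
  keeps continuous functions continuous and measurable ones measurable, while the bound makes
  dominated convergence applicable.\<close>

definition clampC :: "real \<Rightarrow> complex \<Rightarrow> complex" where
  "clampC B z = of_real (B / max B (cmod z)) * z"

lemma clampC_bound: "B > 0 \<Longrightarrow> cmod (clampC B z) \<le> B"
  unfolding clampC_def norm_mult norm_of_real by (auto simp: field_simps max_def abs_if)

lemma clampC_id: "B > 0 \<Longrightarrow> cmod z \<le> B \<Longrightarrow> clampC B z = z"
  by (simp add: clampC_def max_def)

lemma clampC_diff: "B > 0 \<Longrightarrow> cmod (clampC B z - z) \<le> cmod z"
proof -
  assume B: "B > 0"
  have "clampC B z - z = of_real (B / max B (cmod z) - 1) * z"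
    by (simp add: clampC_def algebra_simps)
  then have "cmod (clampC B z - z) = \<bar>B / max B (cmod z) - 1\<bar> * cmod z"
    by (simp only: norm_mult norm_of_real)
  also have "\<dots> \<le> 1 * cmod z"
  proof (rule mult_right_mono)
    have "0 \<le> B / max B (cmod z)" "B / max B (cmod z) \<le> 1" using B by (auto simp: max_def divide_le_eq)
    then show "\<bar>B / max B (cmod z) - 1\<bar> \<le> 1" by linarith
  qed simp
  finally show ?thesis by simp
qed

lemma continuous_clampC: "B > 0 \<Longrightarrow> continuous_on UNIV (clampC B)"
  unfolding clampC_def by (intro continuous_intros) (auto simp: max_def)

lemma L2I_polynomial: "polynomial_function p \<Longrightarrow> p \<in> L2I D"
  by (intro L2I_continuous continuous_on_polymonial_function)

text \<open>Measurability on a set supplies continuous functions that converge almost everywhere.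
  Clamping them at B does not disturb the limit, because f itself is bounded by B, and turns
  pointwise convergence into convergence in norm; the Weierstrass theorem then replaces a continuous
  function by a polynomial.\<close>

lemma bounded_approx_polynomial:
  assumes D: "D > 0" and f: "f \<in> borel_measurable (lebI D)"
    and fB: "\<And>x. x \<in> {0..D} \<Longrightarrow> cmod (f x) \<le> B" and B: "B > 0" and e: "e > 0"
  shows "\<exists>p. polynomial_function p \<and> nrm D (\<lambda>x. f x - p x) < e"
proof -
  have "f measurable_on {0..D}" using f measurable_on_iff_borel_measurable[of "{0..D}" f] by simp
  then obtain N g where N: "negligible N" and g: "\<And>n. continuous_on UNIV (g n)"
    and lim: "\<And>x. x \<notin> N \<Longrightarrow> (\<lambda>n::nat. g n x) \<longlonglongrightarrow> (if x \<in> {0..D} then f x else 0)"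
    unfolding measurable_on_def by blast
  define h where "h n x = clampC B (g n x)" for n x
  have hc: "continuous_on A (h n)" for n A
    unfolding h_def using continuous_on_compose2[OF continuous_clampC[OF B] g]
    by (auto intro: continuous_on_subset)
  have fL: "f \<in> L2I D" using f fB by (rule L2I_bounded)
  have "(\<lambda>n. nrm D (\<lambda>x. h n x - f x)) \<longlonglongrightarrow> 0"
  proof (rule nrm_dominated_convergence[where g="\<lambda>x. of_real (2*B)"])
    show "AE x in lebI D. (\<lambda>n. h n x) \<longlonglongrightarrow> f x"
    proof -
      have "AE x in lebesgue. x \<notin> N"
        using N by (simp add: negligible_iff_null_sets AE_not_in)
      then have "AE x in lebesgue. x \<in> {0..D} \<longrightarrow> (\<lambda>n. h n x) \<longlonglongrightarrow> f x"
      proof eventually_elim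
        case (elim x)
        show ?case
        proof
          assume x: "x \<in> {0..D}"
          have "(\<lambda>n. clampC B (g n x)) \<longlonglongrightarrow> clampC B (f x)"
            using continuous_on_tendsto_compose[OF continuous_clampC[OF B] lim[OF elim]] x by auto
          then show "(\<lambda>n. h n x) \<longlonglongrightarrow> f x" using clampC_id[OF B fB[OF x]] by (simp add: h_def)
        qed
      qed
      then show ?thesis by (subst AE_restrict_space_iff) auto
    qed
    fix n x assume "x \<in> {0..D}"
    have "cmod (h n x - f x) \<le> cmod (h n x) + cmod (f x)" by (rule norm_triangle_ineq4)
    also have "\<dots> \<le> 2 * B" using clampC_bound[OF B] fB[OF \<open>x \<in> _\<close>] unfolding h_def
      by (smt (verit))
    also have "\<dots> \<le> cmod (of_real (2*B))" by (metis abs_ge_self norm_of_real)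
    finally show "cmod (h n x - f x) \<le> cmod (of_real (2*B))" .
  qed (auto intro: L2I_const fL continuous_imp_measurable_lebI hc)
  then have "eventually (\<lambda>n. nrm D (\<lambda>x. h n x - f x) < e / 2) sequentially"
    using e by (intro order_tendstoD(2)[of _ 0]) auto
  then obtain n where n: "nrm D (\<lambda>x. h n x - f x) < e / 2"
    by (auto simp: eventually_sequentially)
  \<comment> \<open>A uniform error d costs at most \<open>sqrt D * d = e / 4\<close> in
    norm.\<close>
  define d where "d = e / (4 * sqrt D)"
  have d: "d > 0" using e D by (simp add: d_def)
  obtain p where p: "polynomial_function p" "\<And>x. x \<in> {0..D} \<Longrightarrow> cmod (h n x - p x) < d"
    using Stone_Weierstrass_polynomial_function[OF compact_Icc hc d] by metis
  have pL: "p \<in> L2I D" and hL: "h n \<in> L2I D"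
    using L2I_polynomial[OF p(1)] L2I_continuous[OF hc] by auto
  have "nrm D (\<lambda>x. h n x - p x) \<le> sqrt D * d"
    using D d p(2) by (intro nrm_bound L2I_meas L2I_diff hL pL) (auto intro: less_imp_le)
  also have "\<dots> < e / 2" using D e by (simp add: d_def)
  finally have 2: "nrm D (\<lambda>x. h n x - p x) < e / 2" .
  have "nrm D (\<lambda>x. f x - p x) \<le> nrm D (\<lambda>x. f x - h n x) + nrm D (\<lambda>x. h n x - p x)"
    using nrm_triangle[OF L2I_diff[OF fL hL] L2I_diff[OF hL pL]] by simp
  also have "\<dots> < e" using n 2 nrm_minus_commute[of D f "h n"] by simp
  finally show ?thesis using p(1) by blast
qed

text \<open>Truncation by \<open>clampC\<close> at height n + 1 reduces to bounded functions: at
  each point the truncations are eventually equal to f, and the error is dominated by the modulus of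
  f.\<close>

lemma L2I_approx_polynomial:
  assumes D: "D > 0" and f: "f \<in> L2I D" and e: "e > 0"
  shows "\<exists>p. polynomial_function p \<and> nrm D (\<lambda>x. f x - p x) < e"
proof -
  define F where "F n x = clampC (real n + 1) (f x)" for n x
  have Fm: "F n \<in> borel_measurable (lebI D)" for n
    unfolding F_def
    by (rule borel_measurable_continuous_on[OF continuous_clampC L2I_meas[OF f]]) simp
  have "(\<lambda>n. nrm D (\<lambda>x. F n x - f x)) \<longlonglongrightarrow> 0"
  proof (rule nrm_dominated_convergence[where g=f])
    show "AE x in lebI D. (\<lambda>n. F n x) \<longlonglongrightarrow> f x"
    proof (rule AE_I2, rule tendsto_eventually)
      fix x
      obtain m :: nat where "cmod (f x) \<le> m" using real_arch_simple by blast
      then have "F n x = f x" if "n \<ge> m" for n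
        using that unfolding F_def by (intro clampC_id) auto
      then show "\<forall>\<^sub>F n in sequentially. F n x = f x" by (auto simp: eventually_sequentially)
    qed
    show "cmod (F n x - f x) \<le> cmod (f x)" for n x
      unfolding F_def by (rule clampC_diff) simp
  qed (use Fm f in auto)
  then have "eventually (\<lambda>n. nrm D (\<lambda>x. F n x - f x) < e / 2) sequentially"
    using e by (intro order_tendstoD(2)[of _ 0]) auto
  then obtain n where n: "nrm D (\<lambda>x. F n x - f x) < e / 2"
    by (auto simp: eventually_sequentially)
  have b: "cmod (F n x) \<le> real n + 1" for x unfolding F_def by (rule clampC_bound) simp
  obtain p where p: "polynomial_function p" "nrm D (\<lambda>x. F n x - p x) < e / 2"
    using bounded_approx_polynomial[OF D Fm b, where e="e/2"] e by auto
  have FL: "F n \<in> L2I D" using Fm b by (rule L2I_bounded)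
  have "nrm D (\<lambda>x. f x - p x) \<le> nrm D (\<lambda>x. f x - F n x) + nrm D (\<lambda>x. F n x - p x)"
    using nrm_triangle[OF L2I_diff[OF f FL] L2I_diff[OF FL L2I_polynomial[OF p(1)]]] by simp
  also have "\<dots> < e" using n p(2) nrm_minus_commute[of D f "F n"] by simp
  finally show ?thesis using p(1) by blast
qed

lemma L2I_approx_polynomial_seq:
  assumes D: "D > 0" and f: "f \<in> L2I D"
  shows "\<exists>P. (\<forall>n. polynomial_function (P n)) \<and> (\<lambda>n::nat. nrm D (\<lambda>x. P n x - f x)) \<longlonglongrightarrow> 0"
proof -
  have "\<forall>n. \<exists>p. polynomial_function p \<and> nrm D (\<lambda>x. f x - p x) < 1 / (real n + 1)"
    using L2I_approx_polynomial[OF assms] by simp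
  then obtain P where P: "\<And>n. polynomial_function (P n)"
      "\<And>n. nrm D (\<lambda>x. f x - P n x) < 1 / (real n + 1)" by metis
  have "(\<lambda>n. nrm D (\<lambda>x. P n x - f x)) \<longlonglongrightarrow> 0"
  proof (rule tendsto_sandwich[OF _ _ tendsto_const LIMSEQ_inverse_real_of_nat])
    show "\<forall>\<^sub>F n in sequentially. nrm D (\<lambda>x. P n x - f x) \<le> inverse (real (Suc n))"
      using P(2) nrm_minus_commute[of D f] by (intro always_eventually allI)
        (auto simp: inverse_eq_divide add.commute intro: less_imp_le)
  qed auto
  with P(1) show ?thesis by blast
qed

section \<open>Primitives of square-integrable functions\<close>

lemma integral_lebI_continuous:
  fixes f :: "real \<Rightarrow> complex"
  assumes "continuous_on {0..x} f"
  shows "lint x f = integral {0..x} f"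
  by (rule lebesgue_integral_eq_integral[OF L2I_integrable[OF L2I_continuous[OF assms]]]) simp

definition prim :: "(real \<Rightarrow> complex) \<Rightarrow> real \<Rightarrow> complex" where
  "prim g x = lint x g"

lemma L2I_subinterval:
  assumes "g \<in> L2I D" "x \<le> D"
  shows "g \<in> L2I x" "nrm x g \<le> nrm D g"
proof -
  have sub: "{0..x} \<subseteq> {0..D}" using assms by auto
  have i: "integrable (lebI x) (\<lambda>x. (cmod (g x))\<^sup>2)"
    using integrable_subinterval[OF L2I_sq_integrable[OF assms(1)] sub] .
  have "g \<in> borel_measurable (lebI x)"
    using measurable_restrict_mono[OF L2I_meas[OF assms(1)] sub] .
  then show "g \<in> L2I x" using i by (simp add: L2I_def)
  have "lint x (\<lambda>x. (cmod (g x))\<^sup>2)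
      \<le> lint D (\<lambda>x. (cmod (g x))\<^sup>2)"
    using integral_subset_le[OF sub integrable_on_lebesgue_on[OF i]
        integrable_on_lebesgue_on[OF L2I_sq_integrable[OF assms(1)]]]
      lebesgue_integral_eq_integral[OF i]
      lebesgue_integral_eq_integral[OF L2I_sq_integrable[OF assms(1)]] by simp
  then show "nrm x g \<le> nrm D g" by (simp add: nrm_def)
qed

lemma prim_0 [simp]: "prim g 0 = 0"
proof -
  have "AE x in lebI 0. g x = 0"
  proof (subst AE_restrict_space_iff)
    have "AE x in lebesgue. x \<notin> {0::real}" by (rule AE_not_in) simp
    then show "AE x in lebesgue. x \<in> {0..0} \<longrightarrow> g x = 0" by eventually_elim auto
  qed auto
  then show ?thesis unfolding prim_def by (rule integral_eq_zero_AE)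
qed

lemma prim_bound:
  assumes "g \<in> L2I D" "x \<in> {0..D}"
  shows "cmod (prim g x) \<le> sqrt D * nrm D g"
proof -
  have x: "x \<le> D" "0 \<le> x" using assms(2) by auto
  have "cmod (prim g x) \<le> lint x (\<lambda>x. cmod (g x))"
    unfolding prim_def by (rule integral_norm_bound)
  also have "\<dots> \<le> sqrt x * nrm x g"
    using integral_cmod_le_nrm L2I_subinterval(1)[OF assms(1) x(1)] x by blast
  also have "\<dots> \<le> sqrt D * nrm D g"
    using x L2I_subinterval(2)[OF assms(1) x(1)] by (intro mult_mono) auto
  finally show ?thesis .
qed

lemma prim_diff:
  assumes "f \<in> L2I D" "g \<in> L2I D" "x \<le> D"
  shows "prim (\<lambda>x. f x - g x) x = prim f x - prim g x"
  unfolding prim_def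
  using L2I_integrable[OF L2I_subinterval(1)[OF assms(1,3)]]
    L2I_integrable[OF L2I_subinterval(1)[OF assms(2,3)]] by simp

lemma prim_cong_AE:
  assumes "f \<in> L2I D" "g \<in> L2I D" "x \<le> D" "AE x in lebI D. f x = g x"
  shows "prim f x = prim g x"
  unfolding prim_def
proof (rule integral_cong_AE)
  have "AE y in lebesgue. y \<in> {0..D} \<longrightarrow> f y = g y"
    using assms(4) by (subst (asm) AE_restrict_space_iff) auto
  then have "AE y in lebesgue. y \<in> {0..x} \<longrightarrow> f y = g y"
    by eventually_elim (use assms(3) in auto)
  then show "AE y in lebI x. f y = g y" by (subst AE_restrict_space_iff) auto
qed (use L2I_meas[OF L2I_subinterval(1)] assms in auto)

lemma prim_continuous_fun:
  assumes "continuous_on {0..D} g" "x \<in> {0..D}"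
  shows "(prim g has_vector_derivative g x) (at x within {0..D})"
proof -
  have "((\<lambda>u. integral {0..u} g) has_vector_derivative g x) (at x within {0..D})"
    using assms by (intro integral_has_vector_derivative)
  moreover have "prim g y = integral {0..y} g" if "y \<in> {0..D}" for y
    unfolding prim_def using that assms(1)
    by (intro integral_lebI_continuous) (auto intro: continuous_on_subset)
  ultimately show ?thesis
    by (rule has_vector_derivative_transform[OF assms(2), rotated]) auto
qed

text \<open>By \<open>prim_bound\<close> the map from g to its primitive is continuous from the norm
  \<open>nrm D\<close> to the supremum norm, so the primitive is a uniform limit of primitives of
  polynomials.\<close>

lemma prim_continuous:
  assumes "D > 0" "g \<in> L2I D"
  shows "continuous_on {0..D} (prim g)"
proof -
  obtain P where P: "\<And>n. polynomial_function (P n)" "(\<lambda>n::nat. nrm D (\<lambda>x. P n x - g x)) \<longlonglongrightarrow> 0"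
    using L2I_approx_polynomial_seq[OF assms] by blast
  note PL = L2I_polynomial[OF P(1)]
  have "uniform_limit {0..D} (\<lambda>n. prim (P n)) (prim g) sequentially"
  proof (rule uniform_limitI)
    fix e :: real assume "e > 0"
    have "(\<lambda>n. sqrt D * nrm D (\<lambda>x. P n x - g x)) \<longlonglongrightarrow> sqrt D * 0"
      by (intro tendsto_intros P(2))
    then have "\<forall>\<^sub>F n in sequentially. sqrt D * nrm D (\<lambda>x. P n x - g x) < e"
      using \<open>e > 0\<close> by (intro order_tendstoD(2)) auto
    then show "\<forall>\<^sub>F n in sequentially. \<forall>x\<in>{0..D}. dist (prim (P n) x) (prim g x) < e"
    proof eventually_elim
      case (elim n)
      show ?case
      proof
        fix x assume x: "x \<in> {0..D}"
        then show "dist (prim (P n) x) (prim g x) < e"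
          using prim_bound[OF L2I_diff[OF PL assms(2)] x, of n] prim_diff[OF PL assms(2), of x n] elim
          by (simp add: dist_norm)
      qed
    qed
  qed
  moreover have "continuous_on {0..D} (prim (P n))" for n
    using prim_continuous_fun[of D "P n"] continuous_on_polymonial_function[OF P(1)]
    by (meson continuous_on_vector_derivative)
  ultimately show ?thesis
    by (intro uniform_limit_theorem[where F=sequentially and f="\<lambda>n. prim (P n)"]) auto
qed

lemma nrm_prim_le:
  assumes "D > 0" "g \<in> L2I D"
  shows "nrm D (prim g) \<le> D * nrm D g"
proof -
  have "nrm D (prim g) \<le> sqrt D * (sqrt D * nrm D g)"
    using assms prim_bound[OF assms(2)]
    by (intro nrm_bound continuous_imp_measurable_lebI prim_continuous) auto
  then show ?thesis using assms(1) by (simp add: mult.assoc[symmetric])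
qed

text \<open>Norm convergence implies weak convergence, by Cauchy-Schwarz. This is the device by
  which identities are extended from polynomials to square-integrable functions.\<close>

lemma tendsto_integral_mult_L2I:
  assumes "\<And>n. F n \<in> L2I D" "f \<in> L2I D" "g \<in> L2I D"
    and lim: "(\<lambda>n::nat. nrm D (\<lambda>x. F n x - f x)) \<longlonglongrightarrow> 0"
  shows "(\<lambda>n. lint D (\<lambda>x. F n x * g x))
    \<longlonglongrightarrow> lint D (\<lambda>x. f x * g x)"
proof (rule LIM_zero_cancel, rule Lim_null_comparison)
  show "(\<lambda>n. nrm D (\<lambda>x. F n x - f x) * nrm D g) \<longlonglongrightarrow> 0"
    using tendsto_mult_left_zero[OF lim] .
  show "\<forall>\<^sub>F n in sequentially. cmod (lint D (\<lambda>x. F n x * g x)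
     - lint D (\<lambda>x. f x * g x)) \<le> nrm D (\<lambda>x. F n x - f x) * nrm D g"
  proof (intro always_eventually allI)
    fix n
    show "cmod (lint D (\<lambda>x. F n x * g x)
     - lint D (\<lambda>x. f x * g x)) \<le> nrm D (\<lambda>x. F n x - f x) * nrm D g"
      using Cauchy_Schwarz_L2I[OF L2I_diff[OF assms(1)[of n] assms(2)] assms(3)]
        L2I_mult_integrable[OF assms(1)[of n] assms(3)] L2I_mult_integrable[OF assms(2,3)]
      by (simp add: left_diff_distrib)
  qed
qed

lemma integration_by_parts_continuous:
  assumes "D > 0" "continuous_on {0..D} g"
    and "\<And>x. x \<in> {0..D} \<Longrightarrow> (\<phi> has_vector_derivative \<phi>' x) (at x within {0..D})"
    and "continuous_on {0..D} \<phi>'"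
  shows "lint D (\<lambda>x. prim g x * \<phi>' x)
    = prim g D * \<phi> D - lint D (\<lambda>x. g x * \<phi> x)"
proof -
  have \<phi>: "continuous_on {0..D} \<phi>" using assms(3) by (meson continuous_on_vector_derivative)
  have pg: "continuous_on {0..D} (prim g)"
    using prim_continuous[OF assms(1) L2I_continuous[OF assms(2)]] .
  have c: "continuous_on {0..D} (\<lambda>x. prim g x * \<phi>' x)" "continuous_on {0..D} (\<lambda>x. g x * \<phi> x)"
    by (intro continuous_intros assms \<phi> pg)+
  have "((\<lambda>x. prim g x * \<phi>' x + g x * \<phi> x) has_integral (prim g D * \<phi> D - prim g 0 * \<phi> 0)) {0..D}"
    using assms(1) has_vector_derivative_mult[OF prim_continuous_fun[OF assms(2)] assms(3)]
    by (intro fundamental_theorem_of_calculus[where f="\<lambda>x. prim g x * \<phi> x"]) auto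
  then have "integral {0..D} (\<lambda>x. prim g x * \<phi>' x) + integral {0..D} (\<lambda>x. g x * \<phi> x)
      = prim g D * \<phi> D"
    using Henstock_Kurzweil_Integration.integral_add[OF integrable_continuous_real[OF c(1)]
        integrable_continuous_real[OF c(2)]] by (simp add: integral_unique)
  then show ?thesis using c by (simp add: integral_lebI_continuous algebra_simps)
qed

text \<open>Both sides depend continuously on g in norm, so the classical formula for continuous g
  extends by density. The boundary term at 0 is missing because a primitive vanishes there.\<close>

lemma integration_by_parts_L2I:
  assumes "D > 0" "g \<in> L2I D"
    and "\<And>x. x \<in> {0..D} \<Longrightarrow> (\<phi> has_vector_derivative \<phi>' x) (at x within {0..D})"
    and "continuous_on {0..D} \<phi>'"
  shows "lint D (\<lambda>x. prim g x * \<phi>' x)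
    = prim g D * \<phi> D - lint D (\<lambda>x. g x * \<phi> x)"
proof -
  obtain P where P: "\<And>n. polynomial_function (P n)" "(\<lambda>n::nat. nrm D (\<lambda>x. P n x - g x)) \<longlonglongrightarrow> 0"
    using L2I_approx_polynomial_seq[OF assms(1,2)] by blast
  note PL = L2I_polynomial[OF P(1)]
  have \<phi>: "\<phi> \<in> L2I D" "\<phi>' \<in> L2I D"
    by (rule L2I_continuous[OF continuous_on_vector_derivative], use assms(3) in blast)
      (rule L2I_continuous[OF assms(4)])
  have pL: "prim h \<in> L2I D" if "h \<in> L2I D" for h
    using prim_continuous[OF assms(1) that] by (rule L2I_continuous)
  have "(\<lambda>n. nrm D (\<lambda>x. prim (P n) x - prim g x)) \<longlonglongrightarrow> 0"
  proof (rule tendsto_sandwich[OF _ _ tendsto_const])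
    show "(\<lambda>n. D * nrm D (\<lambda>x. P n x - g x)) \<longlonglongrightarrow> 0" using tendsto_mult_right_zero[OF P(2)] .
    show "\<forall>\<^sub>F n in sequentially. nrm D (\<lambda>x. prim (P n) x - prim g x) \<le> D * nrm D (\<lambda>x. P n x - g x)"
    proof (intro always_eventually allI)
      fix n
      have "nrm D (\<lambda>x. prim (P n) x - prim g x) = nrm D (prim (\<lambda>x. P n x - g x))"
        unfolding nrm_def
        by (intro arg_cong[where f=sqrt] Bochner_Integration.integral_cong)
          (auto simp: prim_diff[OF PL assms(2)])
      then show "nrm D (\<lambda>x. prim (P n) x - prim g x) \<le> D * nrm D (\<lambda>x. P n x - g x)"
        using nrm_prim_le[OF assms(1) L2I_diff[OF PL assms(2)]] by simp
    qed
  qed auto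
  then have 1: "(\<lambda>n. lint D (\<lambda>x. prim (P n) x * \<phi>' x))
    \<longlonglongrightarrow> lint D (\<lambda>x. prim g x * \<phi>' x)"
    by (intro tendsto_integral_mult_L2I pL PL assms \<phi>)
  have 2: "(\<lambda>n. prim (P n) D) \<longlonglongrightarrow> prim g D"
    using tendsto_integral_mult_L2I[OF PL assms(2) L2I_const[of 1] P(2)] by (simp add: prim_def)
  have 3: "(\<lambda>n. lint D (\<lambda>x. P n x * \<phi> x))
    \<longlonglongrightarrow> lint D (\<lambda>x. g x * \<phi> x)"
    by (intro tendsto_integral_mult_L2I PL assms \<phi> P)
  have "(\<lambda>n. lint D (\<lambda>x. prim (P n) x * \<phi>' x))
    = (\<lambda>n. prim (P n) D * \<phi> D - lint D (\<lambda>x. P n x * \<phi> x))"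
    using integration_by_parts_continuous[OF assms(1) continuous_on_polymonial_function[OF P(1)] assms(3,4)]
    by simp
  then have "(\<lambda>n. lint D (\<lambda>x. prim (P n) x * \<phi>' x))
    \<longlonglongrightarrow> prim g D * \<phi> D - lint D (\<lambda>x. g x * \<phi> x)"
    using tendsto_diff[OF tendsto_mult[OF 2 tendsto_const] 3] by simp
  then show ?thesis using 1 LIMSEQ_unique by blast
qed

section \<open>Test functions and weak derivatives\<close>

text \<open>Smoothness in \<open>test_fun\<close> speaks about iterates of \<open>deriv\<close>.
  Counting from the function inwards, with the function arbitrary in the induction, lets the sum,
  product and chain rules be iterated; \<open>ndiff_iff\<close> is the translation.\<close>

primrec ndiff :: "nat \<Rightarrow> (real \<Rightarrow> real) \<Rightarrow> bool" where
  "ndiff 0 f \<longleftrightarrow> (\<forall>x. f differentiable (at x))"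
| "ndiff (Suc k) f \<longleftrightarrow> (\<forall>x. f differentiable (at x)) \<and> ndiff k (deriv f)"

lemma ndiff_differentiable: "ndiff k f \<Longrightarrow> f differentiable (at x)"
  by (cases k) auto

lemma ndiff_Suc_imp: "ndiff (Suc k) f \<Longrightarrow> ndiff k f"
  by (induction k arbitrary: f) auto

lemma ndiff_iff: "(\<forall>k. ndiff k f) \<longleftrightarrow> (\<forall>k x. (deriv ^^ k) f differentiable (at x))"
proof
  have "ndiff k f \<Longrightarrow> (deriv ^^ k) f differentiable (at x)" for k x
    by (induction k arbitrary: f) (auto simp del: funpow.simps simp: funpow_Suc_right)
  then show "\<forall>k. ndiff k f \<Longrightarrow> \<forall>k x. (deriv ^^ k) f differentiable (at x)" by blast
  have "\<forall>k x. (deriv ^^ k) f differentiable (at x) \<Longrightarrow> ndiff n f" for n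
  proof (induction n arbitrary: f)
    case 0
    then show ?case using spec[OF 0, of 0] by simp
  next
    case (Suc n)
    have "\<forall>k x. (deriv ^^ k) (deriv f) differentiable (at x)"
      using Suc.prems by (metis comp_apply funpow_Suc_right)
    then show ?case using Suc.IH spec[OF Suc.prems, of 0] by simp
  qed
  then show "\<forall>k x. (deriv ^^ k) f differentiable (at x) \<Longrightarrow> \<forall>k. ndiff k f" by blast
qed

lemma DERIV_deriv_differentiable:
  "(f :: real \<Rightarrow> real) differentiable (at x) \<Longrightarrow> (f has_real_derivative deriv f x) (at x)"
  using DERIV_deriv_iff_real_differentiable by blast

lemma ndiff_const [simp]: "ndiff k (\<lambda>x. c)"
  by (induction k arbitrary: c) auto

lemma ndiff_add: "ndiff k f \<Longrightarrow> ndiff k g \<Longrightarrow> ndiff k (\<lambda>x. f x + g x)"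
proof (induction k arbitrary: f g)
  case (Suc k)
  have "deriv (\<lambda>x. f x + g x) = (\<lambda>x. deriv f x + deriv g x)"
    by (intro ext DERIV_imp_deriv DERIV_add DERIV_deriv_differentiable
        ndiff_differentiable[OF Suc.prems(1)] ndiff_differentiable[OF Suc.prems(2)])
  with Suc show ?case by (auto intro: differentiable_add)
qed (auto intro: differentiable_add)

lemma ndiff_mult: "ndiff k f \<Longrightarrow> ndiff k g \<Longrightarrow> ndiff k (\<lambda>x. f x * g x)"
proof (induction k arbitrary: f g)
  case (Suc k)
  have "deriv (\<lambda>x. f x * g x) = (\<lambda>x. deriv f x * g x + deriv g x * f x)"
    by (intro ext DERIV_imp_deriv DERIV_mult DERIV_deriv_differentiable
        ndiff_differentiable[OF Suc.prems(1)] ndiff_differentiable[OF Suc.prems(2)])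
  moreover have "ndiff k (\<lambda>x. deriv f x * g x + deriv g x * f x)"
    using Suc ndiff_Suc_imp by (intro ndiff_add Suc.IH) auto
  ultimately show ?case using Suc.prems by (auto intro: differentiable_mult)
qed (auto intro: differentiable_mult)

lemma ndiff_affine: "ndiff k f \<Longrightarrow> ndiff k (\<lambda>x. f (a * x + b))"
proof (induction k arbitrary: f)
  case 0
  have "((\<lambda>x. f (a * x + b)) has_real_derivative deriv f (a * x + b) * a) (at x)" for x
    using 0 by (intro DERIV_chain2[where f=f] DERIV_deriv_differentiable)
      (auto intro!: derivative_eq_intros)
  then show ?case by (auto simp: real_differentiable_def)
next
  case (Suc k)
  have D: "((\<lambda>x. f (a * x + b)) has_real_derivative a * deriv f (a * x + b)) (at x)" for x
    using Suc.prems by (subst mult.commute, intro DERIV_chain2[where f=f] DERIV_deriv_differentiable)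
      (auto intro!: derivative_eq_intros)
  then have "deriv (\<lambda>x. f (a * x + b)) = (\<lambda>x. a * deriv f (a * x + b))"
    by (intro ext DERIV_imp_deriv)
  moreover have "ndiff k (\<lambda>x. a * deriv f (a * x + b))"
    using Suc by (intro ndiff_mult) auto
  ultimately show ?case using D by (auto simp: real_differentiable_def)
qed

lemma ndiff_real_polynomial: "real_polynomial_function s \<Longrightarrow> ndiff k s"
proof (induction rule: real_polynomial_function.induct)
  case (linear f)
  then obtain c where "f = (\<lambda>x. x * c)" using real_bounded_linear by metis
  then have f: "f = (\<lambda>x. c * x)" by auto
  have "deriv (\<lambda>x. c * x) = (\<lambda>x::real. c)"
    by (intro ext DERIV_imp_deriv) (auto intro!: derivative_eq_intros)
  then show ?case unfolding f by (cases k) (auto intro!: derivative_intros)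
qed (auto intro: ndiff_add ndiff_mult)

text \<open>Derivatives stay in the span of this family, also at \<open>0\<close>, so smoothness follows by induction.\<close>

definition flat :: "nat \<Rightarrow> real \<Rightarrow> real" where
  "flat m x = (if x > 0 then (1 / x) ^ m * exp (- (1 / x)) else 0)"

lemma flat_tendsto_0: "((\<lambda>h. (1 / h) ^ m * exp (- (1 / h))) \<longlongrightarrow> 0) (at_right (0::real))"
proof -
  have "((\<lambda>h::real. (inverse h) ^ m / exp (inverse h)) \<longlongrightarrow> 0) (at_right 0)"
    by (rule filterlim_compose[OF tendsto_power_div_exp_0 filterlim_inverse_at_top_right])
  then show ?thesis by (simp add: exp_minus divide_inverse)
qed

lemma DERIV_flat: "(flat m has_real_derivative (- real m * flat (Suc m) x + flat (m + 2) x)) (at x)"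
proof -
  consider "x < 0" | "x = 0" | "x > 0" by linarith
  then show ?thesis
  proof cases
    case 1
    have "((\<lambda>x. 0) has_real_derivative 0) (at x)" by simp
    then have "(flat m has_real_derivative 0) (at x)"
      by (rule has_field_derivative_transform_within_open[of _ _ _ "{..<0}"])
        (use 1 in \<open>auto simp: flat_def\<close>)
    then show ?thesis using 1 by (simp add: flat_def)
  next
    case 2
    \<comment> \<open>Dividing by h raises the exponent by one: the right difference quotient at 0
      is the formula of \<open>flat (Suc m)\<close>, which tends to 0 because the exponential beats
      every power.\<close>
    have "((\<lambda>h. (flat m (0 + h) - flat m 0) / h) \<longlongrightarrow> 0) (at_right 0)"
    proof (rule Lim_transform_eventually[OF flat_tendsto_0[of "Suc m"]])
      show "\<forall>\<^sub>F h in at_right 0. (1 / h) ^ Suc m * exp (- (1 / h)) = (flat m (0 + h) - flat m 0) / h"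
        by (auto simp: eventually_at_right_field flat_def intro!: exI[of _ 1])
    qed
    moreover have "((\<lambda>h. (flat m (0 + h) - flat m 0) / h) \<longlongrightarrow> 0) (at_left 0)"
      by (rule Lim_transform_eventually[OF tendsto_const])
        (auto simp: eventually_at_left_field flat_def intro!: exI[of _ "-1"])
    ultimately have "(flat m has_real_derivative 0) (at 0)"
      unfolding DERIV_def by (simp add: filterlim_split_at_real)
    then show ?thesis using 2 by (simp add: flat_def)
  next
    case 3
    have "((\<lambda>x. (1 / x) ^ m * exp (- (1 / x))) has_real_derivative
        (- real m * (1 / x) ^ Suc m * exp (- (1 / x)) + (1 / x) ^ (m + 2) * exp (- (1 / x)))) (at x)"
    proof -
      have 1: "((\<lambda>x. 1 / x) has_real_derivative - (1 / x)\<^sup>2) (at x)"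
        using 3 by (auto intro!: derivative_eq_intros simp: power2_eq_square)
      \<comment> \<open>The derivative of the power carries the truncated exponent
        \<open>m - Suc 0\<close>; at \<open>m = 0\<close> the factor \<open>real m\<close> makes it
        harmless, hence the case distinction.\<close>
      have 2: "real m * (- y\<^sup>2 * y ^ (m - Suc 0)) * e + e * - (- y\<^sup>2) * y ^ m
          = - real m * y ^ Suc m * e + y ^ (m + 2) * e" for y e :: real
        by (cases m) (auto simp: algebra_simps power2_eq_square)
      show ?thesis
        by (rule DERIV_cong[OF DERIV_mult[OF DERIV_power[OF 1, of m] DERIV_fun_exp[OF DERIV_minus[OF 1]]]])
          (rule 2)
    qed
    then have "(flat m has_real_derivative
        (- real m * (1 / x) ^ Suc m * exp (- (1 / x)) + (1 / x) ^ (m + 2) * exp (- (1 / x)))) (at x)"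
      by (rule has_field_derivative_transform_within_open[of _ _ _ "{0<..}"])
        (use 3 in \<open>auto simp: flat_def\<close>)
    then show ?thesis using 3 by (simp add: flat_def mult.assoc)
  qed
qed

lemma ndiff_flat: "ndiff k (flat m)"
proof (induction k arbitrary: m)
  case 0
  then show ?case using DERIV_flat real_differentiable_def by auto
next
  case (Suc k)
  have "deriv (flat m) = (\<lambda>x. - real m * flat (Suc m) x + flat (m + 2) x)"
    by (intro ext DERIV_imp_deriv DERIV_flat)
  moreover have "ndiff k (\<lambda>x. - real m * flat (Suc m) x + flat (m + 2) x)"
    by (intro ndiff_add ndiff_mult Suc ndiff_const)
  moreover have "flat m differentiable (at x)" for x
    unfolding real_differentiable_def using DERIV_flat by blast
  ultimately show ?case by simp
qed

text \<open>Cutoffs without an exact plateau: they lie in [0,1], vanish outside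
  \<open>{1/(n+1)..D - 1/(n+1)}\<close>, and tend to 1 at each interior point since
  \<open>flat 0\<close> tends to 1 at infinity. When that interval is empty the function is
  identically 0.\<close>

definition bump :: "real \<Rightarrow> nat \<Rightarrow> real \<Rightarrow> real" where
  "bump D n x = flat 0 ((real n + 1) * x - 1) * flat 0 ((real n + 1) * (D - x) - 1)"

lemma flat0_bounds: "0 \<le> flat 0 x" "flat 0 x \<le> 1"
  by (auto simp: flat_def)

lemma bump_bounds: "0 \<le> bump D n x" "bump D n x \<le> 1"
  unfolding bump_def using flat0_bounds by (auto intro: mult_nonneg_nonneg mult_le_one)

lemma ndiff_bump: "ndiff k (bump D n)"
proof -
  have "bump D n = (\<lambda>x. flat 0 ((real n + 1) * x + (- 1))
      * flat 0 ((- (real n + 1)) * x + ((real n + 1) * D - 1)))"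
    by (auto simp: bump_def algebra_simps)
  then show ?thesis by (simp only: ndiff_mult ndiff_affine ndiff_flat)
qed

lemma bump_support:
  assumes "x \<notin> {1 / (real n + 1)..D - 1 / (real n + 1)}"
  shows "bump D n x = 0"
proof -
  have "(real n + 1) * x - 1 \<le> 0 \<or> (real n + 1) * (D - x) - 1 \<le> 0"
  proof (cases "x < 1 / (real n + 1)")
    case True
    then show ?thesis by (simp add: field_simps)
  next
    case False
    then have "D - x < 1 / (real n + 1)" using assms by auto
    then show ?thesis by (simp add: field_simps)
  qed
  then show ?thesis by (auto simp: bump_def flat_def)
qed

lemma flat0_tendsto: "a > 0 \<Longrightarrow> (\<lambda>n. flat 0 ((real n + 1) * a - 1)) \<longlonglongrightarrow> 1"
proof -
  assume a: "a > 0"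
  have lim: "filterlim (\<lambda>n. (real n + 1) * a - 1) at_top sequentially"
  proof (rule filterlim_at_top_mono)
    show "filterlim (\<lambda>n. a * real n + (a - 1)) at_top sequentially"
      using filterlim_tendsto_add_at_top[OF tendsto_const
          filterlim_tendsto_pos_mult_at_top[OF tendsto_const a filterlim_real_sequentially], of "a - 1"]
      by (simp add: add.commute)
  qed (auto simp: algebra_simps)
  have "((\<lambda>y::real. exp (- (inverse y))) \<longlongrightarrow> exp (- 0)) at_top"
    by (intro tendsto_intros tendsto_inverse_0_at_top filterlim_ident)
  then have "((\<lambda>y::real. exp (- (inverse y))) \<longlongrightarrow> 1) at_top" by simp
  then have "((\<lambda>y. flat 0 y) \<longlongrightarrow> 1) at_top"
  proof (rule Lim_transform_eventually)
    show "\<forall>\<^sub>F y in at_top. exp (- (inverse y)) = flat 0 y"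
      using eventually_gt_at_top[of 0] by eventually_elim (simp add: flat_def divide_inverse)
  qed
  then show ?thesis by (rule filterlim_compose) (rule lim)
qed

lemma bump_tendsto: "0 < x \<Longrightarrow> x < D \<Longrightarrow> (\<lambda>n. bump D n x) \<longlonglongrightarrow> 1"
  unfolding bump_def using tendsto_mult[OF flat0_tendsto[of x] flat0_tendsto[of "D - x"]] by simp

lemma test_funI:
  assumes "\<And>k. ndiff k \<phi>" "0 < a" "b < D" "\<And>x. x \<notin> {a..b} \<Longrightarrow> \<phi> x = 0"
  shows "test_fun D \<phi>"
  unfolding test_fun_def using assms ndiff_iff[of \<phi>] by blast

lemma test_fun_ndiff: "test_fun D \<phi> \<Longrightarrow> ndiff k \<phi>"
  unfolding test_fun_def using ndiff_iff by blast

lemma test_fun_bump_mult: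
  assumes "\<And>k. ndiff k s" shows "test_fun D (\<lambda>x. bump D n x * s x)"
  by (rule test_funI[of _ "1 / (real n + 1)" "D - 1 / (real n + 1)"])
    (auto intro: ndiff_mult ndiff_bump assms simp: bump_support)

lemma test_fun_combine:
  assumes "test_fun D f" "test_fun D g"
  shows "test_fun D (\<lambda>x. f x + c * g x)"
proof -
  obtain a b a' b' where ab: "0 < a" "b < D" "\<And>x. x \<notin> {a..b} \<Longrightarrow> f x = 0"
      "0 < a'" "b' < D" "\<And>x. x \<notin> {a'..b'} \<Longrightarrow> g x = 0"
    using assms unfolding test_fun_def by metis
  show ?thesis
  proof (rule test_funI[of _ "min a a'" "max b b'"])
    fix x assume "x \<notin> {min a a'..max b b'}"
    then have "x \<notin> {a..b}" "x \<notin> {a'..b'}" by auto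
    then show "f x + c * g x = 0" using ab(3,6) by simp
  qed (use ab in \<open>auto intro!: ndiff_add ndiff_mult test_fun_ndiff[OF assms(1)] test_fun_ndiff[OF assms(2)]\<close>)
qed

lemma test_fun_continuous: "test_fun D \<phi> \<Longrightarrow> continuous_on A \<phi>"
  using ndiff_differentiable[OF test_fun_ndiff]
  by (meson continuous_at_imp_continuous_on differentiable_imp_continuous_within)

lemma test_fun_L2I: "test_fun D \<phi> \<Longrightarrow> (\<lambda>x. complex_of_real (\<phi> x)) \<in> L2I D"
  by (intro L2I_continuous continuous_intros test_fun_continuous)

section \<open>The fundamental lemma of the calculus of variations and its relatives\<close>

lemma AE_lebI_open:
  assumes "\<And>x. 0 < x \<Longrightarrow> x < D \<Longrightarrow> P x"
  shows "AE x in lebI D. P x"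
proof (subst AE_restrict_space_iff)
  have "AE x in lebesgue. x \<notin> {0, D}" by (rule AE_not_in) (simp add: negligible_iff_null_sets[symmetric])
  then show "AE x in lebesgue. x \<in> {0..D} \<longrightarrow> P x"
    by eventually_elim (use assms in \<open>force simp: less_le\<close>)
qed auto

lemma bump_mult_tendsto:
  assumes "D > 0" "continuous_on {0..D} s"
  shows "(\<lambda>n. nrm D (\<lambda>x. complex_of_real (bump D n x * s x) - complex_of_real (s x))) \<longlonglongrightarrow> 0"
proof (rule nrm_dominated_convergence)
  have bc: "continuous_on {0..D} (bump D n)" for n
    using ndiff_differentiable[OF ndiff_bump]
    by (meson continuous_at_imp_continuous_on differentiable_imp_continuous_within)
  show "(\<lambda>x. complex_of_real (bump D n x * s x)) \<in> borel_measurable (lebI D)" for n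
    by (intro continuous_imp_measurable_lebI continuous_intros bc assms(2))
  show s: "(\<lambda>x. complex_of_real (s x)) \<in> L2I D" by (intro L2I_continuous continuous_intros assms(2))
  then show "(\<lambda>x. complex_of_real (s x)) \<in> L2I D" .
  show "AE x in lebI D. (\<lambda>n. complex_of_real (bump D n x * s x)) \<longlonglongrightarrow> complex_of_real (s x)"
  proof (rule AE_lebI_open)
    fix x assume "0 < x" "x < D"
    then show "(\<lambda>n. complex_of_real (bump D n x * s x)) \<longlonglongrightarrow> complex_of_real (s x)"
      using tendsto_of_real[OF tendsto_mult[OF bump_tendsto tendsto_const[of "s x"]]] by simp
  qed
  fix n x
  have "cmod (complex_of_real (bump D n x * s x) - complex_of_real (s x))
      = \<bar>bump D n x - 1\<bar> * \<bar>s x\<bar>"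
    by (simp add: algebra_simps flip: of_real_mult of_real_diff abs_mult)
  also have "\<dots> \<le> 1 * \<bar>s x\<bar>"
    using bump_bounds[of D n x] by (intro mult_right_mono) auto
  finally show "cmod (complex_of_real (bump D n x * s x) - complex_of_real (s x)) \<le> cmod (complex_of_real (s x))"
    by simp
qed

text \<open>A cutoff times a real polynomial is a test function. Letting the cutoff tend to 1 shows
  that h integrates to 0 against all real, then all complex polynomials. Polynomials approximating
  the conjugate of h finally give that the squared norm of h is 0.\<close>

lemma fundamental_lemma_variations:
  assumes D: "D > 0" and h: "h \<in> L2I D"
    and orth: "\<And>\<psi>. test_fun D \<psi> \<Longrightarrow>
      lint D (\<lambda>x. h x * complex_of_real (\<psi> x)) = 0"
  shows "AE x in lebI D. h x = 0"
proof -
  let ?I = "lint D"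
  have rp: "?I (\<lambda>x. complex_of_real (s x) * h x) = 0" if s: "real_polynomial_function s" for s
  proof -
    have t: "test_fun D (\<lambda>x. bump D n x * s x)" for n
      using test_fun_bump_mult[OF ndiff_real_polynomial[OF s]] .
    have qc: "continuous_on {0..D} s"
      using s by (simp add: continuous_on_polymonial_function real_polynomial_function_eq)
    have "(\<lambda>n. ?I (\<lambda>x. complex_of_real (bump D n x * s x) * h x)) \<longlonglongrightarrow> ?I (\<lambda>x. complex_of_real (s x) * h x)"
      by (intro tendsto_integral_mult_L2I h test_fun_L2I t bump_mult_tendsto D qc
          L2I_continuous continuous_intros)
    moreover have "?I (\<lambda>x. complex_of_real (bump D n x * s x) * h x) = 0" for n
      using orth[OF t, of n] by (simp add: mult.commute)
    ultimately show ?thesis by (simp add: LIMSEQ_const_iff)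
  qed
  have cp: "?I (\<lambda>x. p x * h x) = 0" if p: "polynomial_function p" for p
  proof -
    have r: "real_polynomial_function (\<lambda>x. Re (p x))" "real_polynomial_function (\<lambda>x. Im (p x))"
      using p bounded_linear_Re bounded_linear_Im unfolding polynomial_function_def o_def by blast+
    have L: "(\<lambda>x. complex_of_real (Re (p x))) \<in> L2I D" "(\<lambda>x. complex_of_real (Im (p x))) \<in> L2I D"
      by (intro L2I_continuous continuous_intros continuous_on_polymonial_function[OF p])+
    have "?I (\<lambda>x. p x * h x)
      = ?I (\<lambda>x. complex_of_real (Re (p x)) * h x + \<i> * (complex_of_real (Im (p x)) * h x))"
    proof (rule arg_cong[where f="?I"], rule ext)
      fix x
      show "p x * h x = complex_of_real (Re (p x)) * h x + \<i> * (complex_of_real (Im (p x)) * h x)"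
        by (subst complex_eq[of "p x"]) (simp add: algebra_simps)
    qed
    also have "\<dots> = 0"
      using rp[OF r(1)] rp[OF r(2)] L2I_mult_integrable[OF L(1) h] L2I_mult_integrable[OF L(2) h]
      by simp
    finally show ?thesis .
  qed
  obtain P where P: "\<And>n. polynomial_function (P n)" "(\<lambda>n::nat. nrm D (\<lambda>x. P n x - cnj (h x))) \<longlonglongrightarrow> 0"
    using L2I_approx_polynomial_seq[OF D L2I_cnj[OF h]] by blast
  have "(\<lambda>n. ?I (\<lambda>x. P n x * h x)) \<longlonglongrightarrow> ?I (\<lambda>x. cnj (h x) * h x)"
    by (intro tendsto_integral_mult_L2I h P L2I_polynomial L2I_cnj)
  then have "?I (\<lambda>x. cnj (h x) * h x) = 0" using cp[OF P(1)] by (simp add: LIMSEQ_const_iff)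
  moreover have "?I (\<lambda>x. cnj (h x) * h x) = complex_of_real ((nrm D h)\<^sup>2)"
    by (simp add: nrm_sq mult.commute[of "cnj _"] complex_norm_square[symmetric] flip: integral_complex_of_real)
  ultimately have "nrm D h = 0" by simp
  then show ?thesis by (rule nrm_zero_imp_AE[OF h])
qed

text \<open>An antiderivative is constant on either side of the support, and the two constants agree
  precisely because the total integral is 0; subtracting the common constant gives compact
  support.\<close>

lemma test_fun_antiderivative:
  assumes D: "D > 0" and t: "test_fun D \<theta>" and int0: "integral {0..D} \<theta> = 0"
  shows "\<exists>\<phi>. test_fun D \<phi> \<and> deriv \<phi> = \<theta>"
proof -
  have "\<exists>F. \<forall>x::real. - \<infinity> < ereal x \<longrightarrow> ereal x < \<infinity> \<longrightarrow> (F has_vector_derivative \<theta> x) (at x)"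
    using test_fun_continuous[OF t, of UNIV]
    by (intro einterval_antiderivative) (auto simp: continuous_on_eq_continuous_at)
  then obtain F where F: "\<And>x. (F has_vector_derivative \<theta> x) (at x)" by auto
  obtain a b where ab: "0 < a" "b < D" "\<And>x. x \<notin> {a..b} \<Longrightarrow> \<theta> x = 0"
    using t unfolding test_fun_def by metis
  have ftc: "(\<theta> has_integral (F y - F x)) {x..y}" if "x \<le> y" for x y
    by (rule fundamental_theorem_of_calculus[OF that has_vector_derivative_at_within[OF F]])
  have eq: "F x = F y" if "x \<le> y" "\<And>z. z \<in> {x..y} \<Longrightarrow> \<theta> z = 0" for x y
    using has_integral_unique[OF ftc[OF that(1)] has_integral_is_0[OF that(2)]] by simp
  \<comment> \<open>The support interval is enlarged strictly: constancy of F up to and including a'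
    and from b' on needs \<open>\<theta>\<close> to vanish at a' and b' themselves, which is not
    known at a and b.\<close>
  define a' where "a' = a / 2"
  define b' where "b' = (b + D) / 2"
  have F0D: "F 0 = F D" using ftc[of 0 D] D int0 by (simp add: integral_unique)
  have "F 0 = F a'" using ab by (intro eq) (auto simp: a'_def)
  have "F D = F b'" using ab by (intro eq[symmetric]) (auto simp: b'_def)
  have z1: "F x = F a'" if "x < a'" for x using ab that by (intro eq) (auto simp: a'_def)
  have z2: "F x = F b'" if "x > b'" for x using ab that by (intro eq[symmetric]) (auto simp: b'_def)
  define \<phi> where "\<phi> x = F x - F a'" for x
  have d: "(\<phi> has_real_derivative \<theta> x) (at x)" for x
  proof -
    have "(F has_real_derivative \<theta> x) (at x)"
      using F by (simp add: has_real_derivative_iff_has_vector_derivative)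
    from DERIV_diff[OF this DERIV_const[of "F a'"]] show ?thesis unfolding \<phi>_def by simp
  qed
  then have de: "deriv \<phi> = \<theta>" by (intro ext DERIV_imp_deriv)
  have "ndiff k \<phi>" for k
    using d de test_fun_ndiff[OF t] by (cases k) (auto simp: real_differentiable_def)
  then have "test_fun D \<phi>"
  proof (rule test_funI[of _ a' b'])
    fix x assume "x \<notin> {a'..b'}"
    then show "\<phi> x = 0"
      using z1[of x] z2[of x] F0D \<open>F 0 = F a'\<close> \<open>F D = F b'\<close> by (auto simp: \<phi>_def)
  qed (use ab in \<open>auto simp: a'_def b'_def\<close>)
  with de show ?thesis by blast
qed

text \<open>Subtracting from a test function a multiple of one fixed bump of positive integral makes
  its integral 0, so the difference is the derivative of a test function. Hence h minus a constant,
  namely the mean of h weighted by the bump, is orthogonal to all test functions.\<close>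

lemma du_Bois_Reymond:
  assumes D: "D > 0" and h: "h \<in> L2I D"
    and orth: "\<And>\<phi>. test_fun D \<phi> \<Longrightarrow>
      lint D (\<lambda>x. h x * complex_of_real (deriv \<phi> x)) = 0"
  shows "\<exists>c. AE x in lebI D. h x = c"
proof -
  let ?I = "lint D"
  have intC: "?I (\<lambda>x. complex_of_real (\<psi> x)) = complex_of_real (integral {0..D} \<psi>)"
    if "continuous_on {0..D} \<psi>" for \<psi>
  proof -
    have i: "integrable (lebI D) (\<lambda>x. complex_of_real (\<psi> x))"
      by (intro L2I_integrable L2I_continuous continuous_intros that)
    then have "integrable (lebI D) \<psi>"
      using integrable_Re[OF i] by simp
    then show ?thesis by (simp add: lebesgue_integral_eq_integral)
  qed
  have bt: "test_fun D (bump D n)" for n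
    using test_fun_bump_mult[of "\<lambda>x. 1" D n] by simp
  \<comment> \<open>The integrals of the bumps tend to D, so some bump has the positive integral
    needed for the normalisation.\<close>
  have "(\<lambda>n. ?I (\<lambda>x. complex_of_real (bump D n x * 1) * 1)) \<longlonglongrightarrow> ?I (\<lambda>x. complex_of_real 1 * 1)"
    using test_fun_L2I[OF bt] bump_mult_tendsto[OF D, of "\<lambda>x. 1"]
    by (intro tendsto_integral_mult_L2I L2I_const) auto
  then have "(\<lambda>n. complex_of_real (integral {0..D} (bump D n))) \<longlonglongrightarrow> complex_of_real D"
    using measure_lebI[of D] D intC[OF test_fun_continuous[OF bt]] by (simp add: scaleR_conv_of_real)
  then have "(\<lambda>n. integral {0..D} (bump D n)) \<longlonglongrightarrow> D" by (simp only: tendsto_of_real_iff)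
  then have "\<forall>\<^sub>F n in sequentially. integral {0..D} (bump D n) > 0" using D by (rule order_tendstoD)
  then obtain n where n: "integral {0..D} (bump D n) > 0" by (auto simp: eventually_sequentially)
  define s where "s = integral {0..D} (bump D n)"
  define c where "c = ?I (\<lambda>x. h x * complex_of_real (bump D n x)) / complex_of_real s"
  have "AE x in lebI D. h x - c = 0"
  proof (rule fundamental_lemma_variations[OF D L2I_diff[OF h L2I_const]])
    fix \<psi> assume t: "test_fun D \<psi>"
    define k where "k = - (integral {0..D} \<psi> / s)"
    define \<theta> where "\<theta> x = \<psi> x + k * bump D n x" for x
    have t\<theta>: "test_fun D \<theta>" unfolding \<theta>_def by (rule test_fun_combine[OF t bt])
    have i: "\<psi> integrable_on {0..D}" "bump D n integrable_on {0..D}"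
      using test_fun_continuous[OF t] test_fun_continuous[OF bt]
      by (auto intro: integrable_continuous_real)
    have "integral {0..D} \<theta> = integral {0..D} \<psi> + k * s"
      unfolding \<theta>_def s_def using i
      by (subst Henstock_Kurzweil_Integration.integral_add) (auto intro!: integrable_on_mult_right)
    then have "integral {0..D} \<theta> = 0" using n by (simp add: k_def s_def)
    then obtain \<phi> where \<phi>: "test_fun D \<phi>" "deriv \<phi> = \<theta>"
      using test_fun_antiderivative[OF D t\<theta>] by blast
    have ints: "integrable (lebI D) (\<lambda>x. h x * complex_of_real (\<psi> x))"
        "integrable (lebI D) (\<lambda>x. h x * complex_of_real (bump D n x))"
        "integrable (lebI D) (\<lambda>x. complex_of_real (\<psi> x))"
      by (intro L2I_mult_integrable h test_fun_L2I t bt L2I_integrable)+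
    have "0 = ?I (\<lambda>x. h x * complex_of_real (\<theta> x))" using orth[OF \<phi>(1)] \<phi>(2) by simp
    also have "\<dots> = ?I (\<lambda>x. h x * complex_of_real (\<psi> x)
        + complex_of_real k * (h x * complex_of_real (bump D n x)))"
      by (simp add: \<theta>_def algebra_simps)
    also have "\<dots> = ?I (\<lambda>x. h x * complex_of_real (\<psi> x))
        + complex_of_real k * ?I (\<lambda>x. h x * complex_of_real (bump D n x))"
      using ints by simp
    also have "\<dots> = ?I (\<lambda>x. h x * complex_of_real (\<psi> x)) - c * ?I (\<lambda>x. complex_of_real (\<psi> x))"
      using intC[OF test_fun_continuous[OF t]] by (simp add: k_def c_def)
    also have "\<dots> = ?I (\<lambda>x. (h x - c) * complex_of_real (\<psi> x))"
      using ints by (simp add: left_diff_distrib)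
    finally show "?I (\<lambda>x. (h x - c) * complex_of_real (\<psi> x)) = 0" by simp
  qed
  then show ?thesis by auto
qed

lemma test_fun_ends: assumes "test_fun D \<phi>" shows "\<phi> 0 = 0" "\<phi> D = 0"
  using assms unfolding test_fun_def by (force)+

lemma test_fun_deriv:
  assumes "test_fun D \<phi>"
  shows "(complex_of_real \<circ> \<phi> has_vector_derivative complex_of_real (deriv \<phi> x)) (at x within A)"
    and "continuous_on A (\<lambda>x. complex_of_real (deriv \<phi> x))"
proof -
  have n: "ndiff (Suc 0) \<phi>" using test_fun_ndiff[OF assms] .
  then have "(\<phi> has_vector_derivative deriv \<phi> x) (at x)"
    using DERIV_deriv_differentiable[of \<phi> x]
    by (simp add: has_real_derivative_iff_has_vector_derivative)
  then show "(complex_of_real \<circ> \<phi> has_vector_derivative complex_of_real (deriv \<phi> x)) (at x within A)"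
    unfolding o_def
    by (rule has_vector_derivative_at_within[OF bounded_linear.has_vector_derivative[OF bounded_linear_of_real]])
  have "\<And>x. deriv \<phi> differentiable (at x)" using n by simp
  then show "continuous_on A (\<lambda>x. complex_of_real (deriv \<phi> x))"
    by (intro continuous_on_of_real continuous_at_imp_continuous_on ballI
        differentiable_imp_continuous_within)
qed

lemma integral_prim_deriv_test:
  assumes "D > 0" "g \<in> L2I D" "test_fun D \<phi>"
  shows "lint D (\<lambda>x. prim g x * complex_of_real (deriv \<phi> x))
    = - lint D (\<lambda>x. g x * complex_of_real (\<phi> x))"
  using integration_by_parts_L2I[OF assms(1,2) test_fun_deriv[OF assms(3)]] test_fun_ends[OF assms(3)]
  by simp

lemma integral_deriv_test:
  assumes "D > 0" "test_fun D \<phi>"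
  shows "lint D (\<lambda>x. complex_of_real (deriv \<phi> x)) = 0"
proof -
  have "((\<lambda>x. complex_of_real (deriv \<phi> x)) has_integral complex_of_real (\<phi> D) - complex_of_real (\<phi> 0)) {0..D}"
    using fundamental_theorem_of_calculus[OF _ test_fun_deriv(1)[OF assms(2)]] assms(1) by simp
  then show ?thesis
    using test_fun_ends[OF assms(2)] integral_lebI_continuous[OF test_fun_deriv(2)[OF assms(2)]]
    by (simp add: integral_unique)
qed

text \<open>The bridge from the distributional definition to calculus: from left to right by the
  lemma of du Bois-Reymond applied to \<open>f - prim g\<close>, from right to left by integration
  by parts. It is what yields the representatives used from here on.\<close>

lemma has_weak_deriv_iff:
  assumes D: "D > 0" and f: "f \<in> L2I D" and g: "g \<in> L2I D"
  shows "has_weak_deriv D f g \<longleftrightarrow> (\<exists>c. AE x in lebI D. f x = c + prim g x)"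
proof
  let ?I = "lint D"
  have pg: "prim g \<in> L2I D" by (intro L2I_continuous prim_continuous D g)
  have dL: "(\<lambda>x. complex_of_real (deriv \<phi> x)) \<in> L2I D" if "test_fun D \<phi>" for \<phi>
    using test_fun_deriv(2)[OF that] by (rule L2I_continuous)
  { assume w: "has_weak_deriv D f g"
    have "\<exists>c. AE x in lebI D. f x - prim g x = c"
    proof (rule du_Bois_Reymond[OF D L2I_diff[OF f pg]])
      fix \<phi> assume t: "test_fun D \<phi>"
      have "?I (\<lambda>x. (f x - prim g x) * complex_of_real (deriv \<phi> x))
        = ?I (\<lambda>x. f x * complex_of_real (deriv \<phi> x)) - ?I (\<lambda>x. prim g x * complex_of_real (deriv \<phi> x))"
        using L2I_mult_integrable[OF f dL[OF t]] L2I_mult_integrable[OF pg dL[OF t]]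
        by (simp add: left_diff_distrib)
      also have "\<dots> = 0"
        using w t integral_prim_deriv_test[OF D g t] by (simp add: has_weak_deriv_def)
      finally show "?I (\<lambda>x. (f x - prim g x) * complex_of_real (deriv \<phi> x)) = 0" .
    qed
    then obtain c where "AE x in lebI D. f x - prim g x = c" by blast
    then have "AE x in lebI D. f x = c + prim g x" by eventually_elim auto
    then show "\<exists>c. AE x in lebI D. f x = c + prim g x" by blast }
  { assume "\<exists>c. AE x in lebI D. f x = c + prim g x"
    then obtain c where c: "AE x in lebI D. f x = c + prim g x" by blast
    show "has_weak_deriv D f g"
      unfolding has_weak_deriv_def
    proof (intro allI impI)
      fix \<phi> assume t: "test_fun D \<phi>"
      have "?I (\<lambda>x. f x * complex_of_real (deriv \<phi> x)) = ?I (\<lambda>x. (c + prim g x) * complex_of_real (deriv \<phi> x))"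
      proof (rule integral_cong_AE)
        show "AE x in lebI D. f x * complex_of_real (deriv \<phi> x) = (c + prim g x) * complex_of_real (deriv \<phi> x)"
          using c by eventually_elim auto
      qed (use f pg dL[OF t] in \<open>auto intro!: borel_measurable_times borel_measurable_add dest: L2I_meas\<close>)
      also have "\<dots> = ?I (\<lambda>x. c * complex_of_real (deriv \<phi> x)) + ?I (\<lambda>x. prim g x * complex_of_real (deriv \<phi> x))"
        using L2I_integrable[OF dL[OF t]] L2I_mult_integrable[OF pg dL[OF t]]
        by (simp add: distrib_right)
      also have "\<dots> = - ?I (\<lambda>x. g x * complex_of_real (\<phi> x))"
        using integral_deriv_test[OF D t] integral_prim_deriv_test[OF D g t] by simp
      finally show "?I (\<lambda>x. f x * complex_of_real (deriv \<phi> x)) = - ?I (\<lambda>x. g x * complex_of_real (\<phi> x))" .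
    qed }
qed

lemma weak_deriv_unique:
  assumes D: "D > 0" and g: "g \<in> L2I D" "g' \<in> L2I D"
    and "has_weak_deriv D f g" "has_weak_deriv D f g'"
  shows "AE x in lebI D. g x = g' x"
proof -
  have "AE x in lebI D. g x - g' x = 0"
  proof (rule fundamental_lemma_variations[OF D L2I_diff[OF g]])
    fix \<psi> assume t: "test_fun D \<psi>"
    show "lint D (\<lambda>x. (g x - g' x) * complex_of_real (\<psi> x)) = 0"
      using assms(4,5) t L2I_mult_integrable[OF g(1) test_fun_L2I[OF t]]
        L2I_mult_integrable[OF g(2) test_fun_L2I[OF t]]
      by (simp add: left_diff_distrib has_weak_deriv_def)
  qed
  then show ?thesis by eventually_elim auto
qed

section \<open>Continuous representatives and boundary values\<close>

text \<open>The primitive does not see null sets, so it is identically 0; its derivative is k at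
  every point, endpoints included. This gives uniqueness of the representative that
  \<open>cval\<close> refers to.\<close>

lemma continuous_AE_zero:
  fixes k :: "real \<Rightarrow> complex"
  assumes "D > 0" "continuous_on {0..D} k" "AE x in lebI D. k x = 0" "x \<in> {0..D}"
  shows "k x = 0"
proof -
  have "prim k y = 0" if "y \<in> {0..D}" for y
    using prim_cong_AE[OF L2I_continuous[OF assms(2)] L2I_const[of 0], of y] that assms(3)
    by (simp add: prim_def)
  then have "(prim k has_vector_derivative 0) (at x within {0..D})"
    by (intro has_vector_derivative_transform[OF assms(4) _ has_vector_derivative_const]) auto
  then show ?thesis
    using vector_derivative_unique_within_closed_interval[of 0 D x "prim k" "k x" 0]
      prim_continuous_fun[OF assms(2,4)] assms(1,4) by simp
qed

lemma cval_eq: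
  assumes D: "D > 0" and h: "continuous_on {0..D} h" "AE y in lebI D. f y = h y"
    and x: "x \<in> {0..D}"
  shows "cval D f x = h x"
  unfolding cval_def
proof (rule the_equality)
  show "\<exists>h'. continuous_on {0..D} h' \<and> (AE y in lebI D. h' y = f y) \<and> h' x = h x"
    using h by (intro exI[of _ h]) auto
  fix c
  assume "\<exists>h. continuous_on {0..D} h \<and> (AE y in lebI D. h y = f y) \<and> h x = c"
  then obtain g where g: "continuous_on {0..D} g" "AE y in lebI D. g y = f y" "g x = c"
    by blast
  have "AE y in lebI D. g y - h y = 0"
    using g(2) h(2) by eventually_elim auto
  then have "g x - h x = 0"
    by (intro continuous_AE_zero[OF D _ _ x] continuous_intros g(1) h(1))
  with g(3) show "c = h x" by simp
qed

lemma has_weak_deriv_cong_AE: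
  assumes "has_weak_deriv D f g" "f \<in> L2I D" "f' \<in> L2I D" "AE x in lebI D. f x = f' x"
  shows "has_weak_deriv D f' g"
  unfolding has_weak_deriv_def
proof (intro allI impI)
  fix \<phi> assume t: "test_fun D \<phi>"
  have "lint D (\<lambda>x. f' x * complex_of_real (deriv \<phi> x))
    = lint D (\<lambda>x. f x * complex_of_real (deriv \<phi> x))"
  proof (rule integral_cong_AE)
    show "AE x in lebI D. f' x * complex_of_real (deriv \<phi> x) = f x * complex_of_real (deriv \<phi> x)"
      using assms(4) by eventually_elim auto
  qed (use assms L2I_continuous[OF test_fun_deriv(2)[OF t], of D] in
      \<open>auto intro!: borel_measurable_times dest: L2I_meas\<close>)
  then show "lint D (\<lambda>x. f' x * complex_of_real (deriv \<phi> x))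
    = - lint D (\<lambda>x. g x * complex_of_real (\<phi> x))"
    using assms(1) t by (simp add: has_weak_deriv_def)
qed

lemma wderiv_AE:
  assumes "D > 0" "g \<in> L2I D" "has_weak_deriv D f g"
  shows "wderiv D f \<in> L2I D" "has_weak_deriv D f (wderiv D f)"
    "AE x in lebI D. wderiv D f x = g x"
proof -
  have "wderiv D f \<in> L2I D \<and> has_weak_deriv D f (wderiv D f)"
    unfolding wderiv_def by (rule someI[of _ g]) (use assms in auto)
  then show 1: "wderiv D f \<in> L2I D" "has_weak_deriv D f (wderiv D f)" by auto
  show "AE x in lebI D. wderiv D f x = g x"
    by (rule weak_deriv_unique[OF assms(1) 1(1) assms(2) 1(2) assms(3)])
qed

text \<open>\<open>f\<close> is a \<open>C\<^sup>1\<close> representative of \<open>u\<close>, with \<open>f' = p\<close> everywhere and \<open>p' = z\<close> in the integrated sense.\<close>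

definition H2_rep :: "real \<Rightarrow> (real \<Rightarrow> complex) \<Rightarrow> (real \<Rightarrow> complex) \<Rightarrow> (real \<Rightarrow> complex)
    \<Rightarrow> (real \<Rightarrow> complex) \<Rightarrow> bool" where
  "H2_rep D u f p z \<longleftrightarrow> u \<in> L2I D \<and> z \<in> L2I D \<and> (\<forall>x\<in>{0..D}. p x = p 0 + prim z x)
    \<and> (\<forall>x\<in>{0..D}. f x = f 0 + prim p x) \<and> (AE x in lebI D. u x = f x)"

text \<open>The weak derivative v is itself only determined almost everywhere. Its continuous
  representative p has the same primitive, so integrating p instead makes f continuously
  differentiable with derivative p everywhere.\<close>

lemma H2_rep_exists:
  assumes D: "D > 0" and u: "u \<in> L2I D" and v: "v \<in> L2I D" and w: "w \<in> L2I D"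
    and d: "has_weak_deriv D u v" "has_weak_deriv D v w"
  shows "\<exists>f p. H2_rep D u f p w"
proof -
  obtain c where c: "AE x in lebI D. u x = c + prim v x"
    using d(1) has_weak_deriv_iff[OF D u v] by blast
  obtain c' where c': "AE x in lebI D. v x = c' + prim w x"
    using d(2) has_weak_deriv_iff[OF D v w] by blast
  define p where "p x = c' + prim w x" for x
  define f where "f x = c + prim p x" for x
  have pL: "p \<in> L2I D"
    unfolding p_def by (intro L2I_continuous continuous_intros prim_continuous D w)
  have "prim v x = prim p x" if "x \<le> D" for x
    using c' unfolding p_def[symmetric] by (rule prim_cong_AE[OF v pL that])
  then have "AE x in lebI D. u x = f x"
  proof -
    have "AE x in lebI D. x \<le> D" by (rule AE_I2) simp
    with c show ?thesis by eventually_elim (use \<open>\<And>x. x \<le> D \<Longrightarrow> prim v x = prim p x\<close> in \<open>simp add: f_def\<close>)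
  qed
  then have "H2_rep D u f p w" using u w by (simp add: H2_rep_def p_def f_def)
  then show ?thesis by blast
qed

context
  fixes D :: real and u f p z :: "real \<Rightarrow> complex"
  assumes D: "D > 0" and rep: "H2_rep D u f p z"
begin

lemma H2_rep_z: "z \<in> L2I D" and H2_rep_u: "u \<in> L2I D"
  and H2_rep_p: "x \<in> {0..D} \<Longrightarrow> p x = p 0 + prim z x"
  and H2_rep_f: "x \<in> {0..D} \<Longrightarrow> f x = f 0 + prim p x"
  and H2_rep_AE: "AE x in lebI D. u x = f x"
  using rep unfolding H2_rep_def by blast+

lemma H2_rep_continuous: "continuous_on {0..D} p" "continuous_on {0..D} f"
proof -
  have "continuous_on {0..D} (\<lambda>x. p 0 + prim z x)"
    by (intro continuous_intros prim_continuous D H2_rep_z)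
  then show p: "continuous_on {0..D} p"
    using continuous_on_cong[of "{0..D}" "{0..D}" p "\<lambda>x. p 0 + prim z x", OF refl H2_rep_p] by blast
  have "continuous_on {0..D} (\<lambda>x. f 0 + prim p x)"
    by (intro continuous_intros prim_continuous D L2I_continuous p)
  then show "continuous_on {0..D} f"
    using continuous_on_cong[of "{0..D}" "{0..D}" f "\<lambda>x. f 0 + prim p x", OF refl H2_rep_f] by blast
qed

lemma H2_rep_L2I: "p \<in> L2I D" "f \<in> L2I D"
  using H2_rep_continuous by (auto intro: L2I_continuous)

lemma H2_rep_f_deriv:
  assumes "x \<in> {0..D}" shows "(f has_vector_derivative p x) (at x within {0..D})"
proof -
  have "((\<lambda>x. f 0 + prim p x) has_vector_derivative 0 + p x) (at x within {0..D})"
    by (rule has_vector_derivative_add[OF has_vector_derivative_const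
          prim_continuous_fun[OF H2_rep_continuous(1) assms]])
  then have "((\<lambda>x. f 0 + prim p x) has_vector_derivative p x) (at x within {0..D})" by simp
  then show ?thesis
    by (rule has_vector_derivative_transform[OF assms, rotated]) (rule H2_rep_f)
qed

lemma H2_rep_weak: "has_weak_deriv D u p" "has_weak_deriv D p z"
proof -
  have "AE x in lebI D. p x = p 0 + prim z x"
    by (rule AE_I2) (rule H2_rep_p, simp)
  then show "has_weak_deriv D p z"
    using has_weak_deriv_iff[OF D H2_rep_L2I(1) H2_rep_z] by blast
  have "AE x in lebI D. f x = f 0 + prim p x"
    by (rule AE_I2) (rule H2_rep_f, simp)
  with H2_rep_AE have "AE x in lebI D. u x = f 0 + prim p x" by eventually_elim auto
  then show "has_weak_deriv D u p"
    using has_weak_deriv_iff[OF D H2_rep_u H2_rep_L2I(1)] by blast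
qed

lemma H2_rep_wderiv:
  "wderiv D u \<in> L2I D" "AE x in lebI D. wderiv D u x = p x"
  "wderiv D (wderiv D u) \<in> L2I D" "AE x in lebI D. wderiv D (wderiv D u) x = z x"
proof -
  note 1 = wderiv_AE[OF D H2_rep_L2I(1) H2_rep_weak(1)]
  show "wderiv D u \<in> L2I D" "AE x in lebI D. wderiv D u x = p x" using 1 by auto
  have "AE x in lebI D. p x = wderiv D u x" using 1(3) by eventually_elim auto
  then have "has_weak_deriv D (wderiv D u) z"
    by (rule has_weak_deriv_cong_AE[OF H2_rep_weak(2) H2_rep_L2I(1) 1(1)])
  note 2 = wderiv_AE[OF D H2_rep_z this]
  show "wderiv D (wderiv D u) \<in> L2I D" "AE x in lebI D. wderiv D (wderiv D u) x = z x"
    using 2 by auto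
qed

lemma H2_rep_cval:
  assumes "x \<in> {0..D}" shows "cval D u x = f x" "cval D (wderiv D u) x = p x"
  using cval_eq[OF D H2_rep_continuous(2) H2_rep_AE assms]
    cval_eq[OF D H2_rep_continuous(1) H2_rep_wderiv(2) assms] by auto

lemma prim_z_end: "prim z D = p D - p 0"
  using H2_rep_p[of D] D by simp

text \<open>Integration by parts of \<open>prim z\<close>, which is \<open>p - p 0\<close>, against
  the conjugate of f. The contribution of \<open>p 0\<close> merges with
  \<open>prim z D = p D - p 0\<close> into the two boundary terms.\<close>

lemma H2_rep_green:
  "ip D z f
    = p D * cnj (f D) - p 0 * cnj (f 0) - of_real ((nrm D p)\<^sup>2)"
proof -
  let ?I = "lint D"
  have cp: "(\<lambda>x. cnj (p x)) \<in> L2I D" by (intro L2I_cnj H2_rep_L2I)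
  have "?I (\<lambda>x. prim z x * cnj (p x)) = prim z D * cnj (f D) - ?I (\<lambda>x. z x * cnj (f x))"
  proof (rule integration_by_parts_L2I[OF D H2_rep_z])
    show "((\<lambda>x. cnj (f x)) has_vector_derivative cnj (p x)) (at x within {0..D})" if "x \<in> {0..D}" for x
      by (rule bounded_linear.has_vector_derivative[OF bounded_linear_cnj H2_rep_f_deriv[OF that]])
    show "continuous_on {0..D} (\<lambda>x. cnj (p x))" by (intro continuous_intros H2_rep_continuous)
  qed
  moreover have "?I (\<lambda>x. prim z x * cnj (p x)) = ?I (\<lambda>x. p x * cnj (p x) - p 0 * cnj (p x))"
  proof (intro Bochner_Integration.integral_cong refl)
    fix x assume "x \<in> space (lebI D)"
    then have "prim z x = p x - p 0" using H2_rep_p[of x] by simp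
    then show "prim z x * cnj (p x) = p x * cnj (p x) - p 0 * cnj (p x)"
      by (simp only: left_diff_distrib)
  qed
  moreover have "\<dots> = ?I (\<lambda>x. p x * cnj (p x)) - p 0 * ?I (\<lambda>x. cnj (p x))"
    using L2I_mult_integrable[OF H2_rep_L2I(1) cp] L2I_integrable[OF cp] by simp
  moreover have "?I (\<lambda>x. p x * cnj (p x)) = of_real ((nrm D p)\<^sup>2)"
    by (simp add: nrm_sq complex_norm_square[symmetric] flip: integral_complex_of_real)
  moreover have "?I (\<lambda>x. cnj (p x)) = cnj (f D - f 0)"
    using H2_rep_f[of D] D by (simp add: prim_def)
  ultimately have "prim z D * cnj (f D) - ?I (\<lambda>x. z x * cnj (f x))
      = of_real ((nrm D p)\<^sup>2) - p 0 * cnj (f D - f 0)"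
    by (simp only:)
  then show ?thesis unfolding prim_z_end by (simp add: algebra_simps)
qed

lemma H2_rep_osc:
  assumes "x \<in> {0..D}" "y \<in> {0..D}" shows "cmod (f x - f y) \<le> 2 * sqrt D * nrm D p"
proof -
  have "f x - f y = prim p x - prim p y" using H2_rep_f[OF assms(1)] H2_rep_f[OF assms(2)] by simp
  then show ?thesis
    using prim_bound[OF H2_rep_L2I(1) assms(1)] prim_bound[OF H2_rep_L2I(1) assms(2)]
      norm_triangle_ineq4[of "prim p x" "prim p y"] by simp
qed

lemma H2_rep_mean: "lint D u = lint D f"
  using H2_rep_AE H2_rep_u H2_rep_L2I(2) by (intro integral_cong_AE) (auto dest: L2I_meas)

text \<open>The deviation from the mean is the mean of the deviations \<open>f x - f y\<close>, each
  bounded by \<open>H2_rep_osc\<close>. At the endpoints this compares boundary values with means at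
  the cost of the derivative alone, which is why the limit is governed by means.\<close>

lemma H2_rep_mean_osc:
  assumes x: "x \<in> {0..D}"
  shows "cmod (f x - lint D u / of_real D) \<le> 2 * sqrt D * nrm D p"
proof -
  let ?I = "lint D"
  have "of_real D * (f x - ?I u / of_real D) = of_real D * f x - ?I f"
    using D by (simp add: H2_rep_mean field_simps)
  also have "\<dots> = ?I (\<lambda>y. f x - f y)"
    using L2I_integrable[OF H2_rep_L2I(2)] L2I_integrable[OF L2I_const[of "f x" D]] measure_lebI[of D] D
    by (simp add: scaleR_conv_of_real)
  finally have "D * cmod (f x - ?I u / of_real D) = cmod (?I (\<lambda>y. f x - f y))"
    using D by (metis abs_of_pos norm_mult norm_of_real)
  also have "\<dots> \<le> lint D (\<lambda>y. cmod (f x - f y))"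
    by (rule integral_norm_bound)
  also have "\<dots> \<le> lint D (\<lambda>y. 2 * sqrt D * nrm D p)"
    using H2_rep_osc[OF x] L2I_integrable[OF L2I_diff[OF L2I_const[of "f x"] H2_rep_L2I(2)]]
    by (intro integral_mono finite_measure.integrable_const integrable_norm) auto
  also have "\<dots> = D * (2 * sqrt D * nrm D p)" using measure_lebI[of D] D by simp
  finally show ?thesis using D by simp
qed

text \<open>Poincare's inequality, read off from the pointwise bound; the constant is not sharp, but
  only its independence of \<kappa> matters.\<close>

lemma H2_rep_poincare:
  "nrm D (\<lambda>x. u x - lint D u / of_real D) \<le> 2 * D * nrm D p"
proof -
  define m where "m = lint D u / of_real D"
  have "AE x in lebI D. u x - m = f x - m" using H2_rep_AE by eventually_elim auto
  then have "nrm D (\<lambda>x. u x - m) = nrm D (\<lambda>x. f x - m)"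
    using H2_rep_u H2_rep_L2I(2) by (intro nrm_cong_AE L2I_meas L2I_diff L2I_const)
  also have "\<dots> \<le> sqrt D * (2 * sqrt D * nrm D p)"
    using D H2_rep_mean_osc unfolding m_def
    by (intro nrm_bound L2I_meas L2I_diff L2I_const H2_rep_L2I) auto
  also have "\<dots> = 2 * D * nrm D p" using D by simp
  finally show ?thesis by (simp add: m_def)
qed

end

lemma mean_bound:
  assumes "D > 0" "u \<in> L2I D"
  shows "cmod (lint D u / of_real D) \<le> nrm D u / sqrt D"
proof -
  have "cmod (lint D u) \<le> sqrt D * nrm D u"
    using integral_norm_bound[of "lebI D" u] integral_cmod_le_nrm[OF assms(2)] assms(1)
    by (meson less_imp_le order_trans)
  then have "cmod (lint D u) / D \<le> sqrt D * nrm D u / D"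
    using assms(1) by (intro divide_right_mono) auto
  also have "\<dots> = nrm D u / sqrt D"
    using assms(1) by (simp add: field_simps)
  finally show ?thesis using assms(1) by (simp add: norm_divide)
qed

text \<open>Pythagoras: \<open>u - m\<close> has integral 0 and is therefore orthogonal to
  constants. With \<open>c = 0\<close> it relates energy to fluctuation, with c a limit value it
  splits the error.\<close>

lemma nrm_split_mean:
  assumes "D > 0" "u \<in> L2I D"
  defines "m \<equiv> lint D u / of_real D"
  shows "(nrm D (\<lambda>x. u x - c))\<^sup>2 = (nrm D (\<lambda>x. u x - m))\<^sup>2 + D * (cmod (m - c))\<^sup>2"
proof -
  let ?I = "lint D"
  have int: "integrable (lebI D) (\<lambda>x. (cmod (u x - m))\<^sup>2)"
    by (intro L2I_sq_integrable L2I_diff L2I_const assms)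
  have iu: "integrable (lebI D) (\<lambda>x. (u x - m) * cnj (m - c))"
    by (intro integrable_mult_left L2I_integrable L2I_diff L2I_const assms)
  have z: "?I (\<lambda>x. (u x - m) * cnj (m - c)) = 0"
  proof -
    have "?I (\<lambda>x. u x - m) = 0"
      using L2I_integrable[OF assms(2)] L2I_integrable[OF L2I_const[of m D]] measure_lebI[of D] assms(1)
      by (simp add: m_def scaleR_conv_of_real)
    then show ?thesis by simp
  qed
  have "(nrm D (\<lambda>x. u x - c))\<^sup>2 = ?I (\<lambda>x. (cmod (u x - m))\<^sup>2 + (cmod (m - c))\<^sup>2
      + 2 * Re ((u x - m) * cnj (m - c)))"
    unfolding nrm_sq
  proof (rule arg_cong[where f="?I"], rule ext)
    fix x
    have "u x - c = (u x - m) + (m - c)" by simp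
    then show "(cmod (u x - c))\<^sup>2 = (cmod (u x - m))\<^sup>2 + (cmod (m - c))\<^sup>2 + 2 * Re ((u x - m) * cnj (m - c))"
      by (simp only: cmod_power2) (simp add: power2_eq_square algebra_simps)
  qed
  also have "\<dots> = ?I (\<lambda>x. (cmod (u x - m))\<^sup>2) + D * (cmod (m - c))\<^sup>2
      + 2 * ?I (\<lambda>x. Re ((u x - m) * cnj (m - c)))"
  proof -
    have ir: "integrable (lebI D) (\<lambda>x. Re ((u x - m) * cnj (m - c)))"
      by (rule integrable_Re[OF iu])
    have ic: "integrable (lebI D) (\<lambda>x. (cmod (m - c))\<^sup>2)"
      by (rule finite_measure.integrable_const[OF finite_measure_lebI])
    show ?thesis
      using measure_lebI[of D] assms(1)
      by (simp only: Bochner_Integration.integral_add[OF Bochner_Integration.integrable_add[OF int ic]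
            integrable_mult_right[OF ir]] Bochner_Integration.integral_add[OF int ic]
            integral_mult_right_zero) simp
  qed
  also have "?I (\<lambda>x. Re ((u x - m) * cnj (m - c))) = Re (?I (\<lambda>x. (u x - m) * cnj (m - c)))"
    using integral_Re[OF iu] by simp
  finally show ?thesis by (simp only: z nrm_sq) simp
qed

section \<open>Energy estimates on the domain of the generator\<close>

text \<open>The weight 1/\<sigma>_i compensates the factor \<sigma>_i in \<open>Astar\<close>, so
  that Green's formula leaves \<kappa> times the Dirichlet integral with no edge
  coefficient.\<close>

definition energy :: "('e::finite) network \<Rightarrow> 'e edgefun \<Rightarrow> real" where
  "energy G u = (\<Sum>i\<in>UNIV. (nrm (len G i) (u i))\<^sup>2 / sig G i)"

definition fluct :: "('e::finite) network \<Rightarrow> 'e edgefun \<Rightarrow> real" where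
  "fluct G u = (\<Sum>i\<in>UNIV. (nrm (len G i) (\<lambda>x. u i x - Pavg G u $ i))\<^sup>2 / sig G i)"

text \<open>The four estimates bound the derivative of the energy, the failure of the means to
  follow Q, the fluctuation, and minus the derivative of the part of the energy carried by the
  means; the first and the last add up to a bound for the derivative of the fluctuation. The witness
  N is the sum of the squared norms of the first derivatives, but along a trajectory only its
  existence at each instant counts.\<close>

definition energy_bounds :: "('e::finite) network \<Rightarrow> real \<Rightarrow> real \<Rightarrow> 'e edgefun \<Rightarrow> bool" where
  "energy_bounds G \<kappa> C v \<longleftrightarrow> (\<exists>N\<ge>0.
     2 * (\<Sum>i\<in>UNIV. Re (ip (len G i) (Astar G \<kappa> v i) (v i)) / sig G i)
       \<le> - 2 * \<kappa> * N + C * (energy G v + N) \<and>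
     (\<Sum>i\<in>UNIV. (cmod ((Pavg G (Astar G \<kappa> v) - Qop G (Pavg G v)) $ i))\<^sup>2) \<le> C * N \<and>
     fluct G v \<le> C * N \<and>
     - (2 * (\<Sum>i\<in>UNIV. len G i / sig G i * Re (Pavg G (Astar G \<kappa> v) $ i * cnj (Pavg G v $ i))))
       \<le> C * (energy G v + N))"

text \<open>One number dominating all data and the reciprocals that occur, at least 1 so that its
  powers may be enlarged; every later constant is a polynomial in M and the number of edges.\<close>

definition netbound :: "('e::finite) network \<Rightarrow> real \<Rightarrow> bool" where
  "netbound G M \<longleftrightarrow> M \<ge> 1 \<and> (\<forall>i. sig G i \<le> M \<and> 1 / sig G i \<le> M \<and> sqrt (len G i) \<le> M
     \<and> len G i \<le> M \<and> 1 / sqrt (len G i) \<le> M \<and> 1 / len G i \<le> M \<and> lperm G i \<le> M \<and> rperm G i \<le> M)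
     \<and> (\<forall>i j. \<bar>lout G i j\<bar> \<le> M \<and> \<bar>rout G i j\<bar> \<le> M)"

lemma finite_bounds:
  fixes hs :: "('a::finite \<Rightarrow> real) list"
  shows "\<exists>M\<ge>1. \<forall>h\<in>set hs. \<forall>i. h i \<le> M"
proof (induction hs)
  case Nil
  show ?case by (rule exI[of _ 1]) simp
next
  case (Cons h hs)
  then obtain M where M: "M \<ge> 1" "\<forall>h\<in>set hs. \<forall>i. h i \<le> M" by blast
  have "h i \<le> Max (range h)" for i by (rule Max_ge) auto
  then show ?case using M by (intro exI[of _ "max M (Max (range h))"]) (auto simp: le_max_iff_disj)
qed

lemma netbound_exists:
  fixes G :: "('e::finite) network"
  shows "\<exists>M. netbound G M"
proof -
  \<comment> \<open>Indexing by pairs of edges brings quantities with one and with two indices under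
    the same maximum.\<close>
  obtain M where "M \<ge> 1" "\<forall>h\<in>set [\<lambda>(i,j). sig G i, \<lambda>(i,j). 1 / sig G i, \<lambda>(i,j). sqrt (len G i),
    \<lambda>(i,j). len G i, \<lambda>(i,j). 1 / sqrt (len G i), \<lambda>(i,j). 1 / len G i, \<lambda>(i,j). lperm G i,
    \<lambda>(i,j). rperm G i, \<lambda>(i,j). \<bar>lout G i j\<bar>, \<lambda>(i,j). \<bar>rout G i j\<bar>]. \<forall>ij. h ij \<le> M"
    using finite_bounds by blast
  then have "netbound G M"
    unfolding netbound_def by (simp add: split_paired_All)
  then show ?thesis by blast
qed

text \<open>Meant for a and b the two ends of the i-th edge, which are distinct: an endpoint of
  another edge lies at one of them, at the other, or at neither, and in the last case the
  coefficient h vanishes.\<close>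

lemma sum_two_cases:
  fixes h :: "'e::finite \<Rightarrow> complex"
  assumes "a \<noteq> b" and "\<And>j. j \<noteq> i \<Longrightarrow> e j \<noteq> a \<Longrightarrow> e j \<noteq> b \<Longrightarrow> h j = 0"
  shows "(\<Sum>j | j \<noteq> i \<and> e j = a. h j) + (\<Sum>j | j \<noteq> i \<and> e j = b. h j) = (\<Sum>j\<in>UNIV - {i}. h j)"
proof -
  have "(\<Sum>j | j \<noteq> i \<and> e j = a. h j) + (\<Sum>j | j \<noteq> i \<and> e j = b. h j)
      = (\<Sum>j\<in>{j. j \<noteq> i \<and> e j = a} \<union> {j. j \<noteq> i \<and> e j = b}. h j)"
    by (rule sum.union_disjoint[symmetric]) (use assms(1) in auto)
  also have "\<dots> = (\<Sum>j\<in>UNIV - {i}. h j)"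
    by (rule sum.mono_neutral_left) (use assms(2) in auto)
  finally show ?thesis .
qed

context
  fixes G :: "('e::finite) network"
  assumes net: "is_network G"
begin

lemma net_sig: "sig G i > 0" and net_len: "len G i > 0"
  and net_perm: "lperm G i \<ge> 0" "rperm G i \<ge> 0"
  and net_ends: "L_end G i \<noteq> R_end G i"
  and net_out0: "j \<noteq> i \<Longrightarrow> L_end G j \<noteq> L_end G i \<Longrightarrow> L_end G j \<noteq> R_end G i \<Longrightarrow> lout G j i = 0"
    "j \<noteq> i \<Longrightarrow> R_end G j \<noteq> L_end G i \<Longrightarrow> R_end G j \<noteq> R_end G i \<Longrightarrow> rout G j i = 0"
  using net unfolding is_network_def incident_def by auto

text \<open>For \<open>v\<close> in the domain, the mean of \<open>A v\<close> over the \<open>i\<close>-th edge in terms of the boundary values of \<open>v\<close>.\<close>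

definition netflux :: "'e \<Rightarrow> ('e \<Rightarrow> complex) \<Rightarrow> ('e \<Rightarrow> complex) \<Rightarrow> complex" where
  "netflux i \<alpha> \<beta> = (\<Sum>j\<in>UNIV - {i}. of_real (sig G j * lout G j i / len G i) * \<alpha> j
      + of_real (sig G j * rout G j i / len G i) * \<beta> j)
     - of_real (sig G i * lperm G i / len G i) * \<alpha> i - of_real (sig G i * rperm G i / len G i) * \<beta> i"

text \<open>The functionals at the two ends of an edge enter the mean of \<open>Astar\<close> with
  opposite signs, as do the incoming terms inside them. All incoming terms thus add up, and by
  \<open>sum_two_cases\<close> the incidence conditions under the sums disappear.\<close>

lemma F_diff_netflux:
  "of_real (sig G i / len G i) * (F_R G i u - F_L G i u) = netflux i (at_L G u) (at_R G u)"
proof -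
  let ?l = "\<lambda>j. of_real (sig G j * lout G j i) * at_L G u j"
  let ?r = "\<lambda>j. of_real (sig G j * rout G j i) * at_R G u j"
  have l: "(\<Sum>j | j \<noteq> i \<and> L_end G j = L_end G i. ?l j) + (\<Sum>j | j \<noteq> i \<and> L_end G j = R_end G i. ?l j)
      = (\<Sum>j\<in>UNIV - {i}. ?l j)"
    by (rule sum_two_cases) (use net_ends net_out0(1)[of _ i] in auto)
  have r: "(\<Sum>j | j \<noteq> i \<and> R_end G j = L_end G i. ?r j) + (\<Sum>j | j \<noteq> i \<and> R_end G j = R_end G i. ?r j)
      = (\<Sum>j\<in>UNIV - {i}. ?r j)"
    by (rule sum_two_cases) (use net_ends net_out0(2)[of _ i] in auto)
  have s: "complex_of_real (sig G i) \<noteq> 0" using net_sig[of i] by simp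
  have *: "s * ((b + d - y) / s - (x - a - c) / s) = a + b + (c + d) - x - y"
    if "s \<noteq> 0" for s a b c d x y :: complex
    using that by (simp add: field_simps)
  have "of_real (sig G i) * (F_R G i u - F_L G i u)
     = (\<Sum>j\<in>UNIV - {i}. ?l j) + (\<Sum>j\<in>UNIV - {i}. ?r j)
       - of_real (sig G i * lperm G i) * at_L G u i - of_real (sig G i * rperm G i) * at_R G u i"
    unfolding F_R_def F_L_def l[symmetric] r[symmetric] by (rule *[OF s])
  then have "of_real (sig G i / len G i) * (F_R G i u - F_L G i u)
     = ((\<Sum>j\<in>UNIV - {i}. ?l j) + (\<Sum>j\<in>UNIV - {i}. ?r j)
       - of_real (sig G i * lperm G i) * at_L G u i - of_real (sig G i * rperm G i) * at_R G u i)
       / of_real (len G i)"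
    by simp
  then show ?thesis
    by (simp add: netflux_def sum.distrib sum_divide_distrib add_divide_distrib diff_divide_distrib)
qed

text \<open>The origin of Q: a function that is constant on each edge has the same value at both
  ends, so left and right permeabilities merge into the entries \<open>q\<close>.\<close>

lemma netflux_const: "netflux i (\<lambda>j. c $ j) (\<lambda>j. c $ j) = Qop G c $ i"
proof -
  have "(\<Sum>j\<in>UNIV - {i}. of_real (q G i j) * c $ j) = (\<Sum>j\<in>UNIV - {i}.
      of_real (sig G j * lout G j i / len G i) * c $ j + of_real (sig G j * rout G j i / len G i) * c $ j)"
    by (intro sum.cong refl) (auto simp: q_def algebra_simps add_divide_distrib)
  then show ?thesis
    by (simp add: netflux_def Qop_def) (simp add: q_def algebra_simps add_divide_distrib)
qed

lemma netflux_diff: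
  "netflux i \<alpha> \<beta> - netflux i \<alpha>' \<beta>' = netflux i (\<lambda>j. \<alpha> j - \<alpha>' j) (\<lambda>j. \<beta> j - \<beta>' j)"
proof -
  have "(\<Sum>j\<in>S. a j * \<alpha> j + b j * \<beta> j) - c * \<alpha> i - d * \<beta> i - ((\<Sum>j\<in>S. a j * \<alpha>' j + b j * \<beta>' j) - c * \<alpha>' i - d * \<beta>' i)
      = (\<Sum>j\<in>S. a j * (\<alpha> j - \<alpha>' j) + b j * (\<beta> j - \<beta>' j)) - c * (\<alpha> i - \<alpha>' i) - d * (\<beta> i - \<beta>' i)"
    for a b :: "'e \<Rightarrow> complex" and c d S
    by (simp add: algebra_simps sum.distrib sum_subtractf)
  then show ?thesis unfolding netflux_def .
qed

lemma netflux_bound: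
  assumes M: "netbound G M"
  shows "cmod (netflux i \<alpha> \<beta>) \<le> 2 * M ^ 3 * (\<Sum>j\<in>UNIV. cmod (\<alpha> j) + cmod (\<beta> j))"
proof -
  have M1: "M \<ge> 1" and Mb: "\<And>i. sig G i \<le> M" "\<And>i. 1 / len G i \<le> M" "\<And>i. lperm G i \<le> M"
      "\<And>i. rperm G i \<le> M" "\<And>i j. \<bar>lout G i j\<bar> \<le> M" "\<And>i j. \<bar>rout G i j\<bar> \<le> M"
    using M unfolding netbound_def by auto
  have c: "\<bar>sig G j * x / len G i\<bar> \<le> M ^ 3" if "\<bar>x\<bar> \<le> M" for j x
  proof -
    have "\<bar>sig G j * x / len G i\<bar> = sig G j * \<bar>x\<bar> * (1 / len G i)"
      using net_sig[of j] net_len[of i] by (simp add: abs_mult)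
    also have "\<dots> \<le> M * M * M"
      using that Mb M1 net_sig[of j] net_len[of i]
      by (intro mult_mono) (auto intro: less_imp_le)
    finally show ?thesis by (simp add: power3_eq_cube)
  qed
  have c': "cmod (of_real (sig G j * x / len G i) * y) \<le> M ^ 3 * cmod y" if "\<bar>x\<bar> \<le> M" for j x y
    unfolding norm_mult norm_of_real by (rule mult_right_mono[OF c[OF that]]) simp
  have tri: "cmod (x - y - z) \<le> cmod x + cmod y + cmod z" for x y z :: complex
    using norm_triangle_ineq4[of "x - y" z] norm_triangle_ineq4[of x y] by linarith
  let ?S = "\<Sum>j\<in>UNIV. cmod (\<alpha> j) + cmod (\<beta> j)"
  have "cmod (netflux i \<alpha> \<beta>) \<le> cmod (\<Sum>j\<in>UNIV - {i}. of_real (sig G j * lout G j i / len G i) * \<alpha> j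
      + of_real (sig G j * rout G j i / len G i) * \<beta> j)
     + cmod (of_real (sig G i * lperm G i / len G i) * \<alpha> i)
     + cmod (of_real (sig G i * rperm G i / len G i) * \<beta> i)"
    unfolding netflux_def by (rule tri)
  also have "\<dots> \<le> (\<Sum>j\<in>UNIV - {i}. M ^ 3 * (cmod (\<alpha> j) + cmod (\<beta> j)))
      + M ^ 3 * cmod (\<alpha> i) + M ^ 3 * cmod (\<beta> i)"
  proof (intro add_mono)
    show "cmod (\<Sum>j\<in>UNIV - {i}. of_real (sig G j * lout G j i / len G i) * \<alpha> j
      + of_real (sig G j * rout G j i / len G i) * \<beta> j) \<le> (\<Sum>j\<in>UNIV - {i}. M ^ 3 * (cmod (\<alpha> j) + cmod (\<beta> j)))"
      unfolding distrib_left
      by (intro sum_norm_le order_trans[OF norm_triangle_ineq] add_mono c' Mb)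
  qed (intro c'; use Mb net_perm in auto)+
  also have "\<dots> = M ^ 3 * ?S"
    using sum.remove[OF finite_class.finite_UNIV UNIV_I, of "\<lambda>j. cmod (\<alpha> j) + cmod (\<beta> j)" i]
    by (simp add: distrib_left sum_distrib_left sum.distrib)
  \<comment> \<open>The factor 2 is slack and gives the bound the same shape as
    \<open>F_bound\<close>.\<close>
  also have "\<dots> \<le> 2 * M ^ 3 * ?S"
    using M1 by (intro mult_right_mono) (auto intro: sum_nonneg)
  finally show ?thesis .
qed

text \<open>Each product of some \<sigma>_j and a permeability is at most \<open>M\<^sup>2\<close>,
  and the division by \<sigma>_i contributes one more M. The factor 2 arises because the values at
  one kind of endpoint occur twice, in the edge's own term and in a sum.\<close>

lemma F_bound:
  assumes M: "netbound G M"
  shows "cmod (F_L G i u) \<le> 2 * M ^ 3 * (\<Sum>j\<in>UNIV. cmod (at_L G u j) + cmod (at_R G u j))"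
    and "cmod (F_R G i u) \<le> 2 * M ^ 3 * (\<Sum>j\<in>UNIV. cmod (at_L G u j) + cmod (at_R G u j))"
proof -
  have M1: "M \<ge> 1" and Mb: "\<And>i. sig G i \<le> M" "\<And>i. 1 / sig G i \<le> M" "\<And>i. lperm G i \<le> M"
      "\<And>i. rperm G i \<le> M" "\<And>i j. \<bar>lout G i j\<bar> \<le> M" "\<And>i j. \<bar>rout G i j\<bar> \<le> M"
    using M unfolding netbound_def by auto
  have c: "cmod (of_real (sig G j * x) * y) \<le> M\<^sup>2 * cmod y" if "\<bar>x\<bar> \<le> M" for j x y
  proof -
    have "\<bar>sig G j * x\<bar> \<le> M * M"
      unfolding abs_mult using that Mb(1)[of j] M1 net_sig[of j] by (intro mult_mono) auto
    then show ?thesis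
      unfolding norm_mult norm_of_real power2_eq_square by (rule mult_right_mono) simp
  qed
  let ?a = "\<Sum>j\<in>UNIV. cmod (at_L G u j)" and ?b = "\<Sum>j\<in>UNIV. cmod (at_R G u j)"
  let ?S = "\<Sum>j\<in>UNIV. cmod (at_L G u j) + cmod (at_R G u j)"
  have s: "cmod (\<Sum>j\<in>A. of_real (sig G j * x j) * y j) \<le> M\<^sup>2 * (\<Sum>j\<in>UNIV. cmod (y j))"
    if "\<And>j. \<bar>x j\<bar> \<le> M" for A x and y :: "'e \<Rightarrow> complex"
  proof -
    have "cmod (\<Sum>j\<in>A. of_real (sig G j * x j) * y j) \<le> (\<Sum>j\<in>A. M\<^sup>2 * cmod (y j))"
      by (intro sum_norm_le c that)
    also have "\<dots> \<le> (\<Sum>j\<in>UNIV. M\<^sup>2 * cmod (y j))"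
      by (intro sum_mono2) auto
    finally show ?thesis by (simp add: sum_distrib_left)
  qed
  have ai: "cmod (at_L G u i) \<le> ?a" "cmod (at_R G u i) \<le> ?b"
    by (intro member_le_sum; simp)+
  have ab: "?S = ?a + ?b" "?a \<ge> 0" "?b \<ge> 0" by (auto simp: sum.distrib intro: sum_nonneg)
  have fin: "cmod (x / of_real (sig G i)) \<le> 2 * M ^ 3 * ?S"
    if "cmod x \<le> 2 * M\<^sup>2 * ?S" for x
  proof -
    have "cmod (x / of_real (sig G i)) = cmod x * (1 / sig G i)"
      using net_sig[of i] by (simp add: norm_divide)
    also have "\<dots> \<le> (2 * M\<^sup>2 * ?S) * M"
      using that Mb(2)[of i] net_sig[of i] ab by (intro mult_mono) auto
    finally show ?thesis by (simp add: power3_eq_cube power2_eq_square mult_ac)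
  qed
  have lp: "\<bar>lperm G i\<bar> \<le> M" "\<bar>rperm G i\<bar> \<le> M" using Mb net_perm by auto
  have M2: "M\<^sup>2 \<ge> 0" by simp
  show "cmod (F_L G i u) \<le> 2 * M ^ 3 * ?S"
    unfolding F_L_def
  proof (rule fin)
    let ?x = "of_real (sig G i * lperm G i) * at_L G u i"
    let ?y = "\<Sum>j | j \<noteq> i \<and> L_end G j = L_end G i. of_real (sig G j * lout G j i) * at_L G u j"
    let ?z = "\<Sum>j | j \<noteq> i \<and> R_end G j = L_end G i. of_real (sig G j * rout G j i) * at_R G u j"
    have "cmod (?x - ?y - ?z) \<le> cmod ?x + cmod ?y + cmod ?z"
      using norm_triangle_ineq4[of "?x - ?y" ?z] norm_triangle_ineq4[of ?x ?y] by linarith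
    also have "\<dots> \<le> M\<^sup>2 * cmod (at_L G u i) + M\<^sup>2 * ?a + M\<^sup>2 * ?b"
      by (intro add_mono c s lp Mb)
    also have "\<dots> \<le> M\<^sup>2 * ?a + M\<^sup>2 * ?a + M\<^sup>2 * ?b"
      by (intro add_right_mono mult_left_mono ai M2)
    also have "\<dots> \<le> 2 * M\<^sup>2 * ?S"
      using mult_nonneg_nonneg[OF M2 ab(3)] unfolding ab(1) by (simp add: algebra_simps)
    finally show "cmod (?x - ?y - ?z) \<le> 2 * M\<^sup>2 * ?S" .
  qed
  show "cmod (F_R G i u) \<le> 2 * M ^ 3 * ?S"
    unfolding F_R_def
  proof (rule fin)
    let ?x = "of_real (sig G i * rperm G i) * at_R G u i"
    let ?y = "\<Sum>j | j \<noteq> i \<and> L_end G j = R_end G i. of_real (sig G j * lout G j i) * at_L G u j"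
    let ?z = "\<Sum>j | j \<noteq> i \<and> R_end G j = R_end G i. of_real (sig G j * rout G j i) * at_R G u j"
    have "cmod (?y + ?z - ?x) \<le> cmod ?y + cmod ?z + cmod ?x"
      using norm_triangle_ineq4[of "?y + ?z" ?x] norm_triangle_ineq[of ?y ?z] by linarith
    also have "\<dots> \<le> M\<^sup>2 * ?a + M\<^sup>2 * ?b + M\<^sup>2 * cmod (at_R G u i)"
      by (intro add_mono c s lp Mb)
    also have "\<dots> \<le> M\<^sup>2 * ?a + M\<^sup>2 * ?b + M\<^sup>2 * ?b"
      by (intro add_left_mono mult_left_mono ai M2)
    also have "\<dots> \<le> 2 * M\<^sup>2 * ?S"
      using mult_nonneg_nonneg[OF M2 ab(2)] unfolding ab(1) by (simp add: algebra_simps)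
    finally show "cmod (?y + ?z - ?x) \<le> 2 * M\<^sup>2 * ?S" .
  qed
qed

text \<open>Trades the weak formulation of the domain for functions f, p, z with honest boundary
  values. The boundary conditions become equations for \<open>\<kappa> * p\<close> at the ends, the
  only form in which they are used.\<close>

lemma dom_rep:
  assumes "v \<in> dom_Astar G \<kappa>"
  shows "\<exists>f p z. (\<forall>i. H2_rep (len G i) (v i) (f i) (p i) (z i))
    \<and> at_L G v = (\<lambda>i. f i 0) \<and> at_R G v = (\<lambda>i. f i (len G i))
    \<and> (\<forall>i. of_real \<kappa> * p i 0 = F_L G i v \<and> of_real \<kappa> * p i (len G i) = F_R G i v)
    \<and> (\<forall>i. Astar G \<kappa> v i \<in> L2I (len G i)
       \<and> (AE x in lebI (len G i). Astar G \<kappa> v i x = of_real (\<kappa> * sig G i) * z i x))"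
proof -
  obtain p0 z where 0: "v \<in> L2S (len G)" "p0 \<in> L2S (len G)" "z \<in> L2S (len G)"
      "\<And>i. has_weak_deriv (len G i) (v i) (p0 i)" "\<And>i. has_weak_deriv (len G i) (p0 i) (z i)"
    and bc: "\<And>i. of_real \<kappa> * at_L G (Diff G v) i = F_L G i v"
       "\<And>i. of_real \<kappa> * at_R G (Diff G v) i = F_R G i v"
    using assms unfolding dom_Astar_def H2S_def by blast
  have "\<forall>i. \<exists>f p. H2_rep (len G i) (v i) f p (z i)"
    using 0(1-3) by (intro allI H2_rep_exists[OF net_len _ _ _ 0(4) 0(5)]) (auto simp: L2S_def)
  then obtain f p where rep: "\<And>i. H2_rep (len G i) (v i) (f i) (p i) (z i)" by metis
  have e: "0 \<in> {0..len G i}" "len G i \<in> {0..len G i}" for i using net_len[of i] by auto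
  note cv = H2_rep_cval[OF net_len rep]
  note wd = H2_rep_wderiv[OF net_len rep]
  have "Astar G \<kappa> v i \<in> L2I (len G i)" for i
    using L2I_cmult[OF wd(3)[of i], of "of_real (\<kappa> * sig G i)"] by (simp add: Astar_def Diff_def)
  moreover have "AE x in lebI (len G i). Astar G \<kappa> v i x = of_real (\<kappa> * sig G i) * z i x" for i
    using wd(4)[of i] by eventually_elim (simp add: Astar_def Diff_def)
  moreover have "at_L G v = (\<lambda>i. f i 0)" "at_R G v = (\<lambda>i. f i (len G i))"
    using cv(1) e by (auto simp: at_L_def at_R_def)
  moreover have "of_real \<kappa> * p i 0 = F_L G i v" "of_real \<kappa> * p i (len G i) = F_R G i v" for i
    using bc[of i] cv(2)[of 0 i] cv(2)[of "len G i" i] e[of i] by (auto simp: at_L_def at_R_def Diff_def)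
  ultimately show ?thesis using rep by blast
qed

text \<open>A boundary value is a mean plus a deviation. The mean is controlled by the norm of v,
  the deviation by the norm of its derivative, so boundary values squared cost \<open>E + N\<close>,
  while differences between boundary values and means cost N alone. Every occurrence of \<kappa> at
  a boundary is removed by the boundary conditions.\<close>

lemma static_estimates:
  "\<exists>C\<ge>1. \<forall>\<kappa>>0. \<forall>v\<in>dom_Astar G \<kappa>. energy_bounds G \<kappa> C v"
proof -
  obtain M where M: "netbound G M" using netbound_exists by blast
  have M1: "M \<ge> 1" and Mb: "\<And>i. sig G i \<le> M" "\<And>i. 1 / sig G i \<le> M" "\<And>i. sqrt (len G i) \<le> M"
    "\<And>i. len G i \<le> M" "\<And>i. 1 / sqrt (len G i) \<le> M"
    using M unfolding netbound_def by auto
  define n where "n = real CARD('e)"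
  have n1: "n \<ge> 1" unfolding n_def using zero_less_card_finite[where 'a='e] by linarith
  \<comment> \<open>One constant for each of the four estimates in \<open>energy_bounds\<close>, in
    the same order; each is read off at the end of the corresponding chain of inequalities
    below.\<close>
  define C1 where "C1 = 128 * n * M ^ 6"
  define C2 where "C2 = 64 * n\<^sup>2 * M ^ 8"
  define C3 where "C3 = 4 * M ^ 3"
  define C4 where "C4 = 4 * M ^ 6 * (n * M + 32 * n * M ^ 3)"
  define C where "C = 1 + C1 + C2 + C3 + C4"
  have C0: "C1 \<ge> 0" "C2 \<ge> 0" "C3 \<ge> 0" "C4 \<ge> 0" using n1 M1 by (auto simp: C1_def C2_def C3_def C4_def)
  then have Cge: "C \<ge> 1" "C1 \<le> C" "C2 \<le> C" "C3 \<le> C" "C4 \<le> C" by (auto simp: C_def)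
  show ?thesis
  proof (rule exI[of _ C], intro conjI allI impI ballI)
    show "C \<ge> 1" by (rule Cge)
    fix \<kappa> :: real and v assume k: "\<kappa> > 0" and v: "v \<in> dom_Astar G \<kappa>"
    obtain f p z where rep: "\<And>i. H2_rep (len G i) (v i) (f i) (p i) (z i)"
      and at: "at_L G v = (\<lambda>i. f i 0)" "at_R G v = (\<lambda>i. f i (len G i))"
      and bc: "\<And>i. of_real \<kappa> * p i 0 = F_L G i v" "\<And>i. of_real \<kappa> * p i (len G i) = F_R G i v"
      and A: "\<And>i. Astar G \<kappa> v i \<in> L2I (len G i)"
        "\<And>i. AE x in lebI (len G i). Astar G \<kappa> v i x = of_real (\<kappa> * sig G i) * z i x"
      using dom_rep[OF v] by blast
    have e: "0 \<in> {0..len G i}" "len G i \<in> {0..len G i}" for i using net_len[of i] by auto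
    define m where "m i = Pavg G v $ i" for i
    define \<alpha> where "\<alpha> i = f i 0" for i
    define \<beta> where "\<beta> i = f i (len G i)" for i
    have mdef: "m i = lint (len G i) (v i) / of_real (len G i)" for i
      by (simp add: m_def Pavg_def)
    have vL: "v i \<in> L2I (len G i)" and zL: "z i \<in> L2I (len G i)" and fL: "f i \<in> L2I (len G i)" for i
      using H2_rep_u[OF net_len rep] H2_rep_z[OF net_len rep] H2_rep_L2I(2)[OF net_len rep] by auto
    define N where "N = (\<Sum>i\<in>UNIV. (nrm (len G i) (p i))\<^sup>2)"
    define Y where "Y = (\<Sum>i\<in>UNIV. nrm (len G i) (p i))"
    define U where "U = (\<Sum>i\<in>UNIV. nrm (len G i) (v i))"
    define X where "X = (\<Sum>i\<in>UNIV. cmod (\<alpha> i) + cmod (\<beta> i))"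
    define E where "E = energy G v"
    have nn: "N \<ge> 0" "Y \<ge> 0" "U \<ge> 0" "X \<ge> 0" "E \<ge> 0"
      unfolding N_def Y_def U_def X_def E_def energy_def
      using net_sig by (auto intro!: sum_nonneg divide_nonneg_pos)
    have Y2: "Y\<^sup>2 \<le> n * N"
      using sum_squared_le_sum_of_squares[of "\<lambda>i. nrm (len G i) (p i)" UNIV]
      unfolding Y_def N_def n_def by (simp add: mult.commute)
    have U2: "U\<^sup>2 \<le> n * M * E"
    proof -
      have "U\<^sup>2 \<le> n * (\<Sum>i\<in>UNIV. (nrm (len G i) (v i))\<^sup>2)"
        using sum_squared_le_sum_of_squares[of "\<lambda>i. nrm (len G i) (v i)" UNIV]
        unfolding U_def n_def by (simp add: mult.commute)
      also have "(\<Sum>i\<in>UNIV. (nrm (len G i) (v i))\<^sup>2) \<le> (\<Sum>i\<in>UNIV. M * ((nrm (len G i) (v i))\<^sup>2 / sig G i))"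
      proof (rule sum_mono)
        fix i
        have "(nrm (len G i) (v i))\<^sup>2 = sig G i * ((nrm (len G i) (v i))\<^sup>2 / sig G i)"
          using net_sig[of i] by simp
        also have "\<dots> \<le> M * ((nrm (len G i) (v i))\<^sup>2 / sig G i)"
          using net_sig[of i] Mb(1)[of i] by (intro mult_right_mono) auto
        finally show "(nrm (len G i) (v i))\<^sup>2 \<le> M * ((nrm (len G i) (v i))\<^sup>2 / sig G i)" .
      qed
      finally show ?thesis using n1
        by (simp only: E_def energy_def sum_distrib_left[symmetric] mult.assoc mult_left_mono)
    qed
    have osc: "cmod (\<alpha> i - m i) \<le> 2 * M * nrm (len G i) (p i)" "cmod (\<beta> i - m i) \<le> 2 * M * nrm (len G i) (p i)" for i
    proof -
      have "2 * sqrt (len G i) * nrm (len G i) (p i) \<le> 2 * M * nrm (len G i) (p i)"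
        using Mb(3)[of i] by (intro mult_right_mono) auto
      then show "cmod (\<alpha> i - m i) \<le> 2 * M * nrm (len G i) (p i)" "cmod (\<beta> i - m i) \<le> 2 * M * nrm (len G i) (p i)"
        using H2_rep_mean_osc[OF net_len rep e(1)] H2_rep_mean_osc[OF net_len rep e(2)]
        unfolding \<alpha>_def \<beta>_def mdef by (meson order_trans)+
    qed
    have mb: "cmod (m i) \<le> M * nrm (len G i) (v i)" for i
    proof -
      have "cmod (m i) \<le> nrm (len G i) (v i) * (1 / sqrt (len G i))"
        using mean_bound[OF net_len vL] by (simp add: mdef)
      also have "\<dots> \<le> nrm (len G i) (v i) * M" by (intro mult_left_mono Mb) simp
      finally show ?thesis by (simp add: mult.commute)
    qed
    have oscX: "(\<Sum>i\<in>UNIV. cmod (\<alpha> i - m i) + cmod (\<beta> i - m i)) \<le> 4 * M * Y"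
    proof -
      have "(\<Sum>i\<in>UNIV. cmod (\<alpha> i - m i) + cmod (\<beta> i - m i)) \<le> (\<Sum>i\<in>UNIV. 4 * M * nrm (len G i) (p i))"
        using osc by (intro sum_mono) (smt (verit, best) distrib_right)
      then show ?thesis by (simp add: Y_def sum_distrib_left)
    qed
    have Xb: "X \<le> 4 * M * (U + Y)"
    proof -
      have "cmod (\<alpha> i) + cmod (\<beta> i) \<le> 2 * M * nrm (len G i) (v i) + 4 * M * nrm (len G i) (p i)" for i
      proof -
        have "cmod (\<alpha> i) \<le> cmod (m i) + cmod (\<alpha> i - m i)" "cmod (\<beta> i) \<le> cmod (m i) + cmod (\<beta> i - m i)"
          by (metis add.commute diff_add_cancel norm_triangle_ineq)+
        then show ?thesis using osc[of i] mb[of i] by linarith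
      qed
      then have "X \<le> (\<Sum>i\<in>UNIV. 2 * M * nrm (len G i) (v i) + 4 * M * nrm (len G i) (p i))"
        unfolding X_def by (rule sum_mono)
      also have "\<dots> = 2 * M * U + 4 * M * Y"
        by (simp add: sum.distrib U_def Y_def sum_distrib_left)
      also have "\<dots> \<le> 4 * M * (U + Y)" using M1 nn by (simp add: algebra_simps)
      finally show ?thesis .
    qed
    have X2: "X\<^sup>2 \<le> 32 * n * M ^ 3 * (E + N)"
    proof -
      have "X\<^sup>2 \<le> (4 * M * (U + Y))\<^sup>2" using Xb nn by (intro power_mono) auto
      also have "\<dots> = 16 * M\<^sup>2 * (U + Y)\<^sup>2" by (simp add: power_mult_distrib)
      also have "\<dots> \<le> 16 * M\<^sup>2 * (2 * (n * M * E + n * M * N))"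
      proof (rule mult_left_mono)
        have "n * N \<le> n * M * N" using n1 M1 nn by (intro mult_right_mono) auto
        have "(U + Y)\<^sup>2 \<le> 2 * (U\<^sup>2 + Y\<^sup>2)"
          using sum_squares_bound[of U Y] by (simp add: power2_sum)
        moreover have "2 * (U\<^sup>2 + Y\<^sup>2) \<le> 2 * (n * M * E + n * M * N)"
          by (intro mult_left_mono add_mono U2 order_trans[OF Y2] \<open>n * N \<le> n * M * N\<close>) simp
        ultimately show "(U + Y)\<^sup>2 \<le> 2 * (n * M * E + n * M * N)" by (rule order_trans)
      qed simp
      also have "\<dots> = 32 * n * M ^ 3 * (E + N)"
        by (simp add: algebra_simps power2_eq_square power3_eq_cube)
      finally show ?thesis .
    qed
    \<comment> \<open>The integral of z is the difference of the endpoint derivatives, and \<kappa>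
      times these are the functionals \<open>F_R\<close> and \<open>F_L\<close>: the mean of
      \<open>Astar\<close> does not contain \<kappa>.\<close>
    have PA: "Pavg G (Astar G \<kappa> v) $ i = netflux i \<alpha> \<beta>" for i
    proof -
      have "lint (len G i) (Astar G \<kappa> v i)
          = lint (len G i) (\<lambda>x. of_real (\<kappa> * sig G i) * z i x)"
        by (rule integral_cong_AE[OF _ _ A(2)]) (intro L2I_meas A(1) L2I_cmult zL)+
      also have "\<dots> = of_real (\<kappa> * sig G i) * prim (z i) (len G i)"
        by (simp add: prim_def)
      also have "\<dots> = of_real (sig G i) * (F_R G i v - F_L G i v)"
        unfolding prim_z_end[OF net_len rep] bc[symmetric] by (simp add: algebra_simps)
      finally have "Pavg G (Astar G \<kappa> v) $ i = of_real (sig G i / len G i) * (F_R G i v - F_L G i v)"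
        by (simp add: Pavg_def)
      then show ?thesis unfolding F_diff_netflux at \<alpha>_def[abs_def] \<beta>_def[abs_def] .
    qed
    have PAb: "cmod (Pavg G (Astar G \<kappa> v) $ i) \<le> 2 * M ^ 3 * X" for i
      unfolding PA X_def by (rule netflux_bound[OF M])
    have EN: "E + N \<ge> 0" using nn by simp
    let ?D = "\<Sum>i\<in>UNIV. Re (ip (len G i) (Astar G \<kappa> v i) (v i)) / sig G i"
    let ?S = "\<Sum>i\<in>UNIV. len G i / sig G i * Re (Pavg G (Astar G \<kappa> v) $ i * cnj (Pavg G v $ i))"
    let ?Q = "\<Sum>i\<in>UNIV. (cmod ((Pavg G (Astar G \<kappa> v) - Qop G (Pavg G v)) $ i))\<^sup>2"
    show "energy_bounds G \<kappa> C v"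
      unfolding energy_bounds_def
    proof (intro exI[of _ N] conjI)
      show "N \<ge> 0" by (rule nn)
      \<comment> \<open>Green's formula: division by \<sigma>_i cancels the coefficient, the
        boundary conditions turn the endpoint derivatives into \<open>F_R\<close> and
        \<open>F_L\<close>, and only the Dirichlet term retains \<kappa>.\<close>
      have I: "Re (ip (len G i) (Astar G \<kappa> v i) (v i)) / sig G i
          \<le> - \<kappa> * (nrm (len G i) (p i))\<^sup>2 + 2 * M ^ 3 * X * (cmod (\<alpha> i) + cmod (\<beta> i))" for i
      proof -
        have "ip (len G i) (Astar G \<kappa> v i) (v i)
          = lint (len G i) (\<lambda>x. of_real (\<kappa> * sig G i) * (z i x * cnj (f i x)))"
        proof (rule integral_cong_AE)
          show "AE x in lebI (len G i).
              Astar G \<kappa> v i x * cnj (v i x) = of_real (\<kappa> * sig G i) * (z i x * cnj (f i x))"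
            using A(2)[of i] H2_rep_AE[OF net_len rep[of i]] by eventually_elim simp
        qed (intro borel_measurable_times borel_measurable_const L2I_meas[OF L2I_cnj] L2I_meas A vL zL fL)+
        also have "\<dots> = of_real (\<kappa> * sig G i) * (p i (len G i) * cnj (\<beta> i) - p i 0 * cnj (\<alpha> i)
            - of_real ((nrm (len G i) (p i))\<^sup>2))"
          unfolding \<alpha>_def \<beta>_def by (simp add: H2_rep_green[OF net_len rep])
        also have "\<dots> = of_real (sig G i) * (F_R G i v * cnj (\<beta> i) - F_L G i v * cnj (\<alpha> i)
            - of_real (\<kappa> * (nrm (len G i) (p i))\<^sup>2))"
          unfolding bc[symmetric] by (simp add: algebra_simps)
        finally have "Re (ip (len G i) (Astar G \<kappa> v i) (v i)) / sig G i
            = Re (F_R G i v * cnj (\<beta> i) - F_L G i v * cnj (\<alpha> i) - of_real (\<kappa> * (nrm (len G i) (p i))\<^sup>2))"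
          using net_sig[of i] by (simp only: scaleR_conv_of_real[symmetric] scaleR_complex.sel) simp
        also have "\<dots> = Re (F_R G i v * cnj (\<beta> i) - F_L G i v * cnj (\<alpha> i)) - \<kappa> * (nrm (len G i) (p i))\<^sup>2"
          by (simp only: minus_complex.simps Re_complex_of_real)
        also have "Re (F_R G i v * cnj (\<beta> i) - F_L G i v * cnj (\<alpha> i))
            \<le> cmod (F_R G i v * cnj (\<beta> i) - F_L G i v * cnj (\<alpha> i))" by (rule complex_Re_le_cmod)
        also have "\<dots> \<le> cmod (F_R G i v) * cmod (\<beta> i) + cmod (F_L G i v) * cmod (\<alpha> i)"
          using norm_triangle_ineq4[of "F_R G i v * cnj (\<beta> i)" "F_L G i v * cnj (\<alpha> i)"]
          by (simp add: norm_mult)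
        also have "\<dots> \<le> 2 * M ^ 3 * X * cmod (\<beta> i) + 2 * M ^ 3 * X * cmod (\<alpha> i)"
          using F_bound[OF M, of i v] unfolding at \<alpha>_def[symmetric] \<beta>_def[symmetric] X_def[symmetric]
          by (intro add_mono mult_right_mono) auto
        finally show ?thesis by (simp add: algebra_simps)
      qed
      have "?D
          \<le> (\<Sum>i\<in>UNIV. - \<kappa> * (nrm (len G i) (p i))\<^sup>2 + 2 * M ^ 3 * X * (cmod (\<alpha> i) + cmod (\<beta> i)))"
        by (rule sum_mono) (rule I)
      also have "\<dots> = - \<kappa> * N + 2 * M ^ 3 * X * X"
      proof -
        have "(\<Sum>i\<in>UNIV. c * (cmod (\<alpha> i) + cmod (\<beta> i))) = c * X" for c
          unfolding X_def by (rule sum_distrib_left[symmetric])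
        moreover have "(\<Sum>i\<in>UNIV. - \<kappa> * (nrm (len G i) (p i))\<^sup>2) = - \<kappa> * N"
          unfolding N_def by (rule sum_distrib_left[symmetric])
        ultimately show ?thesis by (simp only: sum.distrib[where g="\<lambda>i. - \<kappa> * (nrm (len G i) (p i))\<^sup>2"])
      qed
      finally have "2 * ?D
          \<le> - 2 * \<kappa> * N + 4 * M ^ 3 * X\<^sup>2" by (simp add: power2_eq_square)
      also have "4 * M ^ 3 * X\<^sup>2 \<le> 4 * M ^ 3 * (32 * n * M ^ 3 * (E + N))"
        using X2 M1 by (intro mult_left_mono) auto
      also have "\<dots> = C1 * (E + N)"
        by (simp add: C1_def flip: power_add)
      also have "\<dots> \<le> C * (E + N)" using Cge EN by (intro mult_right_mono) auto
      finally show "2 * ?D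
          \<le> - 2 * \<kappa> * N + C * (energy G v + N)" by (simp add: E_def)
    next
      \<comment> \<open>\<open>netflux\<close> respects differences and equals Q on edgewise
        constant data, so the discrepancy is the \<open>netflux\<close> of boundary values minus
        means. It is small with the derivative and carries no energy term.\<close>
      have "cmod ((Pavg G (Astar G \<kappa> v) - Qop G (Pavg G v)) $ i) \<le> 2 * M ^ 3 * (4 * M * Y)" for i
      proof -
        have "(Pavg G (Astar G \<kappa> v) - Qop G (Pavg G v)) $ i = netflux i (\<lambda>j. \<alpha> j - m j) (\<lambda>j. \<beta> j - m j)"
          by (simp add: PA netflux_const[symmetric] netflux_diff[symmetric] m_def)
        also have "cmod \<dots> \<le> 2 * M ^ 3 * (\<Sum>j\<in>UNIV. cmod (\<alpha> j - m j) + cmod (\<beta> j - m j))"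
          by (rule netflux_bound[OF M])
        also have "\<dots> \<le> 2 * M ^ 3 * (4 * M * Y)"
          using oscX M1 by (intro mult_left_mono) auto
        finally show ?thesis .
      qed
      then have "?Q
          \<le> (\<Sum>i\<in>(UNIV :: 'e set). (2 * M ^ 3 * (4 * M * Y))\<^sup>2)"
        by (intro sum_mono power_mono) auto
      also have "\<dots> = 64 * n * M ^ 8 * Y\<^sup>2"
        by (simp add: n_def power_mult_distrib flip: power_mult)
      also have "\<dots> \<le> 64 * n * M ^ 8 * (n * N)"
        using Y2 n1 M1 by (intro mult_left_mono) auto
      also have "\<dots> = C2 * N" by (simp add: C2_def power2_eq_square)
      also have "\<dots> \<le> C * N" using Cge nn by (intro mult_right_mono) auto
      finally show "?Q \<le> C * N" .
    next
      have "fluct G v \<le> (\<Sum>i\<in>UNIV. 4 * M ^ 3 * (nrm (len G i) (p i))\<^sup>2)"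
        unfolding fluct_def
      proof (rule sum_mono)
        fix i
        have "nrm (len G i) (\<lambda>x. v i x - Pavg G v $ i) \<le> 2 * len G i * nrm (len G i) (p i)"
          using H2_rep_poincare[OF net_len rep] by (simp add: Pavg_def)
        also have "\<dots> \<le> 2 * M * nrm (len G i) (p i)" using Mb(4)[of i] by (intro mult_right_mono) auto
        finally have "(nrm (len G i) (\<lambda>x. v i x - Pavg G v $ i))\<^sup>2 * (1 / sig G i)
            \<le> (2 * M * nrm (len G i) (p i))\<^sup>2 * M"
          using Mb(2)[of i] net_sig[of i] by (intro mult_mono power_mono) auto
        then show "(nrm (len G i) (\<lambda>x. v i x - Pavg G v $ i))\<^sup>2 / sig G i \<le> 4 * M ^ 3 * (nrm (len G i) (p i))\<^sup>2"
          by (simp add: power_mult_distrib power2_eq_square power3_eq_cube mult_ac)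
      qed
      also have "\<dots> = C3 * N" by (simp add: N_def sum_distrib_left C3_def)
      also have "\<dots> \<le> C * N" using Cge nn by (intro mult_right_mono) auto
      finally show "fluct G v \<le> C * N" .
    next
      \<comment> \<open>Here no smallness is available and none is needed: the mean of
        \<open>Astar\<close> is bounded by the boundary values X, the mean of v by its norm, and the
        product X U by the sum of the squares.\<close>
      have I: "- (len G i / sig G i * Re (Pavg G (Astar G \<kappa> v) $ i * cnj (Pavg G v $ i)))
          \<le> 2 * M ^ 6 * X * nrm (len G i) (v i)" for i
      proof -
        have a: "len G i / sig G i \<le> M * M"
          using mult_mono[OF Mb(4)[of i] Mb(2)[of i]] M1 net_sig[of i] by auto
        have b: "- Re (Pavg G (Astar G \<kappa> v) $ i * cnj (Pavg G v $ i)) \<le> (2 * M ^ 3 * X) * (M * nrm (len G i) (v i))"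
        proof -
          have "- Re (Pavg G (Astar G \<kappa> v) $ i * cnj (Pavg G v $ i)) \<le> cmod (Pavg G (Astar G \<kappa> v) $ i * cnj (Pavg G v $ i))"
            using abs_Re_le_cmod by (smt (verit))
          also have "\<dots> = cmod (Pavg G (Astar G \<kappa> v) $ i) * cmod (m i)" by (simp add: norm_mult m_def)
          also have "\<dots> \<le> (2 * M ^ 3 * X) * (M * nrm (len G i) (v i))"
            using PAb mb M1 nn by (intro mult_mono) auto
          finally show ?thesis .
        qed
        have "- (len G i / sig G i * Re (Pavg G (Astar G \<kappa> v) $ i * cnj (Pavg G v $ i)))
           = len G i / sig G i * (- Re (Pavg G (Astar G \<kappa> v) $ i * cnj (Pavg G v $ i)))" by (rule mult_minus_right[symmetric])
        also have "\<dots> \<le> len G i / sig G i * ((2 * M ^ 3 * X) * (M * nrm (len G i) (v i)))"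
          using b net_sig[of i] net_len[of i] by (intro mult_left_mono) auto
        also have "\<dots> \<le> M * M * ((2 * M ^ 3 * X) * (M * nrm (len G i) (v i)))"
          using a M1 nn by (intro mult_right_mono) auto
        also have "\<dots> = 2 * M ^ 6 * X * nrm (len G i) (v i)" by (simp add: numeral_eq_Suc)
        finally show ?thesis .
      qed
      have "- (2 * ?S)
          = 2 * (\<Sum>i\<in>UNIV. - (len G i / sig G i * Re (Pavg G (Astar G \<kappa> v) $ i * cnj (Pavg G v $ i))))"
        by (simp only: sum_negf mult_minus_right)
      also have "\<dots> \<le> 2 * (\<Sum>i\<in>UNIV. 2 * M ^ 6 * X * nrm (len G i) (v i))"
        using I by (intro mult_left_mono sum_mono) auto
      also have "\<dots> = 4 * M ^ 6 * (X * U)" by (simp add: U_def sum_distrib_left mult_ac)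
      also have "\<dots> \<le> 4 * M ^ 6 * (U\<^sup>2 + X\<^sup>2)"
        using sum_squares_bound[of X U] mult_nonneg_nonneg[OF nn(4,3)] M1
        by (intro mult_left_mono) (auto simp: mult.assoc)
      also have "\<dots> \<le> 4 * M ^ 6 * (n * M * (E + N) + 32 * n * M ^ 3 * (E + N))"
      proof (intro mult_left_mono add_mono X2)
        have "n * M * E \<le> n * M * (E + N)" using n1 M1 nn by (intro mult_left_mono) auto
        then show "U\<^sup>2 \<le> n * M * (E + N)" using U2 by linarith
      qed (use M1 in auto)
      also have "\<dots> = C4 * (E + N)" by (simp add: C4_def algebra_simps)
      also have "\<dots> \<le> C * (E + N)" using Cge EN by (intro mult_right_mono) auto
      finally show "- (2 * ?S)
       \<le> C * (energy G v + N)" by (simp add: E_def)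
    qed
  qed
qed

end

section \<open>Strongly continuous semigroups\<close>

abbreviation dquot :: "complex \<Rightarrow> 'e edgefun \<Rightarrow> 'e edgefun \<Rightarrow> 'e edgefun" where
  "dquot c u v \<equiv> (\<lambda>i x. (u i x - v i x) / c)"

lemma L2_norm_L2_set: "L2_norm d u = L2_set (\<lambda>i. nrm (d i) (u i)) UNIV"
proof -
  have "ip (d i) (u i) (u i) = of_real ((nrm (d i) (u i))\<^sup>2)" for i
    by (simp add: nrm_sq complex_norm_square[symmetric] flip: integral_complex_of_real)
  then have "L2_inner d u u = of_real (\<Sum>i\<in>UNIV. (nrm (d i) (u i))\<^sup>2)"
    by (simp add: L2_inner_def)
  then show ?thesis by (simp add: L2_norm_def L2_set_def)
qed

lemma L2_norm_nonneg [simp]: "L2_norm d u \<ge> 0"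
  by (simp add: L2_norm_L2_set L2_set_nonneg)

lemma L2_dist_nonneg [simp]: "L2_dist d u v \<ge> 0"
  by (simp add: L2_dist_def)

lemma L2_norm_sq: "(L2_norm d u)\<^sup>2 = (\<Sum>i\<in>UNIV. (nrm (d i) (u i))\<^sup>2)"
  by (simp add: L2_norm_L2_set L2_set_def sum_nonneg)

lemma nrm_le_L2_norm: "nrm (d i) (u i) \<le> L2_norm d u"
  unfolding L2_norm_L2_set by (rule member_le_L2_set) auto

lemma L2S_D: "u \<in> L2S d \<Longrightarrow> u i \<in> L2I (d i)"
  by (simp add: L2S_def)

lemma L2S_diff: "u \<in> L2S d \<Longrightarrow> v \<in> L2S d \<Longrightarrow> (\<lambda>i x. u i x - v i x) \<in> L2S d"
  by (simp add: L2S_def L2I_diff)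

lemma L2S_add: "u \<in> L2S d \<Longrightarrow> v \<in> L2S d \<Longrightarrow> (\<lambda>i x. u i x + v i x) \<in> L2S d"
  by (simp add: L2S_def L2I_add)

lemma L2S_cmult: "u \<in> L2S d \<Longrightarrow> (\<lambda>i x. c * u i x) \<in> L2S d"
  by (simp add: L2S_def L2I_cmult)

lemma L2S_divide: "u \<in> L2S d \<Longrightarrow> (\<lambda>i x. u i x / c) \<in> L2S d"
  using L2S_cmult[of u d "1 / c"] by simp

lemma L2_norm_triangle:
  assumes "u \<in> L2S d" "v \<in> L2S d"
  shows "L2_norm d (\<lambda>i x. u i x + v i x) \<le> L2_norm d u + L2_norm d v"
proof -
  have "L2_norm d (\<lambda>i x. u i x + v i x) \<le> L2_set (\<lambda>i. nrm (d i) (u i) + nrm (d i) (v i)) UNIV"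
    unfolding L2_norm_L2_set
    by (rule L2_set_mono[OF nrm_triangle[OF L2S_D[OF assms(1)] L2S_D[OF assms(2)]]]) simp
  also have "\<dots> \<le> L2_norm d u + L2_norm d v"
    unfolding L2_norm_L2_set by (rule L2_set_triangle_ineq)
  finally show ?thesis .
qed

lemma L2_dist_triangle:
  assumes "u \<in> L2S d" "v \<in> L2S d" "w \<in> L2S d"
  shows "L2_dist d u w \<le> L2_dist d u v + L2_dist d v w"
  using L2_norm_triangle[OF L2S_diff[OF assms(1,2)] L2S_diff[OF assms(2,3)]]
  by (simp add: L2_dist_def)

lemma L2_dist_commute: "L2_dist d u v = L2_dist d v u"
  by (simp add: L2_dist_def L2_norm_L2_set nrm_minus_commute[of _ "u _"])

lemma L2_norm_le_dist:
  assumes "u \<in> L2S d" "v \<in> L2S d"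
  shows "L2_norm d u \<le> L2_norm d v + L2_dist d u v"
  using L2_norm_triangle[OF assms(2) L2S_diff[OF assms]] by (simp add: L2_dist_def)

lemma nrm_component_dist:
  assumes "u \<in> L2S d" "v \<in> L2S d"
  shows "\<bar>nrm (d i) (u i) - nrm (d i) (v i)\<bar> \<le> L2_dist d u v"
  using nrm_diff_le[OF L2S_D[OF assms(1)] L2S_D[OF assms(2)], of i]
    nrm_le_L2_norm[of d i "\<lambda>i y. u i y - v i y"] by (simp add: L2_dist_def)

lemma L2_norm_cong:
  assumes "u \<in> L2S d" "v \<in> L2S d" "L2_eq d u v"
  shows "L2_norm d u = L2_norm d v"
proof -
  have "nrm (d i) (u i) = nrm (d i) (v i)" for i
    using assms by (intro nrm_cong_AE L2I_meas L2S_D) (auto simp: L2_eq_def)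
  then show ?thesis by (simp add: L2_norm_L2_set)
qed

lemma L2_dist_cong:
  assumes "u \<in> L2S d" "v \<in> L2S d" "u' \<in> L2S d" "v' \<in> L2S d" "L2_eq d u u'" "L2_eq d v v'"
  shows "L2_dist d u v = L2_dist d u' v'"
  unfolding L2_dist_def
proof (rule L2_norm_cong[OF L2S_diff[OF assms(1,2)] L2S_diff[OF assms(3,4)]])
  show "L2_eq d (\<lambda>i x. u i x - v i x) (\<lambda>i x. u' i x - v' i x)"
    unfolding L2_eq_def
  proof
    fix i
    have "AE x in lebI (d i). u i x = u' i x" "AE x in lebI (d i). v i x = v' i x"
      using assms(5,6) by (auto simp: L2_eq_def)
    then show "AE x in lebI (d i). u i x - v i x = u' i x - v' i x" by eventually_elim simp
  qed
qed

lemma L2_eq_refl [simp]: "L2_eq d u u"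
  by (simp add: L2_eq_def)

lemma L2_dist_dquot_cong:
  assumes L: "u \<in> L2S d" "v \<in> L2S d" "u' \<in> L2S d" "v' \<in> L2S d" "w \<in> L2S d"
    and eq: "L2_eq d u u'" "L2_eq d v v'"
  shows "L2_dist d (dquot c u v) w = L2_dist d (dquot c u' v') w"
proof (rule L2_dist_cong)
  show "L2_eq d (dquot c u v) (dquot c u' v')"
    unfolding L2_eq_def
  proof
    fix i
    have "AE x in lebI (d i). u i x = u' i x" "AE x in lebI (d i). v i x = v' i x"
      using eq by (auto simp: L2_eq_def)
    then show "AE x in lebI (d i). (u i x - v i x) / c = (u' i x - v' i x) / c"
      by eventually_elim simp
  qed
qed (use L in \<open>auto intro: L2S_divide L2S_diff\<close>)

lemma L2_eq_sym: "L2_eq d u v \<Longrightarrow> L2_eq d v u"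
  by (auto simp: L2_eq_def eq_commute)

lemma eventually_at_left_pos:
  assumes "\<And>h::real. 0 < h \<Longrightarrow> h < e \<Longrightarrow> P (t - h)" "e > 0"
  shows "eventually P (at_left t)"
  unfolding eventually_at_left_field
proof (intro exI[of _ "t - e"] conjI allI impI)
  show "t - e < t" using assms(2) by simp
  fix y assume "t - e < y" "y < t"
  then show "P y" using assms(1)[of "t - y"] by simp
qed

lemma filterlim_minus_left: "filterlim (\<lambda>s. t - s) (at_right 0) (at_left (t::real))"
proof -
  have "((\<lambda>s. t - s) \<longlongrightarrow> t - t) (at_left t)" by (intro tendsto_intros)
  then show ?thesis
    by (intro filterlim_at_withinI) (auto simp: eventually_at_left_field intro!: exI[of _ "t - 1"])
qed

lemma filterlim_minus_right: "filterlim (\<lambda>s. s - t) (at_right 0) (at_right (t::real))"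
proof -
  have "((\<lambda>s. s - t) \<longlongrightarrow> t - t) (at_right t)" by (intro tendsto_intros)
  then show ?thesis
    by (intro filterlim_at_withinI) (auto simp: eventually_at_right_field intro!: exI[of _ "t + 1"])
qed

context
  fixes d :: "'e::finite \<Rightarrow> real" and T :: "real \<Rightarrow> 'e edgefun \<Rightarrow> 'e edgefun"
  assumes C0: "C0_semigroup d T"
begin

lemma T_L2S: "t \<ge> 0 \<Longrightarrow> u \<in> L2S d \<Longrightarrow> T t u \<in> L2S d"
  using C0 unfolding C0_semigroup_def by blast

lemma T_linear: "t \<ge> 0 \<Longrightarrow> u \<in> L2S d \<Longrightarrow> v \<in> L2S d \<Longrightarrow>
    L2_eq d (T t (\<lambda>i x. a * u i x + b * v i x)) (\<lambda>i x. a * T t u i x + b * T t v i x)"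
  using C0 unfolding C0_semigroup_def by blast

lemma T_bounded: "t \<ge> 0 \<Longrightarrow> \<exists>C\<ge>1. \<forall>u\<in>L2S d. L2_norm d (T t u) \<le> C * L2_norm d u"
proof -
  assume "t \<ge> 0"
  then obtain C where C: "\<And>u. u \<in> L2S d \<Longrightarrow> L2_norm d (T t u) \<le> C * L2_norm d u"
    using C0[unfolded C0_semigroup_def, THEN conjunct2, THEN conjunct2, THEN conjunct1] by meson
  have "L2_norm d (T t u) \<le> max 1 C * L2_norm d u" if "u \<in> L2S d" for u
    using C[OF that] mult_right_mono[of C "max 1 C" "L2_norm d u"] by auto
  then show ?thesis by (intro exI[of _ "max 1 C"]) auto
qed

lemma T_zero: "u \<in> L2S d \<Longrightarrow> L2_eq d (T 0 u) u"
  using C0 unfolding C0_semigroup_def by blast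

lemma T_add: "s \<ge> 0 \<Longrightarrow> t \<ge> 0 \<Longrightarrow> u \<in> L2S d \<Longrightarrow> L2_eq d (T (s + t) u) (T s (T t u))"
  using C0 unfolding C0_semigroup_def by blast

lemma T_right0: "u \<in> L2S d \<Longrightarrow> ((\<lambda>t. L2_dist d (T t u) u) \<longlongrightarrow> 0) (at_right 0)"
  using C0 unfolding C0_semigroup_def by blast

text \<open>By linearity the left side is the norm of T t applied to the function measured on the
  right. The linearity law combines two functions and holds up to null sets, so the three-term
  combination is built in two stages, with v collecting the last two terms.\<close>

lemma T_quotient_bound:
  assumes t: "t \<ge> 0" and C: "\<And>u. u \<in> L2S d \<Longrightarrow> L2_norm d (T t u) \<le> C * L2_norm d u"
    and y: "y \<in> L2S d" and u: "u \<in> L2S d" and w: "w \<in> L2S d"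
  shows "L2_dist d (dquot c (T t y) (T t u)) (T t w)
    \<le> C * L2_dist d (dquot c y u) w"
proof -
  define v where "v = (\<lambda>i x. (- (1 / c)) * u i x + (- 1) * w i x)"
  have v: "v \<in> L2S d" unfolding v_def by (intro L2S_add L2S_cmult u w)
  have 1: "L2_eq d (T t v) (\<lambda>i x. (- (1 / c)) * T t u i x + (- 1) * T t w i x)"
    unfolding v_def by (rule T_linear[OF t u w])
  have 2: "L2_eq d (T t (\<lambda>i x. (1 / c) * y i x + 1 * v i x)) (\<lambda>i x. (1 / c) * T t y i x + 1 * T t v i x)"
    by (rule T_linear[OF t y v])
  let ?X = "\<lambda>i x. (y i x - u i x) / c - w i x"
  let ?Y = "\<lambda>i x. (T t y i x - T t u i x) / c - T t w i x"
  have X: "?X = (\<lambda>i x. (1 / c) * y i x + 1 * v i x)"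
    by (simp add: v_def fun_eq_iff diff_divide_distrib)
  have XL: "?X \<in> L2S d" by (intro L2S_diff L2S_divide y u w)
  have "L2_eq d (T t ?X) ?Y"
    unfolding L2_eq_def
  proof
    fix i
    have "AE x in lebI (d i). T t ?X i x = (1 / c) * T t y i x + 1 * T t v i x"
      using 2 unfolding X L2_eq_def by blast
    moreover have "AE x in lebI (d i). T t v i x = (- (1 / c)) * T t u i x + (- 1) * T t w i x"
      using 1 unfolding L2_eq_def by blast
    ultimately show "AE x in lebI (d i). T t ?X i x = ?Y i x"
      by eventually_elim (simp add: diff_divide_distrib)
  qed
  then have "L2_norm d ?Y = L2_norm d (T t ?X)"
    by (intro L2_norm_cong[symmetric] T_L2S[OF t] XL L2S_diff L2S_divide y u w)
  then show ?thesis using C[OF XL] by (simp add: L2_dist_def)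
qed

lemma T_dist_bound:
  assumes t: "t \<ge> 0" and C: "\<And>u. u \<in> L2S d \<Longrightarrow> L2_norm d (T t u) \<le> C * L2_norm d u"
    and y: "y \<in> L2S d" and u: "u \<in> L2S d"
  shows "L2_dist d (T t y) (T t u) \<le> C * L2_dist d y u"
proof -
  have "L2_eq d (T t (\<lambda>i x. 1 * y i x + (- 1) * u i x)) (\<lambda>i x. 1 * T t y i x + (- 1) * T t u i x)"
    by (rule T_linear[OF t y u])
  then have "L2_norm d (T t (\<lambda>i x. y i x - u i x)) = L2_dist d (T t y) (T t u)"
    unfolding L2_dist_def
    by (intro L2_norm_cong T_L2S[OF t] L2S_diff y u) simp_all
  then show ?thesis using C[OF L2S_diff[OF y u]] by (simp add: L2_dist_def)
qed

lemma T_right_continuous: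
  assumes t: "t \<ge> 0" and u: "u \<in> L2S d"
  shows "((\<lambda>s. L2_dist d (T s u) (T t u)) \<longlongrightarrow> 0) (at_right t)"
proof -
  obtain C where C: "C \<ge> 1" "\<And>u. u \<in> L2S d \<Longrightarrow> L2_norm d (T t u) \<le> C * L2_norm d u"
    using T_bounded[OF t] by blast
  have "((\<lambda>h. L2_dist d (T (h + t) u) (T t u)) \<longlongrightarrow> 0) (at_right 0)"
  proof (rule tendsto_sandwich[OF _ _ tendsto_const])
    show "((\<lambda>h. C * L2_dist d (T h u) u) \<longlongrightarrow> 0) (at_right 0)"
      by (rule tendsto_mult_right_zero[OF T_right0[OF u]])
    show "\<forall>\<^sub>F h in at_right 0. L2_dist d (T (h + t) u) (T t u) \<le> C * L2_dist d (T h u) u"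
    proof (rule eventually_mono[OF eventually_at_right_less])
      fix h :: real assume "0 < h"
      then have h: "h \<ge> 0" by simp
      have "L2_eq d (T (h + t) u) (T t (T h u))" using T_add[OF t h u] by (simp add: add.commute)
      then have "L2_dist d (T (h + t) u) (T t u) = L2_dist d (T t (T h u)) (T t u)"
        using h t u by (intro L2_dist_cong T_L2S) auto
      also have "\<dots> \<le> C * L2_dist d (T h u) u"
        by (rule T_dist_bound[OF t C(2) T_L2S[OF h u] u])
      finally show "L2_dist d (T (h + t) u) (T t u) \<le> C * L2_dist d (T h u) u" .
    qed
  qed (auto intro: always_eventually)
  then show ?thesis
    by (subst at_right_to_0) (simp add: filterlim_filtermap)
qed

text \<open>
  Baire's theorem on the time axis replaces the uniform boundedness principle: the times \<open>t\<close> with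
  \<open>\<parallel>T t\<parallel> \<le> k\<close> form a set closed under limits from the right, so it contains every open interval
  in which it is dense.  No completeness of \<open>L\<^sup>2\<close> is used.
\<close>

lemma T_bounded_interval:
  assumes e: "\<epsilon> > 0"
  shows "\<exists>a b K. 0 < a \<and> a < b \<and> b \<le> \<epsilon> \<and> K \<ge> 0 \<and> (\<forall>t\<in>{a..b}. \<forall>u\<in>L2S d. L2_norm d (T t u) \<le> K * L2_norm d u)"
proof -
  define B where "B k = {t \<in> {0..\<epsilon>}. \<forall>u\<in>L2S d. L2_norm d (T t u) \<le> real k * L2_norm d u}" for k
  define U where "U k = {0..\<epsilon>} - closure (B k)" for k
  have cover: "\<exists>k. t \<in> B k" if t: "t \<in> {0..\<epsilon>}" for t
  proof -
    obtain C where C: "C \<ge> 1" "\<And>u. u \<in> L2S d \<Longrightarrow> L2_norm d (T t u) \<le> C * L2_norm d u"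
      using T_bounded[of t] t by auto
    obtain k :: nat where "C \<le> real k" using real_arch_simple by blast
    then have "L2_norm d (T t u) \<le> real k * L2_norm d u" if "u \<in> L2S d" for u
      using C(2)[OF that] mult_right_mono[of C "real k" "L2_norm d u"] by auto
    then show ?thesis using t unfolding B_def by blast
  qed
  \<comment> \<open>Otherwise every \<open>U k\<close> is dense and relatively open, and Baire's
    theorem makes their intersection dense; but that intersection is empty because every time lies
    in some \<open>B k\<close>.\<close>
  have "\<exists>k. \<not> {0..\<epsilon>} \<subseteq> closure (U k)"
  proof (rule ccontr)
    assume "\<not> ?thesis"
    then have dense: "\<And>k. {0..\<epsilon>} \<subseteq> closure (U k)" by blast
    have "{0..\<epsilon>} \<subseteq> closure (\<Inter> (range U))"
    proof (rule Baire)
      fix X assume "X \<in> range U"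
      then obtain k where X: "X = U k" by blast
      have "openin (top_of_set {0..\<epsilon>}) ({0..\<epsilon>} \<inter> (- closure (B k)))"
        by (intro openin_open_Int) auto
      then show "openin (top_of_set {0..\<epsilon>}) X \<and> {0..\<epsilon>} \<subseteq> closure X"
        using dense[of k] by (simp add: X U_def Diff_eq)
    qed auto
    moreover have "\<Inter> (range U) = {}"
    proof (rule ccontr)
      assume "\<Inter> (range U) \<noteq> {}"
      then obtain t where t: "\<And>k. t \<in> U k" by auto
      then obtain k where "t \<in> B k" using cover[of t] unfolding U_def by blast
      then show False using t[of k] closure_subset[of "B k"] unfolding U_def by blast
    qed
    ultimately show False using e by auto
  qed
  then obtain k x where x: "x \<in> {0..\<epsilon>}" "x \<notin> closure (U k)" by blast
  then obtain r where r: "r > 0" "ball x r \<inter> U k = {}"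
    by (metis closure_iff_nhds_not_empty centre_in_ball open_ball disjoint_iff order_refl
        closure_approachable dist_commute mem_ball)
  \<comment> \<open>The points at one quarter and at one half of the interval from
    \<open>max 0 (x - r)\<close> to \<open>min \<epsilon> (x + r)\<close>: they lie strictly inside
    it, and a is positive.\<close>
  define a where "a = (max 0 (x - r) * 3 + min \<epsilon> (x + r)) / 4"
  define b where "b = (max 0 (x - r) + min \<epsilon> (x + r)) / 2"
  have lt: "max 0 (x - r) < min \<epsilon> (x + r)" using x e r by auto
  have ab: "0 < a" "a < b" "b < min \<epsilon> (x + r)" "max 0 (x - r) < a"
  proof -
    have "0 < (p * 3 + q') / 4 \<and> (p * 3 + q') / 4 < (p + q') / 2 \<and> (p + q') / 2 < q' \<and> p < (p * 3 + q') / 4"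
      if "0 \<le> p" "p < q'" for p q' :: real
      using that by (auto simp: field_simps)
    from this[OF _ lt] show "0 < a" "a < b" "b < min \<epsilon> (x + r)" "max 0 (x - r) < a"
      unfolding a_def b_def by auto
  qed
  have cl: "s \<in> closure (B k)" if "max 0 (x - r) < s" "s < min \<epsilon> (x + r)" for s
  proof -
    have "s \<in> ball x r" "s \<in> {0..\<epsilon>}" using that by (auto simp: dist_real_def)
    then show ?thesis using r(2) unfolding U_def by blast
  qed
  have "L2_norm d (T t u) \<le> real k * L2_norm d u" if t: "t \<in> {a..b}" and u: "u \<in> L2S d" for t u
  proof (rule field_le_epsilon)
    fix e :: real assume e: "e > 0"
    have t0: "t \<ge> 0" using t ab by auto
    have "\<forall>\<^sub>F s in at_right t. L2_dist d (T s u) (T t u) < e"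
      using T_right_continuous[OF t0 u] e by (rule order_tendstoD)
    then obtain c where c: "c > t" "\<And>s. t < s \<Longrightarrow> s < c \<Longrightarrow> L2_dist d (T s u) (T t u) < e"
      unfolding eventually_at_right_field by blast
    define c' where "c' = min c (min \<epsilon> (x + r))"
    have c': "t < c'" using c(1) t ab by (auto simp: c'_def)
    \<comment> \<open>Midpoint of t and c'. A point of \<open>B k\<close> within half the length of
      that interval is again strictly between t and c', hence to the right of t and close enough for
      right continuity.\<close>
    define s where "s = (t + c') / 2"
    have s: "t < s" "s < c'" using c' by (auto simp: s_def)
    have "s \<in> closure (B k)" by (rule cl) (use s t ab c'_def in auto)
    then obtain s' where s': "s' \<in> B k" "dist s' s < (c' - t) / 2"
      using s c' by (auto simp: closure_approachable dest!: spec[of _ "(c' - t) / 2"])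
    then have a: "\<bar>s' - (t + c') / 2\<bar> < (c' - t) / 2" by (simp add: dist_real_def s_def)
    then have "t < s'" by (simp add: abs_less_iff field_simps)
    have "s' < c'" using a by (simp add: abs_less_iff field_simps)
    then have "L2_dist d (T s' u) (T t u) < e" using \<open>t < s'\<close> by (intro c(2)) (auto simp: c'_def)
    moreover have "L2_norm d (T s' u) \<le> real k * L2_norm d u" using s'(1) u by (auto simp: B_def)
    moreover have "s' \<ge> 0" using \<open>t < s'\<close> t0 by simp
    ultimately show "L2_norm d (T t u) \<le> real k * L2_norm d u + e"
      using L2_norm_le_dist[OF T_L2S[OF t0 u] T_L2S[OF \<open>s' \<ge> 0\<close> u]] L2_dist_commute[of d "T t u"]
      by simp
  qed
  then show ?thesis using ab by (intro exI[of _ a] exI[of _ b] exI[of _ "real k"]) auto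
qed

lemma T_power_bound:
  assumes "\<delta> \<ge> 0" "C \<ge> 0" and C: "\<And>u. u \<in> L2S d \<Longrightarrow> L2_norm d (T \<delta> u) \<le> C * L2_norm d u"
    and u: "u \<in> L2S d" and r: "r \<ge> 0"
  shows "L2_norm d (T (real n * \<delta> + r) u) \<le> C ^ n * L2_norm d (T r u)"
proof (induction n)
  case (Suc n)
  have nn: "real n * \<delta> + r \<ge> 0" using assms by simp
  have "L2_eq d (T (\<delta> + (real n * \<delta> + r)) u) (T \<delta> (T (real n * \<delta> + r) u))"
    by (rule T_add[OF assms(1) nn u])
  then have "L2_norm d (T (\<delta> + (real n * \<delta> + r)) u) = L2_norm d (T \<delta> (T (real n * \<delta> + r) u))"
    using nn assms(1) by (intro L2_norm_cong T_L2S u) auto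
  also have "\<dots> \<le> C * L2_norm d (T (real n * \<delta> + r) u)" by (intro C T_L2S nn u)
  also have "\<dots> \<le> C * (C ^ n * L2_norm d (T r u))" by (rule mult_left_mono[OF Suc assms(2)])
  finally show ?case by (simp add: algebra_simps)
qed simp

text \<open>Every t in the range is \<open>real n * \<delta> + r\<close> with r in the interval
  \<open>{a..b}\<close> of uniform boundedness and \<delta> its length. The operator
  \<open>T \<delta>\<close> is applied at most m times, and since its bound C is at least 1,
  \<open>C ^ n\<close> may be replaced by \<open>C ^ m\<close>.\<close>

lemma T_locally_bounded:
  assumes a0: "a\<^sub>0 > 0"
  shows "\<exists>K\<ge>0. \<forall>t\<in>{a\<^sub>0..R}. \<forall>u\<in>L2S d. L2_norm d (T t u) \<le> K * L2_norm d u"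
proof -
  obtain a b K where ab: "0 < a" "a < b" "b \<le> a\<^sub>0" "K \<ge> 0"
    and K: "\<And>t u. t \<in> {a..b} \<Longrightarrow> u \<in> L2S d \<Longrightarrow> L2_norm d (T t u) \<le> K * L2_norm d u"
    using T_bounded_interval[OF a0] by metis
  define \<delta> where "\<delta> = b - a"
  have \<delta>: "\<delta> > 0" using ab by (simp add: \<delta>_def)
  obtain C where C: "C \<ge> 1" "\<And>u. u \<in> L2S d \<Longrightarrow> L2_norm d (T \<delta> u) \<le> C * L2_norm d u"
    using T_bounded[of \<delta>] \<delta> by auto
  define m where "m = nat \<lceil>R / \<delta>\<rceil>"
  have "L2_norm d (T t u) \<le> C ^ m * K * L2_norm d u" if t: "t \<in> {a\<^sub>0..R}" and u: "u \<in> L2S d" for t u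
  proof -
    define n where "n = nat \<lfloor>(t - a) / \<delta>\<rfloor>"
    have q0: "(t - a) / \<delta> \<ge> 0" using t ab \<delta> by simp
    have n: "real n \<le> (t - a) / \<delta>" "(t - a) / \<delta> < real n + 1"
      using q0 unfolding n_def by linarith+
    have n': "real n * \<delta> \<le> t - a" "t - a < (real n + 1) * \<delta>"
      using n \<delta> by (simp_all add: field_simps)
    have r: "t - real n * \<delta> \<in> {a..b}" using n' by (auto simp: \<delta>_def algebra_simps)
    have "real n \<le> R / \<delta>" using n(1) t ab \<delta> divide_right_mono[of "t - a" R \<delta>] by auto
    then have "n \<le> m" unfolding m_def by linarith
    have "L2_norm d (T (real n * \<delta> + (t - real n * \<delta>)) u) \<le> C ^ n * L2_norm d (T (t - real n * \<delta>) u)"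
      by (rule T_power_bound[OF _ _ C(2) u]) (use \<delta> C r ab in auto)
    also have "\<dots> \<le> C ^ m * (K * L2_norm d u)"
      using C \<open>n \<le> m\<close> by (intro mult_mono power_increasing K r u) auto
    finally show ?thesis by (simp add: mult.assoc)
  qed
  then show ?thesis using C ab by (intro exI[of _ "C ^ m * K"]) auto
qed

text \<open>The difference is \<open>T (t - h)\<close> applied to \<open>u - T h u\<close>. The
  outer operator moves with h, so pointwise boundedness is not enough and the locally uniform bound
  is required.\<close>

lemma T_left_continuous:
  assumes t: "t > 0" and u: "u \<in> L2S d"
  shows "((\<lambda>s. L2_dist d (T s u) (T t u)) \<longlongrightarrow> 0) (at_left t)"
proof -
  obtain K where K: "K \<ge> 0" "\<And>s u. s \<in> {t/2..t} \<Longrightarrow> u \<in> L2S d \<Longrightarrow> L2_norm d (T s u) \<le> K * L2_norm d u"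
    using T_locally_bounded[of "t/2" t] t by auto
  show ?thesis
  proof (rule tendsto_sandwich[OF _ _ tendsto_const])
    show "((\<lambda>s. K * L2_dist d (T (t - s) u) u) \<longlongrightarrow> 0) (at_left t)"
      by (rule tendsto_mult_right_zero[OF filterlim_compose[OF T_right0[OF u] filterlim_minus_left]])
    show "\<forall>\<^sub>F s in at_left t. L2_dist d (T s u) (T t u) \<le> K * L2_dist d (T (t - s) u) u"
    proof (rule eventually_at_left_pos)
      fix h assume h: "0 < h" "h < t / 2"
      have L: "T h u \<in> L2S d" using h u by (intro T_L2S) auto
      have "L2_eq d (T (t - h + h) u) (T (t - h) (T h u))" by (rule T_add) (use h u in auto)
      then have "L2_dist d (T (t - h) u) (T t u) = L2_dist d (T (t - h) u) (T (t - h) (T h u))"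
        using h u L by (intro L2_dist_cong T_L2S) auto
      also have "\<dots> \<le> K * L2_dist d u (T h u)"
        by (rule T_dist_bound[OF _ K(2) u L]) (use h in auto)
      finally show "L2_dist d (T (t - h) u) (T t u) \<le> K * L2_dist d (T (t - (t - h)) u) u"
        by (simp add: L2_dist_commute)
    qed (use t in auto)
  qed (auto intro: always_eventually)
qed

lemma T_right_derivative:
  assumes t: "t \<ge> 0" and g: "in_generator d T u w"
  shows "((\<lambda>s. L2_dist d (dquot (of_real (s - t)) (T s u) (T t u)) (T t w)) \<longlongrightarrow> 0) (at_right t)"
proof -
  have u: "u \<in> L2S d" and w: "w \<in> L2S d"
    and lim: "((\<lambda>h. L2_dist d (dquot (of_real h) (T h u) u) w) \<longlongrightarrow> 0) (at_right 0)"
    using g unfolding in_generator_def by auto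
  obtain C where C: "C \<ge> 1" "\<And>u. u \<in> L2S d \<Longrightarrow> L2_norm d (T t u) \<le> C * L2_norm d u"
    using T_bounded[OF t] by blast
  show ?thesis
  proof (rule tendsto_sandwich[OF _ _ tendsto_const])
    show "((\<lambda>s. C * L2_dist d (dquot (of_real (s - t)) (T (s - t) u) u) w) \<longlongrightarrow> 0) (at_right t)"
      by (rule tendsto_mult_right_zero[OF filterlim_compose[OF lim filterlim_minus_right]])
    show "\<forall>\<^sub>F s in at_right t. L2_dist d (dquot (of_real (s - t)) (T s u) (T t u)) (T t w)
      \<le> C * L2_dist d (dquot (of_real (s - t)) (T (s - t) u) u) w"
    proof (rule eventually_mono[OF eventually_at_right_less])
      fix s assume s: "t < s"
      have L: "T (s - t) u \<in> L2S d" using s u by (intro T_L2S) auto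
      have e: "L2_eq d (T (t + (s - t)) u) (T t (T (s - t) u))" by (rule T_add) (use s t u in auto)
      have "L2_dist d (dquot (of_real (s - t)) (T s u) (T t u)) (T t w)
          = L2_dist d (dquot (of_real (s - t)) (T t (T (s - t) u)) (T t u)) (T t w)"
        using e s t u w L by (intro L2_dist_dquot_cong T_L2S) auto
      also have "\<dots> \<le> C * L2_dist d (dquot (of_real (s - t)) (T (s - t) u) u) w"
        by (rule T_quotient_bound[OF t C(2) L u w])
      finally show "L2_dist d (dquot (of_real (s - t)) (T s u) (T t u)) (T t w)
        \<le> C * L2_dist d (dquot (of_real (s - t)) (T (s - t) u) u) w" .
    qed
  qed (auto intro: always_eventually)
qed

lemma T_in_generator:
  assumes t: "t \<ge> 0" and g: "in_generator d T u w"
  shows "in_generator d T (T t u) (T t w)"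
proof -
  have u: "u \<in> L2S d" and w: "w \<in> L2S d" using g unfolding in_generator_def by auto
  have "((\<lambda>h. L2_dist d (dquot (of_real h) (T (h + t) u) (T t u)) (T t w)) \<longlongrightarrow> 0) (at_right 0)"
    using T_right_derivative[OF t g] by (subst (asm) at_right_to_0) (simp add: filterlim_filtermap)
  moreover have "\<forall>\<^sub>F h in at_right 0. L2_dist d (dquot (of_real h) (T (h + t) u) (T t u)) (T t w)
      = L2_dist d (dquot (of_real h) (T h (T t u)) (T t u)) (T t w)"
  proof (rule eventually_mono[OF eventually_at_right_less])
    fix h :: real assume h: "0 < h"
    have "L2_eq d (T (h + t) u) (T h (T t u))" by (rule T_add) (use h t u in auto)
    then show "L2_dist d (dquot (of_real h) (T (h + t) u) (T t u)) (T t w)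
      = L2_dist d (dquot (of_real h) (T h (T t u)) (T t u)) (T t w)"
      using h t u w by (intro L2_dist_dquot_cong T_L2S) auto
  qed
  ultimately have "((\<lambda>h. L2_dist d (dquot (of_real h) (T h (T t u)) (T t u)) (T t w)) \<longlongrightarrow> 0) (at_right 0)"
    by (rule Lim_transform_eventually)
  then show ?thesis unfolding in_generator_def using t u w T_L2S by auto
qed

text \<open>From the left the difference quotient is \<open>T (t - h)\<close> applied to the
  quotient at 0. It is compared first with \<open>T (t - h) w\<close>, by local boundedness, and
  then with \<open>T t w\<close>, by left continuity.\<close>

lemma T_derivative:
  assumes t: "t > 0" and g: "in_generator d T u w"
  shows "((\<lambda>s. L2_dist d (dquot (of_real (s - t)) (T s u) (T t u)) (T t w)) \<longlongrightarrow> 0) (at t)"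
proof (rule filterlim_split_at_real)
  show "((\<lambda>s. L2_dist d (dquot (of_real (s - t)) (T s u) (T t u)) (T t w)) \<longlongrightarrow> 0) (at_right t)"
    using T_right_derivative[OF less_imp_le[OF t] g] .
  have u: "u \<in> L2S d" and w: "w \<in> L2S d"
    and lim: "((\<lambda>h. L2_dist d (dquot (of_real h) (T h u) u) w) \<longlongrightarrow> 0) (at_right 0)"
    using g unfolding in_generator_def by auto
  obtain K where K: "K \<ge> 0" "\<And>s u. s \<in> {t/2..t} \<Longrightarrow> u \<in> L2S d \<Longrightarrow> L2_norm d (T s u) \<le> K * L2_norm d u"
    using T_locally_bounded[of "t/2" t] t by auto
  show "((\<lambda>s. L2_dist d (dquot (of_real (s - t)) (T s u) (T t u)) (T t w)) \<longlongrightarrow> 0) (at_left t)"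
  proof (rule tendsto_sandwich[OF _ _ tendsto_const])
    show "((\<lambda>s. K * L2_dist d (dquot (of_real (t - s)) (T (t - s) u) u) w
        + L2_dist d (T s w) (T t w)) \<longlongrightarrow> 0) (at_left t)"
      by (rule tendsto_add_zero[OF tendsto_mult_right_zero[OF filterlim_compose[OF lim filterlim_minus_left]]
            T_left_continuous[OF t w]])
    show "\<forall>\<^sub>F s in at_left t. L2_dist d (dquot (of_real (s - t)) (T s u) (T t u)) (T t w)
      \<le> K * L2_dist d (dquot (of_real (t - s)) (T (t - s) u) u) w + L2_dist d (T s w) (T t w)"
    proof (rule eventually_at_left_pos)
      fix h assume h: "0 < h" "h < t / 2"
      have L: "T h u \<in> L2S d" "T (t - h) u \<in> L2S d" "T (t - h) w \<in> L2S d" "T t w \<in> L2S d" "T t u \<in> L2S d"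
         "T (t - h) (T h u) \<in> L2S d"
        using h u w by (auto intro!: T_L2S)
      have e: "L2_eq d (T (t - h + h) u) (T (t - h) (T h u))" by (rule T_add) (use h u in auto)
      have "dquot (of_real (t - h - t)) (T (t - h) u) (T t u) = dquot (of_real h) (T t u) (T (t - h) u)"
        using h by (simp add: fun_eq_iff divide_simps)
      then have "L2_dist d (dquot (of_real (t - h - t)) (T (t - h) u) (T t u)) (T t w)
          = L2_dist d (dquot (of_real h) (T (t - h) (T h u)) (T (t - h) u)) (T t w)"
        using e L by (simp only:) (intro L2_dist_dquot_cong; simp)
      also have "\<dots> \<le> L2_dist d (dquot (of_real h) (T (t - h) (T h u)) (T (t - h) u)) (T (t - h) w)
          + L2_dist d (T (t - h) w) (T t w)"
        using L by (intro L2_dist_triangle L2S_divide L2S_diff)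
      also have "L2_dist d (dquot (of_real h) (T (t - h) (T h u)) (T (t - h) u)) (T (t - h) w)
          \<le> K * L2_dist d (dquot (of_real h) (T h u) u) w"
        by (rule T_quotient_bound[OF _ K(2) L(1) u w]) (use h in auto)
      finally show "L2_dist d (dquot (of_real (t - h - t)) (T (t - h) u) (T t u)) (T t w)
        \<le> K * L2_dist d (dquot (of_real (t - (t - h))) (T (t - (t - h)) u) u) w
          + L2_dist d (T (t - h) w) (T t w)" by simp
    qed (use t in auto)
  qed (auto intro: always_eventually)
qed

end

section \<open>Differentiating squared norms and integrals along a curve in L2\<close>

lemma has_vector_derivative_quotient:
  fixes f :: "real \<Rightarrow> 'a::real_normed_vector"
  assumes "((\<lambda>s. (f s - f t) /\<^sub>R (s - t)) \<longlongrightarrow> y) (at t)"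
  shows "(f has_vector_derivative y) (at t)"
  unfolding has_vector_derivative_def has_derivative_at_within
proof (intro conjI bounded_linear_scaleR_left)
  have lim: "((\<lambda>s. (f s - f t) /\<^sub>R (s - t) - y) \<longlongrightarrow> 0) (at t)"
    using assms by (rule LIM_zero)
  show "((\<lambda>s. (f s - f t - (s - t) *\<^sub>R y) /\<^sub>R norm (s - t)) \<longlongrightarrow> 0) (at t)"
  proof (rule Lim_null_comparison[OF _ tendsto_norm_zero[OF lim]])
    show "\<forall>\<^sub>F s in at t. norm ((f s - f t - (s - t) *\<^sub>R y) /\<^sub>R norm (s - t))
        \<le> norm ((f s - f t) /\<^sub>R (s - t) - y)"
    proof (rule eventually_mono[OF eventually_neq_at_within[of t t UNIV]])
      fix s assume "s \<noteq> t"
      then have "(f s - f t) /\<^sub>R (s - t) - y = (f s - f t - (s - t) *\<^sub>R y) /\<^sub>R (s - t)"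
        by (simp add: scaleR_diff_right)
      then show "norm ((f s - f t - (s - t) *\<^sub>R y) /\<^sub>R norm (s - t))
        \<le> norm ((f s - f t) /\<^sub>R (s - t) - y)" by simp
    qed
  qed
qed

lemma nrm_sq_add:
  assumes "f \<in> L2I D" "g \<in> L2I D"
  shows "(nrm D (\<lambda>x. f x + g x))\<^sup>2 = (nrm D f)\<^sup>2
    + 2 * Re (ip D g f) + (nrm D g)\<^sup>2"
proof -
  let ?I = "lint D"
  note i = L2I_mult_integrable[OF assms(2) L2I_cnj[OF assms(1)]]
  have "(nrm D (\<lambda>x. f x + g x))\<^sup>2 = ?I (\<lambda>x. (cmod (f x))\<^sup>2 + 2 * Re (g x * cnj (f x)) + (cmod (g x))\<^sup>2)"
    unfolding nrm_sq
    by (rule arg_cong[where f="?I"], rule ext, simp only: cmod_power2)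
      (simp add: power2_eq_square algebra_simps)
  also have "\<dots> = ?I (\<lambda>x. (cmod (f x))\<^sup>2) + 2 * ?I (\<lambda>x. Re (g x * cnj (f x))) + ?I (\<lambda>x. (cmod (g x))\<^sup>2)"
    by (simp only: Bochner_Integration.integral_add[OF Bochner_Integration.integrable_add[OF
            L2I_sq_integrable[OF assms(1)] integrable_mult_right[OF integrable_Re[OF i]]] L2I_sq_integrable[OF assms(2)]]
          Bochner_Integration.integral_add[OF L2I_sq_integrable[OF assms(1)] integrable_mult_right[OF integrable_Re[OF i]]]
          integral_mult_right_zero)
  also have "?I (\<lambda>x. Re (g x * cnj (f x))) = Re (?I (\<lambda>x. g x * cnj (f x)))"
    by (rule integral_Re[OF i])
  finally show ?thesis by (simp only: nrm_sq)
qed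

context
  fixes D :: real and x :: "real \<Rightarrow> real \<Rightarrow> complex" and z :: "real \<Rightarrow> complex" and t :: real
  assumes D: "D > 0" and xL: "\<And>s. s \<ge> 0 \<Longrightarrow> x s \<in> L2I D" and z: "z \<in> L2I D" and t: "t > 0"
    and lim: "((\<lambda>s. nrm D (\<lambda>y. (x s y - x t y) / of_real (s - t) - z y)) \<longlongrightarrow> 0) (at t)"
begin

lemma quotient_L2I: "s \<ge> 0 \<Longrightarrow> (\<lambda>y. (x s y - x t y) / of_real (s - t)) \<in> L2I D"
  using L2I_cmult[OF L2I_diff[OF xL xL], of s t "1 / of_real (s - t)"] t by simp

lemma eventually_nonneg_near: "\<forall>\<^sub>F s in at t. s \<ge> 0 \<and> s \<noteq> t"
  unfolding eventually_at using t by (intro exI[of _ t]) (auto simp: dist_real_def)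

lemma integral_quotient_tendsto:
  assumes g: "g \<in> L2I D"
  shows "((\<lambda>s. lint D (\<lambda>y. (x s y - x t y) / of_real (s - t) * g y))
    \<longlongrightarrow> lint D (\<lambda>y. z y * g y)) (at t)"
proof (rule LIM_zero_cancel, rule Lim_null_comparison)
  show "((\<lambda>s. nrm D (\<lambda>y. (x s y - x t y) / of_real (s - t) - z y) * nrm D g) \<longlongrightarrow> 0) (at t)"
    by (rule tendsto_mult_left_zero[OF lim])
  show "\<forall>\<^sub>F s in at t. cmod (lint D (\<lambda>y. (x s y - x t y) / of_real (s - t) * g y)
      - lint D (\<lambda>y. z y * g y))
      \<le> nrm D (\<lambda>y. (x s y - x t y) / of_real (s - t) - z y) * nrm D g"
    using eventually_nonneg_near
  proof eventually_elim
    case (elim s)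
    then have qL: "(\<lambda>y. (x s y - x t y) / of_real (s - t)) \<in> L2I D" by (intro quotient_L2I) simp
    have "lint D (\<lambda>y. (x s y - x t y) / of_real (s - t) * g y)
        - lint D (\<lambda>y. z y * g y)
        = lint D (\<lambda>y. ((x s y - x t y) / of_real (s - t) - z y) * g y)"
      by (simp only: Bochner_Integration.integral_diff[OF L2I_mult_integrable[OF qL g] L2I_mult_integrable[OF z g], symmetric]
          left_diff_distrib)
    then show ?case using Cauchy_Schwarz_L2I[OF L2I_diff[OF qL z] g] by simp
  qed
qed

text \<open>Writing \<open>x s\<close> as \<open>x t\<close> plus (s - t) times the difference
  quotient and expanding the square, the real quotient becomes twice the real part of an inner
  product plus (s - t) times the squared norm of the difference quotient. The latter stays bounded,
  so the second term vanishes in the limit.\<close>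

lemma nrm_sq_has_derivative:
  "((\<lambda>s. (nrm D (x s))\<^sup>2) has_real_derivative
    2 * Re (ip D z (x t))) (at t)"
  unfolding has_field_derivative_iff
proof -
  let ?q = "\<lambda>s y. (x s y - x t y) / of_real (s - t)"
  let ?I = "lint D"
  have tL: "x t \<in> L2I D" using xL t by simp
  have "((\<lambda>s. 2 * Re (?I (\<lambda>y. ?q s y * cnj (x t y))) + (s - t) * (nrm D (?q s))\<^sup>2)
      \<longlongrightarrow> 2 * Re (?I (\<lambda>y. z y * cnj (x t y))) + (t - t) * (nrm D z)\<^sup>2) (at t)"
  proof (intro tendsto_intros integral_quotient_tendsto[OF L2I_cnj[OF tL]])
    show "((\<lambda>s. nrm D (?q s)) \<longlongrightarrow> nrm D z) (at t)"
    proof (rule LIM_zero_cancel, rule Lim_null_comparison[OF _ lim])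
      show "\<forall>\<^sub>F s in at t. norm (nrm D (?q s) - nrm D z) \<le> nrm D (\<lambda>y. ?q s y - z y)"
        using eventually_nonneg_near
      proof eventually_elim
        case (elim s)
        then have qL: "?q s \<in> L2I D" by (intro quotient_L2I) simp
        show ?case
          using nrm_diff_le[OF qL z] by simp
      qed
    qed
  qed
  then have "((\<lambda>s. 2 * Re (?I (\<lambda>y. ?q s y * cnj (x t y))) + (s - t) * (nrm D (?q s))\<^sup>2)
      \<longlongrightarrow> 2 * Re (?I (\<lambda>y. z y * cnj (x t y)))) (at t)" by simp
  then show "((\<lambda>s. ((nrm D (x s))\<^sup>2 - (nrm D (x t))\<^sup>2) / (s - t))
      \<longlongrightarrow> 2 * Re (?I (\<lambda>y. z y * cnj (x t y)))) (at t)"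
  proof (rule Lim_transform_eventually)
    show "\<forall>\<^sub>F s in at t. 2 * Re (?I (\<lambda>y. ?q s y * cnj (x t y))) + (s - t) * (nrm D (?q s))\<^sup>2
        = ((nrm D (x s))\<^sup>2 - (nrm D (x t))\<^sup>2) / (s - t)"
      using eventually_nonneg_near
    proof eventually_elim
      case (elim s)
      then have qL: "?q s \<in> L2I D" by (intro quotient_L2I) simp
      have st: "complex_of_real (s - t) \<noteq> 0" "s - t \<noteq> 0" using elim by auto
      have "x s = (\<lambda>y. x t y + of_real (s - t) * ?q s y)" using st by auto
      then have "(nrm D (x s))\<^sup>2 = (nrm D (\<lambda>y. x t y + of_real (s - t) * ?q s y))\<^sup>2" by simp
      also have "\<dots> = (nrm D (x t))\<^sup>2 + 2 * Re (?I (\<lambda>y. of_real (s - t) * ?q s y * cnj (x t y)))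
          + (nrm D (\<lambda>y. of_real (s - t) * ?q s y))\<^sup>2"
        by (rule nrm_sq_add[OF tL L2I_cmult[OF qL]])
      also have "?I (\<lambda>y. of_real (s - t) * ?q s y * cnj (x t y)) = of_real (s - t) * ?I (\<lambda>y. ?q s y * cnj (x t y))"
        by (simp only: mult.assoc integral_mult_right_zero)
      also have "Re (of_real (s - t) * ?I (\<lambda>y. ?q s y * cnj (x t y))) = (s - t) * Re (?I (\<lambda>y. ?q s y * cnj (x t y)))"
        by (simp only: scaleR_conv_of_real[symmetric] scaleR_complex.sel)
      also have "nrm D (\<lambda>y. of_real (s - t) * ?q s y) = \<bar>s - t\<bar> * nrm D (?q s)"
        by (simp only: nrm_cmult norm_of_real)
      finally have fin: "(nrm D (x s))\<^sup>2 - (nrm D (x t))\<^sup>2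
          = (s - t) * (2 * Re (?I (\<lambda>y. ?q s y * cnj (x t y))) + (s - t) * (nrm D (?q s))\<^sup>2)"
        by (simp only: power_mult_distrib power2_abs) (simp only: power2_eq_square algebra_simps)
      show ?case by (simp only: fin nonzero_mult_div_cancel_left[OF st(2)])
    qed
  qed
qed

lemma integral_has_derivative:
  "((\<lambda>s. lint D (x s)) has_vector_derivative
    lint D z) (at t)"
proof -
  let ?I = "lint D"
  have "((\<lambda>s. ?I (\<lambda>y. (x s y - x t y) / of_real (s - t) * 1)) \<longlongrightarrow> ?I (\<lambda>y. z y * 1)) (at t)"
    by (rule integral_quotient_tendsto[OF L2I_const])
  then have 1: "((\<lambda>s. ?I (\<lambda>y. (x s y - x t y) / of_real (s - t) * 1)) \<longlongrightarrow> ?I z) (at t)" by simp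
  have "((\<lambda>s. (?I (x s) - ?I (x t)) /\<^sub>R (s - t)) \<longlongrightarrow> ?I z) (at t)"
  proof (rule Lim_transform_eventually[OF 1])
    show "\<forall>\<^sub>F s in at t. ?I (\<lambda>y. (x s y - x t y) / of_real (s - t) * 1) = (?I (x s) - ?I (x t)) /\<^sub>R (s - t)"
      using eventually_nonneg_near
    proof eventually_elim
      case (elim s)
      then show ?case
        using L2I_integrable[OF xL[of s]] L2I_integrable[OF xL[of t]] t
        by (simp add: scaleR_conv_of_real divide_inverse mult.commute)
    qed
  qed
  then show ?thesis by (rule has_vector_derivative_quotient)
qed

end

section \<open>The energy method along trajectories\<close>

text \<open>The function \<open>exp (- (a * t)) * (y t + b / a)\<close> is nonincreasing. The sign
  of a is left open, because growth of the mean error needs a > 0 and decay of the fluctuation a <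
  0. Derivatives are demanded in the open interval only, as trajectories are differentiated at
  positive times.\<close>

lemma gronwall:
  assumes "\<tau> \<ge> 0" "a \<noteq> 0" and y: "continuous_on {0..\<tau>} y"
    and d: "\<And>t. 0 < t \<Longrightarrow> t < \<tau> \<Longrightarrow> (y has_real_derivative y' t) (at t)"
    and le: "\<And>t. 0 < t \<Longrightarrow> t < \<tau> \<Longrightarrow> y' t \<le> a * y t + b"
  shows "y \<tau> + b / a \<le> exp (a * \<tau>) * (y 0 + b / a)"
proof -
  define g where "g t = exp (- (a * t)) * (y t + b / a)" for t
  have "g \<tau> \<le> g 0"
  proof (rule DERIV_nonpos_imp_decreasing_open[OF assms(1)])
    show "continuous_on {0..\<tau>} g" unfolding g_def by (intro continuous_intros y)
    fix t assume t: "0 < t" "t < \<tau>"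
    have "(g has_real_derivative (exp (- (a * t)) * - a * (y t + b / a) + (y' t + 0) * exp (- (a * t)))) (at t)"
      unfolding g_def
      by (rule DERIV_mult[OF DERIV_fun_exp DERIV_add[OF d[OF t] DERIV_const]])
        (auto intro!: derivative_eq_intros)
    moreover have "exp (- (a * t)) * - a * (y t + b / a) + (y' t + 0) * exp (- (a * t))
        = exp (- (a * t)) * (y' t - (a * y t + b))"
      using assms(2) by (simp add: field_simps)
    moreover have "\<dots> \<le> 0" using le[OF t] by (simp add: mult_le_0_iff)
    ultimately show "\<exists>z. (g has_real_derivative z) (at t) \<and> z \<le> 0" by metis
  qed
  then have "exp (- (a * \<tau>)) * (y \<tau> + b / a) \<le> y 0 + b / a" by (simp add: g_def)
  then have "exp (a * \<tau>) * (exp (- (a * \<tau>)) * (y \<tau> + b / a)) \<le> exp (a * \<tau>) * (y 0 + b / a)"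
    by (intro mult_left_mono) auto
  then show ?thesis by (simp add: mult.assoc[symmetric] exp_minus)
qed

section \<open>The matrix exponential of Q\<close>

lemma linear_Qop: "linear (Qop G)"
  by (rule linearI) (auto simp: Qop_def vec_eq_iff algebra_simps sum.distrib scaleR_sum_right)

lemma bounded_linear_Qop: "bounded_linear (Qop G)"
  using linear_Qop linear_conv_bounded_linear by blast

lemma Qop_power_diff: "(Qop G ^^ k) (c - c') = (Qop G ^^ k) c - (Qop G ^^ k) c'"
  by (induction k) (auto simp: linear_diff[OF linear_Qop])

lemma Qop_bound: "\<exists>K\<ge>0. \<forall>c. norm (Qop G c) \<le> K * norm c"
proof -
  obtain K where "K > 0" "\<And>c. norm (Qop G c) \<le> norm c * K"
    using bounded_linear.pos_bounded[OF bounded_linear_Qop, of G] by blast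
  then show ?thesis by (intro exI[of _ K]) (simp add: mult.commute)
qed

lemma Qop_power_bound:
  assumes "K \<ge> 0" "\<And>c. norm (Qop G c) \<le> K * norm c"
  shows "norm ((Qop G ^^ k) c) \<le> K ^ k * norm c"
proof (induction k)
  case (Suc k)
  have "norm (Qop G ((Qop G ^^ k) c)) \<le> K * (K ^ k * norm c)"
    by (rule order_trans[OF assms(2) mult_left_mono[OF Suc assms(1)]])
  then show ?case by (simp add: mult.assoc)
qed simp

lemma exp_tQ_term_bound:
  assumes "K \<ge> 0" "\<And>c. norm (Qop G c) \<le> K * norm c"
  shows "norm ((t ^ k / fact k) *\<^sub>R (Qop G ^^ k) c) \<le> (\<bar>t\<bar> * K) ^ k /\<^sub>R fact k * norm c"
proof -
  have "norm ((t ^ k / fact k) *\<^sub>R (Qop G ^^ k) c) = \<bar>t\<bar> ^ k / fact k * norm ((Qop G ^^ k) c)"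
    by (simp add: power_abs)
  also have "\<dots> \<le> \<bar>t\<bar> ^ k / fact k * (K ^ k * norm c)"
    by (intro mult_left_mono Qop_power_bound assms) auto
  finally show ?thesis by (simp add: power_mult_distrib divide_inverse mult_ac)
qed

lemma exp_tQ_sums: "(\<lambda>k. (t ^ k / fact k) *\<^sub>R (Qop G ^^ k) c) sums exp_tQ G t c"
proof -
  obtain K where K: "K \<ge> 0" "\<And>c. norm (Qop G c) \<le> K * norm c" using Qop_bound by blast
  have "summable (\<lambda>k. (\<bar>t\<bar> * K) ^ k /\<^sub>R fact k * norm c)"
    by (intro summable_mult2 summable_exp_generic)
  then have "summable (\<lambda>k. (t ^ k / fact k) *\<^sub>R (Qop G ^^ k) c)"
    using exp_tQ_term_bound[OF K] by (rule summable_comparison_test'[where N=0])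
  then show ?thesis unfolding exp_tQ_def by (rule summable_sums)
qed

lemma exp_tQ_0: "exp_tQ G 0 c = c"
proof -
  have "(\<lambda>k. (0 ^ k / fact k) *\<^sub>R (Qop G ^^ k) c) sums (\<Sum>k\<in>{0}. (0 ^ k / fact k) *\<^sub>R (Qop G ^^ k) c)"
    by (rule sums_finite) auto
  then show ?thesis using exp_tQ_sums[of 0 G c] sums_unique2 by fastforce
qed

lemma exp_tQ_diff: "exp_tQ G t (c - c') = exp_tQ G t c - exp_tQ G t c'"
proof -
  have "(\<lambda>k. (t ^ k / fact k) *\<^sub>R (Qop G ^^ k) (c - c')) sums (exp_tQ G t c - exp_tQ G t c')"
    using sums_diff[OF exp_tQ_sums[of t G c] exp_tQ_sums[of t G c']]
    by (simp add: Qop_power_diff scaleR_diff_right)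
  then show ?thesis using exp_tQ_sums sums_unique2 by blast
qed

lemma exp_tQ_bound: "\<exists>L. \<forall>c. norm (exp_tQ G t c) \<le> L * norm c"
proof -
  obtain K where K: "K \<ge> 0" "\<And>c. norm (Qop G c) \<le> K * norm c" using Qop_bound by blast
  have s: "(\<lambda>k. (\<bar>t\<bar> * K) ^ k /\<^sub>R fact k * norm c) sums (exp (\<bar>t\<bar> * K) * norm c)" for c :: "complex^'a"
    by (intro sums_mult2 exp_converges)
  have "norm (exp_tQ G t c) \<le> exp (\<bar>t\<bar> * K) * norm c" for c
    unfolding exp_tQ_def
    using norm_suminf_le[OF exp_tQ_term_bound[OF K] sums_summable[OF s]] sums_unique[OF s, of c] by simp
  then show ?thesis by blast
qed

lemma Qop_exp_tQ: "Qop G (exp_tQ G t c) = exp_tQ G t (Qop G c)"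
proof -
  have "(\<lambda>k. Qop G ((t ^ k / fact k) *\<^sub>R (Qop G ^^ k) c)) sums Qop G (exp_tQ G t c)"
    by (rule bounded_linear.sums[OF bounded_linear_Qop exp_tQ_sums])
  then have "(\<lambda>k. (t ^ k / fact k) *\<^sub>R (Qop G ^^ k) (Qop G c)) sums Qop G (exp_tQ G t c)"
    by (simp add: linear_scale[OF linear_Qop] funpow_swap1)
  then show ?thesis using exp_tQ_sums sums_unique2 by blast
qed

text \<open>Each component is an everywhere convergent complex power series with coefficients
  \<open>a c k\<close>. Its formal derivative is the series belonging to \<open>Qop G c\<close>, so
  term-by-term differentiation applies, followed by restriction to the real line.\<close>

lemma exp_tQ_derivative:
  "((\<lambda>t. exp_tQ G t c $ i) has_vector_derivative (Qop G (exp_tQ G t c) $ i)) (at t)"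
proof -
  define a where "a c k = ((Qop G ^^ k) c $ i) / fact k" for c k
  obtain K where K: "K \<ge> 0" "\<And>c. norm (Qop G c) \<le> K * norm c" using Qop_bound by blast
  have summ: "summable (\<lambda>k. a c k * z ^ k)" for c z
  proof (rule summable_comparison_test'[where N=0])
    show "summable (\<lambda>k. (cmod z * K) ^ k /\<^sub>R fact k * norm c)"
      by (intro summable_mult2 summable_exp_generic)
    fix k
    have "cmod ((Qop G ^^ k) c $ i) \<le> K ^ k * norm c"
      by (rule order_trans[OF Finite_Cartesian_Product.norm_nth_le Qop_power_bound[OF K]])
    then have "cmod ((Qop G ^^ k) c $ i) * (cmod z ^ k / fact k) \<le> K ^ k * norm c * (cmod z ^ k / fact k)"
      by (rule mult_right_mono) simp
    moreover have "norm (a c k * z ^ k) = cmod ((Qop G ^^ k) c $ i) * (cmod z ^ k / fact k)"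
      by (simp add: a_def norm_mult norm_divide norm_power)
    moreover have "K ^ k * norm c * (cmod z ^ k / fact k) = (cmod z * K) ^ k /\<^sub>R fact k * norm c"
      by (simp add: power_mult_distrib divide_inverse mult_ac)
    ultimately show "norm (a c k * z ^ k) \<le> (cmod z * K) ^ k /\<^sub>R fact k * norm c"
      by simp
  qed
  have comp: "exp_tQ G s c $ i = (\<Sum>k. a c k * of_real s ^ k)" for s c
  proof -
    have "(\<lambda>k. ((s ^ k / fact k) *\<^sub>R (Qop G ^^ k) c) $ i) sums (exp_tQ G s c $ i)"
      by (rule bounded_linear.sums[OF bounded_linear_vec_nth exp_tQ_sums])
    moreover have "((s ^ k / fact k) *\<^sub>R (Qop G ^^ k) c) $ i = a c k * of_real s ^ k" for k
      by (simp only: vector_scaleR_component) (simp add: a_def scaleR_conv_of_real)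
    ultimately show ?thesis by (simp add: sums_iff)
  qed
  have diffs: "diffs (a c) = a (Qop G c)"
    by (rule ext) (simp add: diffs_def a_def funpow_swap1 del: of_nat_Suc)
  have "((\<lambda>z. \<Sum>k. a c k * z ^ k) has_field_derivative (\<Sum>k. diffs (a c) k * of_real t ^ k)) (at (of_real t))"
    by (rule termdiffs_strong_converges_everywhere[OF summ])
  then have "((\<lambda>s. \<Sum>k. a c k * of_real s ^ k) has_vector_derivative (\<Sum>k. a (Qop G c) k * of_real t ^ k)) (at t)"
    unfolding diffs by (rule has_vector_derivative_real_field)
  then show ?thesis by (simp add: comp[symmetric] Qop_exp_tQ)
qed

lemma cmod_sq_has_derivative:
  assumes "(f has_vector_derivative f') (at t)"
  shows "((\<lambda>s. (cmod (f s))\<^sup>2) has_real_derivative 2 * Re (f' * cnj (f t))) (at t)"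
proof -
  have r: "((\<lambda>s. Re (f s)) has_real_derivative Re f') (at t)" "((\<lambda>s. Im (f s)) has_real_derivative Im f') (at t)"
    using bounded_linear.has_vector_derivative[OF bounded_linear_Re assms]
      bounded_linear.has_vector_derivative[OF bounded_linear_Im assms]
    by (simp_all add: has_real_derivative_iff_has_vector_derivative)
  have "((\<lambda>s. (Re (f s))\<^sup>2 + (Im (f s))\<^sup>2) has_real_derivative
      (2 * (Re f' * Re (f t)) + 2 * (Im f' * Im (f t)))) (at t)"
    by (rule DERIV_cong[OF DERIV_add[OF DERIV_power[OF r(1), of 2] DERIV_power[OF r(2), of 2]]]) simp
  then show ?thesis by (simp add: cmod_power2)
qed

lemma norm_vec_sq: "(norm (c :: complex^'e))\<^sup>2 = (\<Sum>i\<in>UNIV. (cmod (c $ i))\<^sup>2)"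
  by (simp add: norm_vec_def L2_set_def sum_nonneg)

text \<open>The mean subtracted in \<open>fluct\<close> moves with u. Separating energy and means
  makes continuity and differentiability of the fluctuation follow from those of the two
  parts.\<close>

lemma fluct_energy:
  assumes "is_network G" "u \<in> L2S (len G)"
  shows "fluct G u = energy G u - (\<Sum>i\<in>UNIV. len G i / sig G i * (cmod (Pavg G u $ i))\<^sup>2)"
proof -
  have "(nrm (len G i) (\<lambda>x. u i x - Pavg G u $ i))\<^sup>2 / sig G i
      = (nrm (len G i) (u i))\<^sup>2 / sig G i - len G i / sig G i * (cmod (Pavg G u $ i))\<^sup>2" for i
    using nrm_split_mean[OF net_len[OF assms(1)] L2S_D[OF assms(2)], of i 0]
    by (simp add: Pavg_def add_divide_distrib)
  then show ?thesis by (simp add: fluct_def energy_def sum_subtractf)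
qed

lemma fluct_nonneg: "is_network G \<Longrightarrow> fluct G u \<ge> 0"
  unfolding fluct_def by (intro sum_nonneg divide_nonneg_pos net_sig) auto

lemma energy_nonneg: "is_network G \<Longrightarrow> energy G u \<ge> 0"
  unfolding energy_def by (intro sum_nonneg divide_nonneg_pos net_sig) auto

lemma dist_edge_const:
  assumes "is_network G" "u \<in> L2S (len G)"
  shows "(L2_dist (len G) u (edge_const y))\<^sup>2
    = (\<Sum>i\<in>UNIV. (nrm (len G i) (\<lambda>x. u i x - Pavg G u $ i))\<^sup>2 + len G i * (cmod ((Pavg G u - y) $ i))\<^sup>2)"
  unfolding L2_dist_def L2_norm_sq edge_const_def
proof (intro sum.cong refl)
  fix i
  show "(nrm (len G i) (\<lambda>x. u i x - y $ i))\<^sup>2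
    = (nrm (len G i) (\<lambda>x. u i x - Pavg G u $ i))\<^sup>2 + len G i * (cmod ((Pavg G u - y) $ i))\<^sup>2"
    using nrm_split_mean[OF net_len[OF assms(1)] L2S_D[OF assms(2)], of i "y $ i"]
    unfolding Pavg_def by simp
qed

text \<open>By Pythagoras the error consists of the fluctuation and the error of the means, the two
  quantities that the energy method controls.\<close>

lemma dist_edge_const_le:
  assumes net: "is_network G" and u: "u \<in> L2S (len G)" and M: "netbound G M"
  shows "(L2_dist (len G) u (edge_const y))\<^sup>2 \<le> M * (fluct G u + (norm (Pavg G u - y))\<^sup>2)"
proof -
  have Mb: "sig G i \<le> M" "len G i \<le> M" for i using M by (auto simp: netbound_def)
  have "(L2_dist (len G) u (edge_const y))\<^sup>2
      \<le> (\<Sum>i\<in>UNIV. M * ((nrm (len G i) (\<lambda>x. u i x - Pavg G u $ i))\<^sup>2 / sig G i)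
        + M * (cmod ((Pavg G u - y) $ i))\<^sup>2)"
    unfolding dist_edge_const[OF net u]
  proof (intro sum_mono add_mono mult_right_mono Mb)
    fix i
    have "(nrm (len G i) (\<lambda>x. u i x - Pavg G u $ i))\<^sup>2
        = sig G i * ((nrm (len G i) (\<lambda>x. u i x - Pavg G u $ i))\<^sup>2 / sig G i)"
      using net_sig[OF net, of i] by simp
    also have "\<dots> \<le> M * ((nrm (len G i) (\<lambda>x. u i x - Pavg G u $ i))\<^sup>2 / sig G i)"
      using net_sig[OF net, of i] Mb by (intro mult_right_mono) auto
    finally show "(nrm (len G i) (\<lambda>x. u i x - Pavg G u $ i))\<^sup>2
      \<le> M * ((nrm (len G i) (\<lambda>x. u i x - Pavg G u $ i))\<^sup>2 / sig G i)" .
  qed simp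
  also have "\<dots> = M * (fluct G u + (norm (Pavg G u - y))\<^sup>2)"
    unfolding fluct_def norm_vec_sq sum.distrib sum_distrib_left[symmetric] distrib_left ..
  finally show ?thesis .
qed

lemma Pavg_diff_bound:
  assumes net: "is_network G" and "v \<in> L2S (len G)" "w \<in> L2S (len G)"
  shows "cmod (Pavg G v $ i - Pavg G w $ i) \<le> L2_dist (len G) v w / sqrt (len G i)"
proof -
  have L: "v i \<in> L2I (len G i)" "w i \<in> L2I (len G i)" using assms(2,3) by (auto intro: L2S_D)
  have "Pavg G v $ i - Pavg G w $ i
      = lint (len G i) (\<lambda>y. v i y - w i y) / of_real (len G i)"
    using L2I_integrable[OF L(1)] L2I_integrable[OF L(2)] by (simp add: Pavg_def diff_divide_distrib)
  then have "cmod (Pavg G v $ i - Pavg G w $ i) \<le> nrm (len G i) (\<lambda>y. v i y - w i y) / sqrt (len G i)"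
    using mean_bound[OF net_len[OF net] L2I_diff[OF L]] by simp
  also have "\<dots> \<le> L2_dist (len G) v w / sqrt (len G i)"
    unfolding L2_dist_def using net_len[OF net, of i]
    by (intro divide_right_mono nrm_le_L2_norm[where u="\<lambda>i y. v i y - w i y"]) auto
  finally show ?thesis .
qed

text \<open>Matches what is known of a trajectory, namely right continuity at 0 and
  differentiability at positive times, with the continuity on a closed interval that
  \<open>gronwall\<close> asks for.\<close>

lemma continuous_on_from_zero:
  fixes f :: "real \<Rightarrow> 'b::topological_space"
  assumes "(f \<longlongrightarrow> f 0) (at_right 0)" "\<And>t. t > 0 \<Longrightarrow> isCont f t"
  shows "continuous_on {0..\<tau>} f"
  unfolding continuous_on_def
proof
  fix t assume t: "t \<in> {0..\<tau>}"
  show "(f \<longlongrightarrow> f t) (at t within {0..\<tau>})"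
  proof (cases "t = 0")
    case True
    have "at 0 within {0..\<tau>} \<le> at_right 0"
      unfolding at_within_def by (intro inf_mono order_refl) auto
    then show ?thesis using assms(1) True tendsto_mono by blast
  next
    case False
    then have "isCont f t" using t assms(2) by auto
    then show ?thesis unfolding isCont_def by (rule tendsto_within_subset) auto
  qed
qed

section \<open>Trajectories that start in the domain\<close>

context
  fixes G :: "('e::finite) network" and \<kappa> :: real and T :: "real \<Rightarrow> 'e edgefun \<Rightarrow> 'e edgefun"
  assumes net: "is_network G" and gen: "generates (len G) (dom_Astar G \<kappa>) (Astar G \<kappa>) T"
begin

lemma gen_C0: "C0_semigroup (len G) T"
  using gen by (simp add: generates_def)

lemma dom_L2S: "u \<in> dom_Astar G \<kappa> \<Longrightarrow> u \<in> L2S (len G)"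
  by (simp add: dom_Astar_def H2S_def)

lemma Astar_L2S: "u \<in> dom_Astar G \<kappa> \<Longrightarrow> Astar G \<kappa> u \<in> L2S (len G)"
  using dom_rep[OF net] unfolding L2S_def by blast

lemma dom_in_generator:
  assumes "u \<in> dom_Astar G \<kappa>" shows "in_generator (len G) T u (Astar G \<kappa> u)"
  using gen dom_L2S[OF assms] Astar_L2S[OF assms] assms by (simp add: generates_def)

text \<open>\<open>generates\<close> describes the domain as the set where the limit at 0 exists, up
  to null sets; the semigroup law carries this limit from u to \<open>T t u\<close>.\<close>

lemma dom_invariant:
  assumes u: "u \<in> dom_Astar G \<kappa>" and t: "t \<ge> 0"
  shows "T t u \<in> dom_Astar G \<kappa>" "L2_eq (len G) (Astar G \<kappa> (T t u)) (T t (Astar G \<kappa> u))"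
proof -
  have "in_generator (len G) T (T t u) (T t (Astar G \<kappa> u))"
    by (rule T_in_generator[OF gen_C0 t dom_in_generator[OF u]])
  then show "T t u \<in> dom_Astar G \<kappa>" "L2_eq (len G) (Astar G \<kappa> (T t u)) (T t (Astar G \<kappa> u))"
    using gen unfolding generates_def in_generator_def by blast+
qed

lemma trajectory_L2I: "u \<in> L2S (len G) \<Longrightarrow> t \<ge> 0 \<Longrightarrow> T t u i \<in> L2I (len G i)"
  by (intro L2S_D T_L2S[OF gen_C0])

lemma edge_derivative:
  assumes u: "u \<in> dom_Astar G \<kappa>" and t: "t > 0"
  shows "((\<lambda>s. nrm (len G i) (\<lambda>y. (T s u i y - T t u i y) / of_real (s - t) - T t (Astar G \<kappa> u) i y))
    \<longlongrightarrow> 0) (at t)"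
proof (rule Lim_null_comparison[OF always_eventually T_derivative[OF gen_C0 t dom_in_generator[OF u]]], intro allI)
  fix s
  show "norm (nrm (len G i) (\<lambda>y. (T s u i y - T t u i y) / of_real (s - t) - T t (Astar G \<kappa> u) i y))
    \<le> L2_dist (len G) (dquot (complex_of_real (s - t)) (T s u) (T t u)) (T t (Astar G \<kappa> u))"
    using nrm_le_L2_norm[of "len G" i "\<lambda>i y. (T s u i y - T t u i y) / of_real (s - t) - T t (Astar G \<kappa> u) i y"]
    by (simp add: L2_dist_def)
qed

lemma nrm_trajectory_derivative:
  assumes u: "u \<in> dom_Astar G \<kappa>" and t: "t > 0"
  shows "((\<lambda>s. (nrm (len G i) (T s u i))\<^sup>2) has_real_derivative
    2 * Re (ip (len G i) (Astar G \<kappa> (T t u) i) (T t u i))) (at t)"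
proof -
  have t0: "t \<ge> 0" using t by simp
  have uL: "u \<in> L2S (len G)" by (rule dom_L2S[OF u])
  have aL: "T t (Astar G \<kappa> u) i \<in> L2I (len G i)" by (rule trajectory_L2I[OF Astar_L2S[OF u] t0])
  have "((\<lambda>s. (nrm (len G i) (T s u i))\<^sup>2) has_real_derivative
    2 * Re (ip (len G i) (T t (Astar G \<kappa> u) i) (T t u i))) (at t)"
    by (rule nrm_sq_has_derivative[OF net_len[OF net] trajectory_L2I[OF uL] aL t edge_derivative[OF u t]])
  moreover have "ip (len G i) (T t (Astar G \<kappa> u) i) (T t u i)
    = ip (len G i) (Astar G \<kappa> (T t u) i) (T t u i)"
  proof (rule integral_cong_AE)
    have "AE y in lebI (len G i). Astar G \<kappa> (T t u) i y = T t (Astar G \<kappa> u) i y"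
      using dom_invariant(2)[OF u t0] by (simp add: L2_eq_def)
    then show "AE y in lebI (len G i). T t (Astar G \<kappa> u) i y * cnj (T t u i y)
        = Astar G \<kappa> (T t u) i y * cnj (T t u i y)" by eventually_elim simp
  qed (intro borel_measurable_times L2I_meas[OF aL] L2I_meas[OF L2I_cnj[OF trajectory_L2I[OF uL t0]]]
      L2I_meas[OF L2S_D[OF Astar_L2S[OF dom_invariant(1)[OF u t0]]]])+
  ultimately show ?thesis by simp
qed

lemma mean_trajectory_derivative:
  assumes u: "u \<in> dom_Astar G \<kappa>" and t: "t > 0"
  shows "((\<lambda>s. Pavg G (T s u) $ i) has_vector_derivative Pavg G (Astar G \<kappa> (T t u)) $ i) (at t)"
proof -
  have t0: "t \<ge> 0" using t by simp
  have uL: "u \<in> L2S (len G)" by (rule dom_L2S[OF u])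
  have aL: "T t (Astar G \<kappa> u) i \<in> L2I (len G i)" by (rule trajectory_L2I[OF Astar_L2S[OF u] t0])
  have "((\<lambda>s. lint (len G i) (T s u i)) has_vector_derivative
    lint (len G i) (T t (Astar G \<kappa> u) i)) (at t)"
    by (rule integral_has_derivative[OF net_len[OF net] trajectory_L2I[OF uL] aL t edge_derivative[OF u t]])
  moreover have "lint (len G i) (T t (Astar G \<kappa> u) i)
    = lint (len G i) (Astar G \<kappa> (T t u) i)"
  proof (rule integral_cong_AE)
    show "AE y in lebI (len G i). T t (Astar G \<kappa> u) i y = Astar G \<kappa> (T t u) i y"
      using L2_eq_sym[OF dom_invariant(2)[OF u t0]] by (simp add: L2_eq_def)
  qed (intro L2I_meas aL L2S_D[OF Astar_L2S[OF dom_invariant(1)[OF u t0]]])+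
  ultimately have "((\<lambda>s. lint (len G i) (T s u i) * (1 / of_real (len G i)))
    has_vector_derivative lint (len G i) (Astar G \<kappa> (T t u) i) * (1 / of_real (len G i))) (at t)"
    by (intro has_vector_derivative_mult_left) simp
  then show ?thesis by (simp add: Pavg_def)
qed

lemma trajectory_right0:
  assumes u: "u \<in> L2S (len G)"
  shows "((\<lambda>s. L2_dist (len G) (T s u) (T 0 u)) \<longlongrightarrow> 0) (at_right 0)"
  by (rule T_right_continuous[OF gen_C0 order_refl u])

lemma nrm_trajectory_continuous0:
  assumes u: "u \<in> L2S (len G)"
  shows "((\<lambda>s. nrm (len G i) (T s u i)) \<longlongrightarrow> nrm (len G i) (T 0 u i)) (at_right 0)"
proof (rule LIM_zero_cancel, rule Lim_null_comparison[OF _ trajectory_right0[OF u]])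
  show "\<forall>\<^sub>F s in at_right 0. norm (nrm (len G i) (T s u i) - nrm (len G i) (T 0 u i))
      \<le> L2_dist (len G) (T s u) (T 0 u)"
    unfolding real_norm_def
    by (rule eventually_mono[OF eventually_at_right_less])
      (intro nrm_component_dist T_L2S[OF gen_C0] u; simp)
qed

lemma mean_trajectory_continuous0:
  assumes u: "u \<in> L2S (len G)"
  shows "((\<lambda>s. Pavg G (T s u) $ i) \<longlongrightarrow> Pavg G (T 0 u) $ i) (at_right 0)"
proof (rule LIM_zero_cancel, rule Lim_null_comparison)
  show "((\<lambda>s. L2_dist (len G) (T s u) (T 0 u) / sqrt (len G i)) \<longlongrightarrow> 0) (at_right 0)"
    by (rule tendsto_divide_zero[OF trajectory_right0[OF u]])
  show "\<forall>\<^sub>F s in at_right 0. norm (Pavg G (T s u) $ i - Pavg G (T 0 u) $ i)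
      \<le> L2_dist (len G) (T s u) (T 0 u) / sqrt (len G i)"
    by (rule eventually_mono[OF eventually_at_right_less])
      (intro Pavg_diff_bound[OF net] T_L2S[OF gen_C0] u; simp)
qed

lemma T0_values:
  assumes u: "u \<in> L2S (len G)"
  shows "energy G (T 0 u) = energy G u" "Pavg G (T 0 u) = Pavg G u" "fluct G (T 0 u) = fluct G u"
proof -
  have e: "AE x in lebI (len G i). T 0 u i x = u i x" for i
    using T_zero[OF gen_C0 u] by (simp add: L2_eq_def)
  have m: "T 0 u i \<in> borel_measurable (lebI (len G i))"
    "u i \<in> borel_measurable (lebI (len G i))" for i
    using L2I_meas[OF L2S_D[OF T_L2S[OF gen_C0 order_refl u]]] L2I_meas[OF L2S_D[OF u]] by auto
  show 1: "energy G (T 0 u) = energy G u"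
    unfolding energy_def using nrm_cong_AE[OF e m] by simp
  show 2: "Pavg G (T 0 u) = Pavg G u"
    unfolding Pavg_def using integral_cong_AE[OF m e] by simp
  show "fluct G (T 0 u) = fluct G u"
    using fluct_energy[OF net T_L2S[OF gen_C0 order_refl u]] fluct_energy[OF net u] 1 2 by simp
qed

text \<open>The rate B collects the growth \<open>1 + 2 * K\<^sup>2\<close> of the mean error and C
  of the energy. The threshold \<open>2 * C\<close> for \<kappa> lets half of the dissipation absorb
  all terms in N, leaving the other half to work with.\<close>

lemma trajectory_estimate:
  assumes C1: "C \<ge> 1"
    and static: "\<And>v. v \<in> dom_Astar G \<kappa> \<Longrightarrow> energy_bounds G \<kappa> C v"
    and K: "K \<ge> 0" "\<And>c. norm (Qop G c) \<le> K * norm c"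
    and k: "\<kappa> \<ge> 2 * C" and u: "u \<in> dom_Astar G \<kappa>" and \<tau>: "\<tau> \<ge> 0"
  defines "B \<equiv> 1 + 2 * K\<^sup>2 + C"
  shows "fluct G (T \<tau> u) \<le> exp (- (\<kappa> / C * \<tau>)) * fluct G u + 2 * C\<^sup>2 * exp (B * \<tau>) * energy G u / \<kappa>"
    and "(norm (Pavg G (T \<tau> u) - exp_tQ G \<tau> (Pavg G u)))\<^sup>2 \<le> 2 * C * exp (B * \<tau>) * energy G u / \<kappa>"
proof -
  have uL: "u \<in> L2S (len G)" by (rule dom_L2S[OF u])
  have k0: "\<kappa> > 0" using k C1 by linarith
  have B1: "B \<ge> 1" using C1 by (simp add: B_def)
  define v where "v t = T t u" for t
  define a where "a t = Astar G \<kappa> (v t)" for t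
  define E where "E t = energy G (v t)" for t
  define c where "c t = Pavg G (v t)" for t
  define W where "W t = fluct G (v t)" for t
  define y where "y t = exp_tQ G t (Pavg G u)" for t
  define Z where "Z t = (norm (c t - y t))\<^sup>2" for t
  define E' where "E' t = 2 * (\<Sum>i\<in>UNIV. Re (ip (len G i) (a t i) (v t i)) / sig G i)" for t
  define S' where "S' t = 2 * (\<Sum>i\<in>UNIV. len G i / sig G i * Re (Pavg G (a t) $ i * cnj (c t $ i)))" for t
  define Z' where "Z' t = (\<Sum>i\<in>UNIV. 2 * Re ((Pavg G (a t) $ i - Qop G (y t) $ i) * cnj (c t $ i - y t $ i)))" for t
  have vL: "v t \<in> L2S (len G)" if "t \<ge> 0" for t
    unfolding v_def by (rule T_L2S[OF gen_C0 that uL])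
  have WE: "W t = E t - (\<Sum>i\<in>UNIV. len G i / sig G i * (cmod (c t $ i))\<^sup>2)" if "t \<ge> 0" for t
    unfolding W_def E_def c_def by (rule fluct_energy[OF net vL[OF that]])
  have Zsum: "Z t = (\<Sum>i\<in>UNIV. (cmod (c t $ i - y t $ i))\<^sup>2)" for t
    by (simp add: Z_def norm_vec_sq)
  have dn: "((\<lambda>s. (nrm (len G i) (v s i))\<^sup>2) has_real_derivative
      2 * Re (ip (len G i) (a t i) (v t i))) (at t)" if "t > 0" for t i
    unfolding v_def a_def by (rule nrm_trajectory_derivative[OF u that])
  have dc: "((\<lambda>s. c s $ i) has_vector_derivative Pavg G (a t) $ i) (at t)" if "t > 0" for t i
    unfolding c_def v_def a_def by (rule mean_trajectory_derivative[OF u that])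
  have dy: "((\<lambda>s. y s $ i) has_vector_derivative Qop G (y t) $ i) (at t)" for t i
    unfolding y_def by (rule exp_tQ_derivative)
  have dE: "(E has_real_derivative E' t) (at t)" if "t > 0" for t
  proof -
    have "((\<lambda>s. \<Sum>i\<in>UNIV. (nrm (len G i) (v s i))\<^sup>2 / sig G i) has_real_derivative
      (\<Sum>i\<in>UNIV. 2 * Re (ip (len G i) (a t i) (v t i)) / sig G i)) (at t)"
      by (intro DERIV_sum DERIV_cdivide dn that)
    then show ?thesis unfolding E_def[abs_def] energy_def E'_def by (simp add: sum_distrib_left)
  qed
  have dS: "((\<lambda>s. \<Sum>i\<in>UNIV. len G i / sig G i * (cmod (c s $ i))\<^sup>2) has_real_derivative S' t) (at t)"
    if "t > 0" for t
  proof -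
    have "((\<lambda>s. \<Sum>i\<in>UNIV. len G i / sig G i * (cmod (c s $ i))\<^sup>2) has_real_derivative
      (\<Sum>i\<in>UNIV. len G i / sig G i * (2 * Re (Pavg G (a t) $ i * cnj (c t $ i))))) (at t)"
      by (intro DERIV_sum DERIV_cmult cmod_sq_has_derivative dc that)
    moreover have "(\<Sum>i\<in>UNIV. len G i / sig G i * (2 * Re (Pavg G (a t) $ i * cnj (c t $ i)))) = S' t"
      unfolding S'_def sum_distrib_left by (intro sum.cong refl) (simp only: mult.left_commute)
    ultimately show ?thesis by simp
  qed
  \<comment> \<open>The fluctuation is differentiated through \<open>WE\<close>; that identity holds
    for nonnegative times only, hence the open set of positive times.\<close>
  have dW: "(W has_real_derivative E' t - S' t) (at t)" if "t > 0" for t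
  proof (rule has_field_derivative_transform_within_open[OF DERIV_diff[OF dE[OF that] dS[OF that]], of "{0<..}"])
    show "E s - (\<Sum>i\<in>UNIV. len G i / sig G i * (cmod (c s $ i))\<^sup>2) = W s" if "s \<in> {0<..}" for s
      using WE[of s] that by simp
  qed (use that in auto)
  have dZ: "(Z has_real_derivative Z' t) (at t)" if "t > 0" for t
    unfolding Zsum[abs_def] Z'_def
    by (intro DERIV_sum cmod_sq_has_derivative has_vector_derivative_diff dc dy that)
  have cE: "continuous_on {0..\<tau>} E" for \<tau>
  proof (rule continuous_on_from_zero)
    show "(E \<longlongrightarrow> E 0) (at_right 0)"
      unfolding E_def[abs_def] energy_def v_def using net_sig[OF net]
      by (intro tendsto_intros nrm_trajectory_continuous0 uL) (simp add: less_imp_neq[symmetric])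
  qed (use dE DERIV_isCont in blast)
  have cc: "((\<lambda>s. c s $ i) \<longlongrightarrow> c 0 $ i) (at_right 0)" for i
    unfolding c_def v_def by (rule mean_trajectory_continuous0[OF uL])
  have cy: "((\<lambda>s. y s $ i) \<longlongrightarrow> y 0 $ i) (at_right 0)" for i
  proof -
    have "isCont (\<lambda>s. y s $ i) 0" using has_vector_derivative_continuous[OF dy] by blast
    then show ?thesis unfolding isCont_def by (rule tendsto_within_subset) auto
  qed
  have cZ: "continuous_on {0..\<tau>} Z" for \<tau>
  proof (rule continuous_on_from_zero)
    show "(Z \<longlongrightarrow> Z 0) (at_right 0)"
      unfolding Zsum[abs_def] by (intro tendsto_intros cc cy)
  qed (use dZ DERIV_isCont in blast)
  have cW: "continuous_on {0..\<tau>} W" for \<tau>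
  proof (rule continuous_on_from_zero)
    have "((\<lambda>s. E s - (\<Sum>i\<in>UNIV. len G i / sig G i * (cmod (c s $ i))\<^sup>2))
        \<longlongrightarrow> E 0 - (\<Sum>i\<in>UNIV. len G i / sig G i * (cmod (c 0 $ i))\<^sup>2)) (at_right 0)"
      unfolding E_def[abs_def] energy_def v_def using net_sig[OF net]
      by (intro tendsto_intros nrm_trajectory_continuous0 uL cc) (simp add: less_imp_neq[symmetric])
    then have "((\<lambda>s. E s - (\<Sum>i\<in>UNIV. len G i / sig G i * (cmod (c s $ i))\<^sup>2)) \<longlongrightarrow> W 0) (at_right 0)"
      using WE[of 0] by simp
    then show "(W \<longlongrightarrow> W 0) (at_right 0)"
      by (rule Lim_transform_eventually)
        (rule eventually_mono[OF eventually_at_right_less], simp add: WE)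
  qed (use dW DERIV_isCont in blast)
  have nn: "E t \<ge> 0" "W t \<ge> 0" "Z t \<ge> 0" for t
    unfolding E_def W_def Z_def by (auto intro: energy_nonneg fluct_nonneg net)
  have init: "E 0 = energy G u" "W 0 = fluct G u" "Z 0 = 0"
    unfolding E_def W_def Z_def v_def c_def y_def using T0_values[OF uL] by (auto simp: exp_tQ_0)
  \<comment> \<open>A separate N is obtained at each time; no regularity in t is required of it. In
    the bound for \<open>Z'\<close> the velocity error is split into \<open>x\<close>, the
    discrepancy between the mean of \<open>Astar\<close> and Q of the mean, which costs N, and
    \<open>w\<close>, Q applied to the error, which costs \<open>K\<^sup>2 * Z t\<close>.\<close>
  have st: "\<exists>N\<ge>0. E' t \<le> - 2 * \<kappa> * N + C * (E t + N) \<and> Z' t \<le> 2 * C * N + (1 + 2 * K\<^sup>2) * Z t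
      \<and> W t \<le> C * N \<and> - S' t \<le> C * (E t + N)" if t: "t > 0" for t
  proof -
    have "v t \<in> dom_Astar G \<kappa>" unfolding v_def by (rule dom_invariant(1)[OF u less_imp_le[OF t]])
    from static[OF this, unfolded energy_bounds_def] obtain N where N: "N \<ge> 0" "E' t \<le> - 2 * \<kappa> * N + C * (E t + N)"
      "(\<Sum>i\<in>UNIV. (cmod ((Pavg G (a t) - Qop G (c t)) $ i))\<^sup>2) \<le> C * N" "W t \<le> C * N"
      "- S' t \<le> C * (E t + N)"
      unfolding E'_def S'_def E_def W_def c_def a_def by blast
    have "Z' t \<le> (\<Sum>i\<in>UNIV. 2 * (cmod ((Pavg G (a t) - Qop G (c t)) $ i))\<^sup>2
        + 2 * (cmod (Qop G (c t - y t) $ i))\<^sup>2 + (cmod (c t $ i - y t $ i))\<^sup>2)"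
      unfolding Z'_def
    proof (rule sum_mono)
      fix i
      define x where "x = (Pavg G (a t) - Qop G (c t)) $ i"
      define w where "w = Qop G (c t - y t) $ i"
      define e where "e = c t $ i - y t $ i"
      have xw: "Pavg G (a t) $ i - Qop G (y t) $ i = x + w"
        by (simp add: x_def w_def linear_diff[OF linear_Qop])
      have "2 * Re ((x + w) * cnj e) \<le> 2 * (cmod (x + w) * cmod e)"
        using complex_Re_le_cmod[of "(x + w) * cnj e"] by (simp add: norm_mult)
      also have "\<dots> \<le> (cmod (x + w))\<^sup>2 + (cmod e)\<^sup>2"
        using sum_squares_bound[of "cmod (x + w)" "cmod e"] by (simp add: mult.assoc)
      also have "(cmod (x + w))\<^sup>2 \<le> (cmod x + cmod w)\<^sup>2"
        by (intro power_mono norm_triangle_ineq) simp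
      also have "(cmod x + cmod w)\<^sup>2 \<le> 2 * (cmod x)\<^sup>2 + 2 * (cmod w)\<^sup>2"
        using sum_squares_bound[of "cmod x" "cmod w"] by (simp add: power2_sum)
      finally show "2 * Re ((Pavg G (a t) $ i - Qop G (y t) $ i) * cnj (c t $ i - y t $ i))
          \<le> 2 * (cmod ((Pavg G (a t) - Qop G (c t)) $ i))\<^sup>2
        + 2 * (cmod (Qop G (c t - y t) $ i))\<^sup>2 + (cmod (c t $ i - y t $ i))\<^sup>2"
        unfolding xw x_def w_def e_def by simp
    qed
    also have "\<dots> = 2 * (\<Sum>i\<in>UNIV. (cmod ((Pavg G (a t) - Qop G (c t)) $ i))\<^sup>2)
        + 2 * (norm (Qop G (c t - y t)))\<^sup>2 + Z t"
      unfolding Zsum norm_vec_sq[of "Qop G (c t - y t)"] by (simp only: sum.distrib sum_distrib_left)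
    also have "\<dots> \<le> 2 * (C * N) + 2 * (K\<^sup>2 * Z t) + Z t"
    proof (intro add_right_mono add_mono mult_left_mono N)
      have "(norm (Qop G (c t - y t)))\<^sup>2 \<le> (K * norm (c t - y t))\<^sup>2"
        by (intro power_mono K) simp
      then show "(norm (Qop G (c t - y t)))\<^sup>2 \<le> K\<^sup>2 * Z t" by (simp add: Z_def power_mult_distrib)
    qed auto
    finally have "Z' t \<le> 2 * C * N + (1 + 2 * K\<^sup>2) * Z t" by (simp add: algebra_simps)
    with N show ?thesis by blast
  qed
  \<comment> \<open>The energy is added with the weight for which its surplus dissipation, \<kappa>
    N, times the weight equals the term 2 C N in \<open>Z'\<close>. As the weight is of order
    1/\<kappa> and Z starts at 0, the initial value of \<Psi> is small.\<close>
  define \<Psi> where "\<Psi> t = Z t + 2 * C / \<kappa> * E t" for t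
  have \<Psi>: "\<Psi> \<tau> \<le> exp (B * \<tau>) * (2 * C / \<kappa> * energy G u)" if "\<tau> \<ge> 0" for \<tau>
  proof -
    have "\<Psi> \<tau> + 0 / B \<le> exp (B * \<tau>) * (\<Psi> 0 + 0 / B)"
    proof (rule gronwall[OF that])
      show "B \<noteq> 0" using B1 by simp
      show "continuous_on {0..\<tau>} \<Psi>" unfolding \<Psi>_def by (intro continuous_intros cZ cE)
      fix t :: real assume t: "0 < t"
      show "(\<Psi> has_real_derivative Z' t + 2 * C / \<kappa> * E' t) (at t)"
        unfolding \<Psi>_def by (intro DERIV_add DERIV_cmult dZ dE t)
      obtain N where N: "N \<ge> 0" "E' t \<le> - 2 * \<kappa> * N + C * (E t + N)" "Z' t \<le> 2 * C * N + (1 + 2 * K\<^sup>2) * Z t"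
        using st[OF t] by blast
      \<comment> \<open>Spends one of the two copies of \<kappa> N on the term C N of the energy
        inequality; the other cancels the source in \<open>Z'\<close>.\<close>
      have "C * N \<le> \<kappa> * N" using k C1 N(1) by (intro mult_right_mono) auto
      then have "E' t \<le> - \<kappa> * N + C * E t" using N(2) by (simp add: algebra_simps)
      then have "2 * C / \<kappa> * E' t \<le> 2 * C / \<kappa> * (- \<kappa> * N + C * E t)"
        using C1 k0 by (intro mult_left_mono) auto
      also have "\<dots> = - (2 * C * N) + C * (2 * C / \<kappa> * E t)" using k0 by (simp add: field_simps)
      finally have "Z' t + 2 * C / \<kappa> * E' t \<le> (1 + 2 * K\<^sup>2) * Z t + C * (2 * C / \<kappa> * E t)"
        using N(3) by simp
      also have "\<dots> \<le> B * Z t + B * (2 * C / \<kappa> * E t)"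
      proof -
        have "1 + 2 * K\<^sup>2 \<le> B" "C \<le> B" using C1 unfolding B_def by auto
        then show ?thesis using nn C1 k0 by (intro add_mono mult_right_mono) auto
      qed
      finally show "Z' t + 2 * C / \<kappa> * E' t \<le> B * \<Psi> t + 0" by (simp add: \<Psi>_def distrib_left)
    qed
    then show ?thesis by (simp add: \<Psi>_def init)
  qed
  have Zb: "Z t \<le> exp (B * t) * (2 * C / \<kappa> * energy G u)" if "t \<ge> 0" for t
  proof -
    have "0 \<le> 2 * C / \<kappa> * E t" using C1 k0 nn by simp
    then show ?thesis using \<Psi>[OF that] unfolding \<Psi>_def by linarith
  qed
  from Zb[OF \<tau>]
  show "(norm (Pavg G (T \<tau> u) - exp_tQ G \<tau> (Pavg G u)))\<^sup>2 \<le> 2 * C * exp (B * \<tau>) * energy G u / \<kappa>"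
    unfolding Z_def c_def v_def y_def by (simp add: mult_ac)
  \<comment> \<open>Since Z starts at 0, the weight 2C/\<kappa> occurs on both sides of the bound
    for \<Psi> and cancels: the energy grows at a rate independent of \<kappa>.\<close>
  have Eb: "E t \<le> exp (B * t) * energy G u" if "t \<ge> 0" for t
  proof -
    have "2 * C / \<kappa> * E t \<le> 2 * C / \<kappa> * (exp (B * t) * energy G u)"
      using \<Psi>[OF that] nn(3)[of t] unfolding \<Psi>_def by (simp add: mult_ac)
    then show ?thesis using C1 k0 by (simp add: divide_simps)
  qed
  \<comment> \<open>A bound for \<open>2 * C * E t\<close> valid on the whole interval, which makes
    the inhomogeneity in Gronwall's inequality constant. Divided by the decay rate \<kappa>/C it
    yields the remainder of order 1/\<kappa>.\<close>
  define b where "b = 2 * C * (exp (B * \<tau>) * energy G u)"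
  have b0: "b \<ge> 0" unfolding b_def using C1 energy_nonneg[OF net] by simp
  have "W \<tau> + b / (- (\<kappa> / C)) \<le> exp (- (\<kappa> / C) * \<tau>) * (W 0 + b / (- (\<kappa> / C)))"
  proof (rule gronwall[OF \<tau> _ cW])
    show "- (\<kappa> / C) \<noteq> 0" using k0 C1 by simp
    fix t assume t: "0 < t" "t < \<tau>"
    show "(W has_real_derivative E' t - S' t) (at t)" by (rule dW[OF t(1)])
    obtain N where N: "N \<ge> 0" "E' t \<le> - 2 * \<kappa> * N + C * (E t + N)" "W t \<le> C * N" "- S' t \<le> C * (E t + N)"
      using st[OF t(1)] by blast
    \<comment> \<open>Both \<open>E'\<close> and \<open>- S'\<close> contribute C N, so here the
      full threshold on \<kappa> is used; the remaining \<kappa> N dominates \<kappa>/C times the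
      fluctuation.\<close>
    have "2 * C * N \<le> \<kappa> * N" using k N(1) by (intro mult_right_mono) auto
    then have "E' t - S' t \<le> - \<kappa> * N + 2 * C * E t" using N(2,4) by (simp add: algebra_simps)
    moreover have "\<kappa> / C * W t \<le> \<kappa> * N"
      using mult_left_mono[OF N(3), of "\<kappa> / C"] k0 C1 by simp
    moreover have "2 * C * E t \<le> b"
    proof -
      have "E t \<le> exp (B * t) * energy G u" using Eb t by simp
      also have "\<dots> \<le> exp (B * \<tau>) * energy G u"
        using t B1 energy_nonneg[OF net] by (intro mult_right_mono) auto
      finally show ?thesis unfolding b_def using C1 by (intro mult_left_mono) auto
    qed
    ultimately show "E' t - S' t \<le> - (\<kappa> / C) * W t + b" by simp
  qed
  then have "W \<tau> \<le> exp (- (\<kappa> / C * \<tau>)) * W 0 + b * C / \<kappa> - exp (- (\<kappa> / C * \<tau>)) * (b * C / \<kappa>)"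
    by (simp add: algebra_simps)
  moreover have "0 \<le> exp (- (\<kappa> / C * \<tau>)) * (b * C / \<kappa>)" using b0 C1 k0 by simp
  moreover have "b * C / \<kappa> = 2 * C\<^sup>2 * exp (B * \<tau>) * energy G u / \<kappa>"
    by (simp add: b_def power2_eq_square mult_ac)
  ultimately show "fluct G (T \<tau> u) \<le> exp (- (\<kappa> / C * \<tau>)) * fluct G u + 2 * C\<^sup>2 * exp (B * \<tau>) * energy G u / \<kappa>"
    using init(2) unfolding W_def v_def by simp
qed

end

section \<open>Density of the domain and convergence\<close>

lemma polynomial_H2_rep:
  assumes D: "D > 0" and v: "polynomial_function v"
    and v': "polynomial_function v'" "\<And>x. (v has_vector_derivative v' x) (at x)"
    and v'': "polynomial_function v''" "\<And>x. (v' has_vector_derivative v'' x) (at x)"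
  shows "H2_rep D v v v' v''"
proof -
  have FTC: "g x = g 0 + prim g' x"
    if "polynomial_function g'" "\<And>x. (g has_vector_derivative g' x) (at x)" "x \<in> {0..D}"
    for g g' :: "real \<Rightarrow> complex" and x
  proof -
    have "(g' has_integral (g x - g 0)) {0..x}"
      using that by (intro fundamental_theorem_of_calculus) (auto intro: has_vector_derivative_at_within)
    moreover have "prim g' x = integral {0..x} g'"
      unfolding prim_def by (intro integral_lebI_continuous continuous_on_polymonial_function that)
    ultimately show ?thesis by (simp add: integral_unique)
  qed
  show ?thesis
    unfolding H2_rep_def using FTC[OF v'] FTC[OF v''] L2I_polynomial[OF v] L2I_polynomial[OF v''(1)]
    by blast
qed

text \<open>If the values and the derivatives vanish at all ends, both sides of each boundary
  condition are 0. Such functions lie in the domain for every \<kappa>, which settles density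
  without solving any boundary system.\<close>

lemma H2_rep_in_dom:
  fixes G :: "('e::finite) network"
  assumes net: "is_network G"
    and rep: "\<And>i. H2_rep (len G i) (v i) (f i) (p i) (z i)"
    and bc: "\<And>i. f i 0 = 0" "\<And>i. f i (len G i) = 0" "\<And>i. p i 0 = 0" "\<And>i. p i (len G i) = 0"
  shows "v \<in> dom_Astar G \<kappa>"
proof -
  note len = net_len[OF net]
  have e: "0 \<in> {0..len G i}" "len G i \<in> {0..len G i}" for i using len[of i] by auto
  have "at_L G v = (\<lambda>i. 0)" "at_R G v = (\<lambda>i. 0)" "at_L G (Diff G v) = (\<lambda>i. 0)" "at_R G (Diff G v) = (\<lambda>i. 0)"
    unfolding at_L_def at_R_def Diff_def
    using H2_rep_cval[OF len rep e(1)] H2_rep_cval[OF len rep e(2)] bc by auto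
  moreover have "v \<in> H2S (len G)"
  proof -
    have "v \<in> L2S (len G)" "p \<in> L2S (len G)" "z \<in> L2S (len G)"
      using H2_rep_u[OF len rep] H2_rep_L2I[OF len rep] H2_rep_z[OF len rep] by (auto simp: L2S_def)
    moreover have "has_weak_deriv (len G i) (v i) (p i)" "has_weak_deriv (len G i) (p i) (z i)" for i
      using H2_rep_weak[OF len rep] by auto
    ultimately show ?thesis unfolding H2S_def by blast
  qed
  ultimately show ?thesis by (simp add: dom_Astar_def F_L_def F_R_def)
qed

text \<open>With \<open>s x = (x (D - x))\<^sup>2\<close>, every \<open>s P\<close> with \<open>P\<close> a polynomial has double zeros at both ends, and
  \<open>s g / (s + 1/n)\<close> tends to \<open>g\<close>.\<close>

lemma double_zero_approx:
  assumes D: "D > 0" and f: "f \<in> L2I D" and e: "e > 0"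
  shows "\<exists>v v' v''. H2_rep D v v v' v'' \<and> v 0 = 0 \<and> v D = 0 \<and> v' 0 = 0 \<and> v' D = 0
    \<and> nrm D (\<lambda>x. v x - f x) < e"
proof -
  define s where "s x = (x * (D - x))\<^sup>2" for x :: real
  have sc: "continuous_on A s" for A unfolding s_def by (intro continuous_intros)
  obtain g where g: "polynomial_function g" "nrm D (\<lambda>x. f x - g x) < e / 3"
    using L2I_approx_polynomial[OF D f, of "e/3"] e by auto
  have gL: "g \<in> L2I D" by (rule L2I_polynomial[OF g(1)])
  have gc: "continuous_on A g" for A by (rule continuous_on_polymonial_function[OF g(1)])
  define h where "h n x = (s x / (s x + 1 / (real n + 1))) *\<^sub>R g x" for n x
  have pos: "s x + 1 / (real n + 1) > 0" for x n
    unfolding s_def by (intro add_nonneg_pos) auto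
  then have ne: "s x + 1 / (real n + 1) \<noteq> 0" for x n by (metis less_irrefl)
  have hc: "continuous_on {0..D} (h n)" for n
    unfolding h_def by (intro continuous_intros sc gc) (use ne in auto)
  have "(\<lambda>n. nrm D (\<lambda>x. h n x - g x)) \<longlonglongrightarrow> 0"
  proof (rule nrm_dominated_convergence[where g=g])
    show "AE x in lebI D. (\<lambda>n. h n x) \<longlonglongrightarrow> g x"
    proof (rule AE_lebI_open)
      fix x assume "0 < x" "x < D"
      then have s0: "s x > 0" by (simp add: s_def)
      have "(\<lambda>n. (s x / (s x + 1 / (real n + 1))) *\<^sub>R g x) \<longlonglongrightarrow> (s x / (s x + 0)) *\<^sub>R g x"
        using s0 LIMSEQ_inverse_real_of_nat
        by (intro tendsto_intros) (auto simp: inverse_eq_divide add.commute)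
      then show "(\<lambda>n. h n x) \<longlonglongrightarrow> g x" using s0 by (simp add: h_def)
    qed
    fix n x
    have "h n x - g x = (s x / (s x + 1 / (real n + 1)) - 1) *\<^sub>R g x"
      by (simp add: h_def scaleR_diff_left)
    then have "cmod (h n x - g x) = \<bar>s x / (s x + 1 / (real n + 1)) - 1\<bar> * cmod (g x)" by simp
    also have "\<dots> \<le> 1 * cmod (g x)"
    proof (rule mult_right_mono)
      have "s x \<ge> 0" by (simp add: s_def)
      then have "0 \<le> s x / (s x + 1 / (real n + 1))" "s x / (s x + 1 / (real n + 1)) \<le> 1"
        using pos[of x n] by (auto intro: divide_nonneg_pos simp: divide_le_eq)
      then show "\<bar>s x / (s x + 1 / (real n + 1)) - 1\<bar> \<le> 1" by linarith
    qed simp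
    finally show "cmod (h n x - g x) \<le> cmod (g x)" by simp
  qed (use gL continuous_imp_measurable_lebI[OF hc] in auto)
  then have "\<forall>\<^sub>F n in sequentially. nrm D (\<lambda>x. h n x - g x) < e / 3"
    using e by (intro order_tendstoD(2)[of _ 0]) auto
  then obtain n where n: "nrm D (\<lambda>x. h n x - g x) < e / 3" by (auto simp: eventually_sequentially)
  obtain S where S: "\<And>x. x \<in> {0..D} \<Longrightarrow> s x \<le> S" "S > 0"
  proof -
    have "s x \<le> (D * D)\<^sup>2" if "x \<in> {0..D}" for x
      unfolding s_def using that by (intro power_mono mult_mono) auto
    then show ?thesis using that[of "(D * D)\<^sup>2"] D by auto
  qed
  \<comment> \<open>The error of P is multiplied by s, hence by at most S, and integration costs
    \<open>sqrt D\<close>; altogether at most e/4.\<close>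
  define \<delta> where "\<delta> = e / (4 * sqrt D * S)"
  have \<delta>: "\<delta> > 0" using e D S by (simp add: \<delta>_def)
  \<comment> \<open>The polynomial approximates the factor \<open>g / (s + 1/(n+1))\<close> and is
    multiplied by s afterwards; approximating the product itself would lose the double zeros at the
    ends.\<close>
  have "continuous_on {0..D} (\<lambda>x. (1 / (s x + 1 / (real n + 1))) *\<^sub>R g x)"
    by (intro continuous_intros sc gc) (use ne in auto)
  from Stone_Weierstrass_polynomial_function[OF compact_Icc this \<delta>]
  obtain P where P: "polynomial_function P"
    "\<And>x. x \<in> {0..D} \<Longrightarrow> cmod ((1 / (s x + 1 / (real n + 1))) *\<^sub>R g x - P x) < \<delta>" by metis
  define v where "v x = s x *\<^sub>R P x" for x
  have sp: "polynomial_function s"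
    unfolding s_def power2_eq_square real_scaleR_def[symmetric]
    by (intro polynomial_function_mult polynomial_function_diff polynomial_function_id polynomial_function_const)
  have vp: "polynomial_function v"
    unfolding v_def by (intro polynomial_function_mult sp P)
  have vL: "v \<in> L2I D" by (rule L2I_polynomial[OF vp])
  have hL: "h n \<in> L2I D" by (rule L2I_continuous[OF hc])
  have "nrm D (\<lambda>x. v x - h n x) \<le> sqrt D * (S * \<delta>)"
  proof (rule nrm_bound)
    fix x assume x: "x \<in> {0..D}"
    have "v x - h n x = s x *\<^sub>R (P x - (1 / (s x + 1 / (real n + 1))) *\<^sub>R g x)"
      by (simp add: v_def h_def scaleR_diff_right)
    then have "cmod (v x - h n x) = s x * cmod ((1 / (s x + 1 / (real n + 1))) *\<^sub>R g x - P x)"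
      by (simp add: s_def norm_minus_commute)
    also have "\<dots> \<le> S * \<delta>"
      using S(1)[OF x] P(2)[OF x] S(2) by (intro mult_mono) (auto simp: s_def)
    finally show "cmod (v x - h n x) \<le> S * \<delta>" .
  qed (use D S \<delta> L2I_meas[OF L2I_diff[OF vL hL]] in auto)
  also have "\<dots> < e / 3" using D S e by (simp add: \<delta>_def)
  finally have vh: "nrm D (\<lambda>x. v x - h n x) < e / 3" .
  have "nrm D (\<lambda>x. v x - f x) \<le> nrm D (\<lambda>x. v x - h n x) + nrm D (\<lambda>x. h n x - f x)"
    using nrm_triangle[OF L2I_diff[OF vL hL] L2I_diff[OF hL f]] by simp
  also have "nrm D (\<lambda>x. h n x - f x) \<le> nrm D (\<lambda>x. h n x - g x) + nrm D (\<lambda>x. g x - f x)"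
    using nrm_triangle[OF L2I_diff[OF hL gL] L2I_diff[OF gL f]] by simp
  finally have close: "nrm D (\<lambda>x. v x - f x) < e"
    using vh n g(2) nrm_minus_commute[of D f g] by simp
  obtain v' where v': "polynomial_function v'" "\<And>x. (v has_vector_derivative v' x) (at x)"
    using has_vector_derivative_polynomial_function[OF vp] by blast
  obtain v'' where v'': "polynomial_function v''" "\<And>x. (v' has_vector_derivative v'' x) (at x)"
    using has_vector_derivative_polynomial_function[OF v'(1)] by blast
  obtain P' where P': "\<And>x. (P has_vector_derivative P' x) (at x)"
    using has_vector_derivative_polynomial_function[OF P(1)] by blast
  have ds: "(s has_real_derivative 2 * (x * (D - x)) * (D - 2 * x)) (at x)" for x
    unfolding s_def by (auto intro!: derivative_eq_intros simp: algebra_simps)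
  \<comment> \<open>The abstract derivative v' is identified by the product rule, because both s and
    its derivative vanish at 0 and at D.\<close>
  have "(v has_vector_derivative s x *\<^sub>R P' x + (2 * (x * (D - x)) * (D - 2 * x)) *\<^sub>R P x) (at x)" for x
    unfolding v_def by (rule has_vector_derivative_scaleR[OF ds P'])
  then have "v' x = s x *\<^sub>R P' x + (2 * (x * (D - x)) * (D - 2 * x)) *\<^sub>R P x" for x
    using vector_derivative_unique_at v'(2) by blast
  then have "v' 0 = 0" "v' D = 0" by (auto simp: s_def)
  moreover have "v 0 = 0" "v D = 0" by (auto simp: v_def s_def)
  ultimately show ?thesis using polynomial_H2_rep[OF D vp v' v''] close by blast
qed

lemma dom_Astar_dense:
  fixes G :: "('e::finite) network"
  assumes net: "is_network G" and u: "u \<in> L2S (len G)" and e: "e > 0"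
  shows "\<exists>v\<in>dom_Astar G \<kappa>. L2_dist (len G) v u < e"
proof -
  \<comment> \<open>The summand 1 makes the sum of the edgewise errors strictly smaller than
    e.\<close>
  define \<delta> where "\<delta> = e / (real CARD('e) + 1)"
  have \<delta>: "\<delta> > 0" using e by (simp add: \<delta>_def)
  have "\<forall>i. \<exists>v v' v''. H2_rep (len G i) v v v' v'' \<and> v 0 = 0 \<and> v (len G i) = 0 \<and> v' 0 = 0 \<and> v' (len G i) = 0
    \<and> nrm (len G i) (\<lambda>x. v x - u i x) < \<delta>"
    using double_zero_approx[OF net_len[OF net] L2S_D[OF u] \<delta>] by blast
  from choice[OF this] obtain v where "\<forall>i. \<exists>v' v''. H2_rep (len G i) (v i) (v i) v' v'' \<and> v i 0 = 0
    \<and> v i (len G i) = 0 \<and> v' 0 = 0 \<and> v' (len G i) = 0 \<and> nrm (len G i) (\<lambda>x. v i x - u i x) < \<delta>" ..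
  from choice[OF this] obtain v' where "\<forall>i. \<exists>v''. H2_rep (len G i) (v i) (v i) (v' i) v'' \<and> v i 0 = 0
    \<and> v i (len G i) = 0 \<and> v' i 0 = 0 \<and> v' i (len G i) = 0 \<and> nrm (len G i) (\<lambda>x. v i x - u i x) < \<delta>" ..
  from choice[OF this] obtain v'' where all: "\<forall>i. H2_rep (len G i) (v i) (v i) (v' i) (v'' i) \<and> v i 0 = 0
    \<and> v i (len G i) = 0 \<and> v' i 0 = 0 \<and> v' i (len G i) = 0 \<and> nrm (len G i) (\<lambda>x. v i x - u i x) < \<delta>" ..
  have v: "\<And>i. H2_rep (len G i) (v i) (v i) (v' i) (v'' i)"
    "\<And>i. v i 0 = 0" "\<And>i. v i (len G i) = 0" "\<And>i. v' i 0 = 0" "\<And>i. v' i (len G i) = 0"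
    and close: "\<And>i. nrm (len G i) (\<lambda>x. v i x - u i x) < \<delta>" using all by auto
  have "L2_dist (len G) v u \<le> (\<Sum>i\<in>(UNIV::'e set). nrm (len G i) (\<lambda>x. v i x - u i x))"
    unfolding L2_dist_def L2_norm_L2_set by (rule L2_set_le_sum) simp
  also have "\<dots> \<le> (\<Sum>i\<in>(UNIV::'e set). \<delta>)"
    by (intro sum_mono less_imp_le close)
  also have "\<dots> < e" using e by (simp add: \<delta>_def field_simps)
  finally show ?thesis using H2_rep_in_dom[OF net v] by blast
qed

section \<open>Passage from the domain to arbitrary initial values\<close>

context
  fixes G :: "('e::finite) network" and v :: "nat \<Rightarrow> 'e edgefun" and u :: "'e edgefun"
  assumes net: "is_network G" and vL: "\<And>m. v m \<in> L2S (len G)" and u: "u \<in> L2S (len G)"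
    and lim: "(\<lambda>m. L2_dist (len G) (v m) u) \<longlonglongrightarrow> 0"
begin

lemma energy_tendsto: "(\<lambda>m. energy G (v m)) \<longlonglongrightarrow> energy G u"
proof -
  have "(\<lambda>m. nrm (len G i) (v m i)) \<longlonglongrightarrow> nrm (len G i) (u i)" for i
    by (rule LIM_zero_cancel, rule Lim_null_comparison[OF always_eventually lim], rule allI)
      (simp only: real_norm_def nrm_component_dist[OF vL u])
  then show ?thesis
    unfolding energy_def using net_sig[OF net] by (intro tendsto_intros) (simp_all add: less_imp_neq[symmetric])
qed

lemma Pavg_tendsto: "(\<lambda>m. Pavg G (v m)) \<longlonglongrightarrow> Pavg G u"
proof (rule vec_tendstoI, rule LIM_zero_cancel, rule Lim_null_comparison)
  fix i
  show "(\<lambda>m. L2_dist (len G) (v m) u / sqrt (len G i)) \<longlonglongrightarrow> 0"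
    by (rule tendsto_divide_zero[OF lim])
  show "\<forall>\<^sub>F m in sequentially. norm (Pavg G (v m) $ i - Pavg G u $ i) \<le> L2_dist (len G) (v m) u / sqrt (len G i)"
    by (intro always_eventually allI Pavg_diff_bound[OF net] vL u)
qed

lemma fluct_tendsto: "(\<lambda>m. fluct G (v m)) \<longlonglongrightarrow> fluct G u"
  unfolding fluct_energy[OF net vL] fluct_energy[OF net u]
  by (intro tendsto_intros energy_tendsto tendsto_vec_nth Pavg_tendsto)

end

lemma edge_const_L2S: "edge_const c \<in> L2S d"
  by (simp add: edge_const_def L2S_def L2I_const)

lemma dist_edge_const_tendsto:
  fixes G :: "('e::finite) network" and c :: "nat \<Rightarrow> complex^'e"
  assumes net: "is_network G" and "c \<longlonglongrightarrow> c'"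
  shows "(\<lambda>m. L2_dist (len G) (edge_const (c m)) (edge_const c')) \<longlonglongrightarrow> 0"
proof -
  have e: "L2_dist (len G) (edge_const (c m)) (edge_const c')
    = L2_set (\<lambda>i. sqrt (len G i) * cmod (c m $ i - c' $ i)) UNIV" for m
    unfolding L2_dist_def L2_norm_L2_set edge_const_def
    using nrm_const[OF less_imp_le[OF net_len[OF net]]] by simp
  have "(\<lambda>m. L2_set (\<lambda>i. sqrt (len G i) * cmod (c m $ i - c' $ i)) UNIV)
      \<longlonglongrightarrow> L2_set (\<lambda>i. sqrt (len G i) * cmod (c' $ i - c' $ i)) UNIV"
    unfolding L2_set_def by (intro tendsto_intros tendsto_vec_nth assms)
  then show ?thesis by (simp add: e L2_set_def)
qed

lemma exp_tQ_tendsto: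
  assumes "c \<longlonglongrightarrow> c'" shows "(\<lambda>m. exp_tQ G t (c m)) \<longlonglongrightarrow> exp_tQ G t c'"
proof -
  obtain L where L: "\<And>c. norm (exp_tQ G t c) \<le> L * norm c" using exp_tQ_bound by blast
  show ?thesis
  proof (rule LIM_zero_cancel, rule Lim_null_comparison[OF always_eventually], rule allI)
    show "norm (exp_tQ G t (c m) - exp_tQ G t c') \<le> L * norm (c m - c')" for m
      using L[of "c m - c'"] by (simp add: exp_tQ_diff)
    have "(\<lambda>m. c m - c') \<longlonglongrightarrow> 0" by (rule LIM_zero[OF assms])
    then show "(\<lambda>m. L * norm (c m - c')) \<longlonglongrightarrow> 0"
      by (intro tendsto_mult_right_zero tendsto_norm_zero)
  qed
qed

text \<open>The right side depends on u only through energy and fluctuation, which are continuous in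
  L2, so the estimate survives approximation of u from the domain. The constants are chosen before
  \<kappa>, the semigroup, u and t, and this is what permits the limit in n.\<close>

lemma semigroup_estimate:
  fixes G :: "('e::finite) network"
  assumes net: "is_network G"
  shows "\<exists>C\<ge>1. \<exists>B\<ge>0. \<exists>M\<ge>0. \<forall>\<kappa> T u t. generates (len G) (dom_Astar G \<kappa>) (Astar G \<kappa>) T \<and> \<kappa> \<ge> 2 * C
    \<and> u \<in> L2S (len G) \<and> t \<ge> 0 \<longrightarrow>
    (L2_dist (len G) (T t u) (edge_const (exp_tQ G t (Pavg G u))))\<^sup>2
      \<le> M * (exp (- (\<kappa> / C * t)) * fluct G u + 4 * C\<^sup>2 * exp (B * t) * energy G u / \<kappa>)"
proof -
  obtain C where C: "C \<ge> 1" and static: "\<And>\<kappa> v. \<kappa> > 0 \<Longrightarrow> v \<in> dom_Astar G \<kappa> \<Longrightarrow> energy_bounds G \<kappa> C v"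
    using static_estimates[OF net] by blast
  obtain K where K: "K \<ge> 0" "\<And>c. norm (Qop G c) \<le> K * norm c" using Qop_bound by blast
  obtain M where M: "netbound G M" using netbound_exists by blast
  have M0: "M \<ge> 0" using M by (auto simp: netbound_def)
  define B where "B = 1 + 2 * K\<^sup>2 + C"
  have B0: "B \<ge> 0" using C by (simp add: B_def)
  define rhs where "rhs \<kappa> u t = M * (exp (- (\<kappa> / C * t)) * fluct G u + 4 * C\<^sup>2 * exp (B * t) * energy G u / \<kappa>)"
    for \<kappa> t and u :: "'e edgefun"
  have "(L2_dist (len G) (T t u) (edge_const (exp_tQ G t (Pavg G u))))\<^sup>2 \<le> rhs \<kappa> u t"
    if gen: "generates (len G) (dom_Astar G \<kappa>) (Astar G \<kappa>) T" and k: "\<kappa> \<ge> 2 * C"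
      and u: "u \<in> L2S (len G)" and t: "t \<ge> 0" for \<kappa> T u t
  proof -
    have k0: "\<kappa> > 0" using k C by linarith
    have c0: "C0_semigroup (len G) T" using gen by (simp add: generates_def)
    have dom: "(L2_dist (len G) (T t v) (edge_const (exp_tQ G t (Pavg G v))))\<^sup>2 \<le> rhs \<kappa> v t"
      if v: "v \<in> dom_Astar G \<kappa>" for v
    proof -
      have vL: "v \<in> L2S (len G)" using v by (simp add: dom_Astar_def H2S_def)
      have f: "fluct G (T t v) \<le> exp (- (\<kappa> / C * t)) * fluct G v + 2 * C\<^sup>2 * exp (B * t) * energy G v / \<kappa>"
       and z: "(norm (Pavg G (T t v) - exp_tQ G t (Pavg G v)))\<^sup>2 \<le> 2 * C * exp (B * t) * energy G v / \<kappa>"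
        unfolding B_def using trajectory_estimate[OF net gen C static[OF k0] K k v t] by auto
      \<comment> \<open>Raises the coefficient 2 C of the mean error to that of the fluctuation; the
        two remainders then add up to \<open>4 * C\<^sup>2\<close>.\<close>
      have "C \<le> C\<^sup>2" using C by (simp add: power2_eq_square)
      then have "2 * C * (exp (B * t) * energy G v / \<kappa>) \<le> 2 * C\<^sup>2 * (exp (B * t) * energy G v / \<kappa>)"
        using k0 energy_nonneg[OF net, of v] by (intro mult_right_mono) auto
      then have "fluct G (T t v) + (norm (Pavg G (T t v) - exp_tQ G t (Pavg G v)))\<^sup>2
          \<le> exp (- (\<kappa> / C * t)) * fluct G v + 4 * C\<^sup>2 * exp (B * t) * energy G v / \<kappa>"
        using f z unfolding times_divide_eq_right[symmetric] mult.assoc by linarith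
      then show ?thesis
        unfolding rhs_def using dist_edge_const_le[OF net T_L2S[OF c0 t vL] M] M0
        by (meson mult_left_mono order_trans)
    qed
    have "\<forall>m. \<exists>v\<in>dom_Astar G \<kappa>. L2_dist (len G) v u < inverse (real (Suc m))"
      using dom_Astar_dense[OF net u] by simp
    then obtain v where v: "\<And>m. v m \<in> dom_Astar G \<kappa>" "\<And>m. L2_dist (len G) (v m) u < inverse (real (Suc m))"
      by metis
    have vL: "v m \<in> L2S (len G)" for m using v(1)[of m] by (simp add: dom_Astar_def H2S_def)
    have lim: "(\<lambda>m. L2_dist (len G) (v m) u) \<longlonglongrightarrow> 0"
      by (rule tendsto_sandwich[OF _ _ tendsto_const LIMSEQ_inverse_real_of_nat])
        (auto intro!: always_eventually less_imp_le v(2) simp del: of_nat_Suc)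
    \<comment> \<open>This bound may depend on \<kappa> and t; it only multiplies the distance from
      \<open>v m\<close> to u, which tends to 0 while both are fixed.\<close>
    obtain A where A: "\<And>w. w \<in> L2S (len G) \<Longrightarrow> L2_norm (len G) (T t w) \<le> A * L2_norm (len G) w"
      using T_bounded[OF c0 t] by blast
    let ?y = "\<lambda>w. edge_const (exp_tQ G t (Pavg G w))"
    have le: "L2_dist (len G) (T t u) (?y u) \<le> A * L2_dist (len G) (v m) u + sqrt (rhs \<kappa> (v m) t)
        + L2_dist (len G) (?y (v m)) (?y u)" for m
    proof -
      have Tu: "T t u \<in> L2S (len G)" "T t (v m) \<in> L2S (len G)" using T_L2S[OF c0 t] u vL by auto
      have "L2_dist (len G) (T t u) (?y u) \<le> L2_dist (len G) (T t u) (T t (v m)) + L2_dist (len G) (T t (v m)) (?y u)"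
        by (rule L2_dist_triangle[OF Tu edge_const_L2S])
      also have "L2_dist (len G) (T t (v m)) (?y u) \<le> L2_dist (len G) (T t (v m)) (?y (v m)) + L2_dist (len G) (?y (v m)) (?y u)"
        by (rule L2_dist_triangle[OF Tu(2) edge_const_L2S edge_const_L2S])
      also have "L2_dist (len G) (T t (v m)) (?y (v m)) \<le> sqrt (rhs \<kappa> (v m) t)"
        by (rule real_le_rsqrt[OF dom[OF v(1)]])
      also have "L2_dist (len G) (T t u) (T t (v m)) \<le> A * L2_dist (len G) (v m) u"
        using T_dist_bound[OF c0 t A vL u] by (simp add: L2_dist_commute[of _ "T t u"])
      finally show ?thesis by simp
    qed
    have "(\<lambda>m. A * L2_dist (len G) (v m) u + sqrt (rhs \<kappa> (v m) t) + L2_dist (len G) (?y (v m)) (?y u))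
        \<longlonglongrightarrow> A * 0 + sqrt (rhs \<kappa> u t) + 0"
      unfolding rhs_def using k0
      by (intro tendsto_intros lim energy_tendsto[OF net vL u lim] fluct_tendsto[OF net vL u lim]
          dist_edge_const_tendsto[OF net] exp_tQ_tendsto Pavg_tendsto[OF net vL u lim]) simp
    then have "L2_dist (len G) (T t u) (?y u) \<le> A * 0 + sqrt (rhs \<kappa> u t) + 0"
      by (rule LIMSEQ_le_const) (use le in blast)
    then have "L2_dist (len G) (T t u) (?y u) \<le> sqrt (rhs \<kappa> u t)" by simp
    moreover have "rhs \<kappa> u t \<ge> 0"
      unfolding rhs_def using M0 k0 fluct_nonneg[OF net, of u] energy_nonneg[OF net, of u] by simp
    ultimately show ?thesis by (metis L2_dist_nonneg power_mono real_sqrt_pow2)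
  qed
  then show ?thesis using C B0 M0 unfolding rhs_def by blast
qed

text \<open>The source of the stronger claim for edgewise constant initial values: there is no
  initial layer, so the estimate is uniform down to t = 0.\<close>

lemma fluct_L20S:
  assumes "u \<in> L20S (len G)" "is_network G"
  shows "fluct G u = 0"
proof -
  obtain c where c: "L2_eq (len G) u (edge_const c)" and u: "u \<in> L2S (len G)"
    using assms by (auto simp: L20S_def)
  have "nrm (len G i) (\<lambda>x. u i x - Pavg G u $ i) = 0" for i
  proof -
    have AE: "AE x in lebI (len G i). u i x = c $ i"
      using c by (simp add: L2_eq_def edge_const_def)
    have "lint (len G i) (u i) = lint (len G i) (\<lambda>x. c $ i)"
      using L2I_meas[OF L2S_D[OF u]] AE by (intro integral_cong_AE) auto
    then have P: "Pavg G u $ i = c $ i"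
      using measure_lebI[of "len G i"] net_len[OF assms(2), of i]
      by (simp add: Pavg_def scaleR_conv_of_real)
    have "AE x in lebI (len G i). u i x - Pavg G u $ i = 0"
      using AE by eventually_elim (simp add: P)
    then have "nrm (len G i) (\<lambda>x. u i x - Pavg G u $ i) = nrm (len G i) (\<lambda>x. 0)"
      by (rule nrm_cong_AE[OF _ L2I_meas[OF L2I_diff[OF L2S_D[OF u] L2I_const]]]) simp
    then show ?thesis by (simp add: nrm_def)
  qed
  then show ?thesis by (simp add: fluct_def)
qed

theorem theorem3p6:
  fixes G :: "('e::finite) network"
    and \<kappa> :: "nat \<Rightarrow> real"
    and T :: "nat \<Rightarrow> real \<Rightarrow> 'e edgefun \<Rightarrow> 'e edgefun"
  assumes "is_network G"
    and "\<And>n. \<kappa> n > 0"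
    and "incseq \<kappa>"
    and "filterlim \<kappa> at_top sequentially"
    and "\<And>n. generates (len G) (dom_Astar G (\<kappa> n)) (Astar G (\<kappa> n)) (T n)"
  shows "\<forall>u\<in>L2S (len G).
      (\<forall>t>0. (\<lambda>n. L2_dist (len G) (T n t u) (edge_const (exp_tQ G t (Pavg G u)))) \<longlonglongrightarrow> 0) \<and>
      (\<forall>K. compact K \<and> K \<subseteq> {0<..} \<longrightarrow>
         uniform_limit K (\<lambda>n t. L2_dist (len G) (T n t u) (edge_const (exp_tQ G t (Pavg G u))))
           (\<lambda>t. 0) sequentially) \<and>
      (u \<in> L20S (len G) \<longrightarrow>
         (\<lambda>n. L2_dist (len G) (T n 0 u) (edge_const (exp_tQ G 0 (Pavg G u)))) \<longlonglongrightarrow> 0 \<and>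
         (\<forall>K. compact K \<and> K \<subseteq> {0..} \<longrightarrow>
            uniform_limit K (\<lambda>n t. L2_dist (len G) (T n t u) (edge_const (exp_tQ G t (Pavg G u))))
              (\<lambda>t. 0) sequentially))"
proof
  fix u assume u: "u \<in> L2S (len G)"
  note net = assms(1)
  obtain C B M where C: "C \<ge> 1" and B: "B \<ge> 0" and M: "M \<ge> 0"
    and est: "\<And>\<kappa> T u t. generates (len G) (dom_Astar G \<kappa>) (Astar G \<kappa>) T \<Longrightarrow> \<kappa> \<ge> 2 * C
      \<Longrightarrow> u \<in> L2S (len G) \<Longrightarrow> t \<ge> 0 \<Longrightarrow>
      (L2_dist (len G) (T t u) (edge_const (exp_tQ G t (Pavg G u))))\<^sup>2
        \<le> M * (exp (- (\<kappa> / C * t)) * fluct G u + 4 * C\<^sup>2 * exp (B * t) * energy G u / \<kappa>)"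
    using semigroup_estimate[OF net] by blast
  let ?R = "\<lambda>n t. L2_dist (len G) (T n t u) (edge_const (exp_tQ G t (Pavg G u)))"
  \<comment> \<open>Serves all four claims. Either the times stay away from 0 or the fluctuation
    vanishes; in both cases the layer term tends to 0 uniformly on the interval.\<close>
  have unif: "uniform_limit K ?R (\<lambda>t. 0) sequentially"
    if K: "K \<subseteq> {a..b}" and a: "a \<ge> 0" and w: "a > 0 \<or> fluct G u = 0" for K a b
  proof (rule uniform_limitI)
    fix e :: real assume e: "e > 0"
    \<comment> \<open>The decaying exponential is largest at the left end a, the growing one at the
      right end b, so h bounds the squared error at all times in K.\<close>
    define h where "h n = M * (exp (- (\<kappa> n / C * a)) * fluct G u + 4 * C\<^sup>2 * exp (B * b) * energy G u / \<kappa> n)" for n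
    have 1: "(\<lambda>n. 4 * C\<^sup>2 * exp (B * b) * energy G u / \<kappa> n) \<longlonglongrightarrow> 0"
      by (rule tendsto_divide_0[OF tendsto_const filterlim_at_top_imp_at_infinity[OF assms(4)]])
    have 2: "(\<lambda>n. exp (- (\<kappa> n / C * a)) * fluct G u) \<longlonglongrightarrow> 0"
    proof (cases "fluct G u = 0")
      case False
      then have "a / C > 0" using w C by auto
      then have "filterlim (\<lambda>n. a / C * \<kappa> n) at_top sequentially"
        by (rule filterlim_tendsto_pos_mult_at_top[OF tendsto_const _ assms(4)])
      then have "(\<lambda>n. exp (- (a / C * \<kappa> n))) \<longlonglongrightarrow> 0"
        by (intro filterlim_compose[OF exp_at_bot]) (simp add: filterlim_uminus_at_bot)
      then have "(\<lambda>n. exp (- (\<kappa> n / C * a))) \<longlonglongrightarrow> 0" by (simp add: mult.commute)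
      then show ?thesis by (rule tendsto_mult_left_zero)
    qed simp
    have "h \<longlonglongrightarrow> M * (0 + 0)" unfolding h_def by (intro tendsto_intros 1 2)
    then have "\<forall>\<^sub>F n in sequentially. h n < e\<^sup>2" using e by (intro order_tendstoD(2)) auto
    moreover have "\<forall>\<^sub>F n in sequentially. \<kappa> n \<ge> 2 * C"
      using assms(4) by (simp add: filterlim_at_top)
    ultimately show "\<forall>\<^sub>F n in sequentially. \<forall>t\<in>K. dist (?R n t) 0 < e"
    proof eventually_elim
      case (elim n)
      show ?case
      proof
        fix t assume "t \<in> K"
        then have t: "a \<le> t" "t \<le> b" "0 \<le> t" using K a by auto
        have "(?R n t)\<^sup>2 \<le> M * (exp (- (\<kappa> n / C * t)) * fluct G u + 4 * C\<^sup>2 * exp (B * t) * energy G u / \<kappa> n)"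
          by (rule est[OF assms(5) elim(2) u t(3)])
        also have "\<dots> \<le> h n"
          unfolding h_def
        proof (intro mult_left_mono add_mono mult_right_mono divide_right_mono M)
          show "exp (- (\<kappa> n / C * t)) \<le> exp (- (\<kappa> n / C * a))"
            using t assms(2)[of n] C by (simp add: divide_right_mono mult_left_mono)
          show "exp (B * t) \<le> exp (B * b)" using t B by (simp add: mult_left_mono)
        qed (use fluct_nonneg[OF net, of u] energy_nonneg[OF net, of u] assms(2)[of n] in auto)
        also have "\<dots> < e\<^sup>2" by (rule elim(1))
        finally have "?R n t < e" by (rule power2_less_imp_less) (use e in simp)
        then show "dist (?R n t) 0 < e" by simp
      qed
    qed
  qed
  have bnd: "\<exists>a b. K \<subseteq> {a..b} \<and> a > 0" if cK: "compact K" and sK: "K \<subseteq> {0<..}" for K :: "real set"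
  proof (cases "K = {}")
    case False
    then obtain a where a: "a \<in> K" "\<And>t. t \<in> K \<Longrightarrow> a \<le> t" using compact_attains_inf[OF cK False] by blast
    obtain b where "\<And>t. t \<in> K \<Longrightarrow> t \<le> b" using compact_attains_sup[OF cK False] by blast
    with a sK show ?thesis by (intro exI[of _ a] exI[of _ b]) auto
  qed (auto intro: exI[of _ 1])
  have bnd0: "\<exists>b. K \<subseteq> {0..b}" if cK: "compact K" and sK: "K \<subseteq> {0..}" for K :: "real set"
  proof (cases "K = {}")
    case False
    obtain b where "\<And>t. t \<in> K \<Longrightarrow> t \<le> b" using compact_attains_sup[OF cK False] by blast
    with sK show ?thesis by (intro exI[of _ b]) auto
  qed auto
  show "(\<forall>t>0. (\<lambda>n. ?R n t) \<longlonglongrightarrow> 0) \<and>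
      (\<forall>K. compact K \<and> K \<subseteq> {0<..} \<longrightarrow> uniform_limit K ?R (\<lambda>t. 0) sequentially) \<and>
      (u \<in> L20S (len G) \<longrightarrow> (\<lambda>n. ?R n 0) \<longlonglongrightarrow> 0 \<and>
         (\<forall>K. compact K \<and> K \<subseteq> {0..} \<longrightarrow> uniform_limit K ?R (\<lambda>t. 0) sequentially))"
  proof (intro conjI allI impI)
    fix t :: real assume "t > 0"
    then have "uniform_limit {t} ?R (\<lambda>t. 0) sequentially" by (intro unif[of _ t t]) auto
    then show "(\<lambda>n. ?R n t) \<longlonglongrightarrow> 0" by (rule tendsto_uniform_limitI) simp
  next
    fix K :: "real set" assume "compact K \<and> K \<subseteq> {0<..}"
    then obtain a b where "K \<subseteq> {a..b}" "a > 0" using bnd by blast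
    then show "uniform_limit K ?R (\<lambda>t. 0) sequentially" by (intro unif[of K a b]) auto
  next
    assume u0: "u \<in> L20S (len G)"
    have "uniform_limit {0} ?R (\<lambda>t. 0) sequentially"
      using fluct_L20S[OF u0 net] by (intro unif[of _ 0 0]) auto
    then show "(\<lambda>n. ?R n 0) \<longlonglongrightarrow> 0" by (rule tendsto_uniform_limitI) simp
  next
    fix K :: "real set" assume u0: "u \<in> L20S (len G)" and "compact K \<and> K \<subseteq> {0..}"
    then obtain b where "K \<subseteq> {0..b}" using bnd0 by blast
    then show "uniform_limit K ?R (\<lambda>t. 0) sequentially"
      using fluct_L20S[OF u0 net] by (intro unif[of K 0 b]) auto
  qed
qed

end
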